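(* (Non-concentration property.) In each of the two settings described in the context: there exists $\delta\in(0,1)$ such that for all $x\in\Lambda$, all cylinders $\mathtt C\subset\Lambda$ containing $x$, and all $w\in\mathbb R^{n-1}$ with $\|w\|=1$, there exists $y\in\mathtt C\setminus B^{\mathrm E}_{\operatorname{diam}(\mathtt C)/4}(x)$ such that $|\langle y-x,w\rangle|\ge\delta\operatorname{diam}(\mathtt C)$.
   Context: $\mathbb N=\{1,2,\dots\}$. Upper half space model: $\mathbb H^n=\{x\in\mathbb R^n:x_n>0\}$, boundary $\mathbb R^{n-1}\cup\{\infty\}$, $o=e_n$. Schottky semigroup setting. $n\ge2$; $\mathbf G=\mathrm{SO}_Q<\mathrm{GL}_{n+1}$ over $\mathbb Q$ preserves $Q=x_1^2+\dots+x_n^2-x_{n+1}^2$; $G=\mathbf G(\mathbb R)^\circ$ is the group of orientation preserving isometries of $\mathbb H^n$. $N_0\in\mathbb N$, $0\le N_1\le N_0$, $N=N_0+N_1$, $D_1,\dots,D_{2N_0}\subset\mathbb R^{n-1}$ are mutually disjoint closed Euclidean balls; $\Gamma<G$ is a Zariski dense semigroup generated by hyperbolic elements $g_1,\dots,g_N$ with $g_j(\operatorname{ext}(D_{j+N_0}))=\operatorname{int}(D_j)$ for $1\le j\le N_0$ and $g_{N_0+j}=g_j^{-1}$ for $1\le j\le N_1$. (The paper also assumes that the $g_j$ lift to integral points of the simply connected cover of $\mathbf G$.) Continued fractions semigroup setting. $n=3$, $G=\mathrm{SL}_2(\mathbb C)$; $\mathsf A\subset\mathbb N+i\mathbb Z$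 finite, $\mathsf A\not\subset\mathbb N$; $g_a=\begin{pmatrix}0&1\\1&a\end{pmatrix}$, $g_{a,a'}=g_ag_{a'}$. $\Gamma<G$ is the semigroup generated by $\{g_{a,a'}:a,a'\in\mathsf A\}$, assumed Zariski dense. For $\varepsilon\in(0,\sqrt3-1)$ let $D^\varepsilon=\{\xi\in\mathbb C:\Re\xi\ge\varepsilon,\ |\xi-(2+\varepsilon)^{-1}|\le(2+\varepsilon)^{-1}\}$; fix $\varepsilon$ such that the sets $g_aD^\varepsilon$ ($a\in\mathsf A$) are mutually disjoint and contained in $\operatorname{int}(D^\varepsilon)$. With $N=(\#\mathsf A)^2$, relabel the generators $g_{a,a'}$ as $g_1,\dots,g_N$ and the sets $g_{a,a'}D^\varepsilon$ correspondingly as $D_1,\dots,D_N$. $D=\bigcup_{j=1}^ND_j$; $T(u)=g_j^{-1}u$ for $u\in D_j$. $\mathcal A=\{1,\dots,N\}$. A sequence in $\mathcal A$ is admissible if consecutive entries satisfy $|\alpha_{j+1}-\alpha_j|\ne N_0$ (Schottky), resp. always (continued fractions). $\Lambda\subset\mathbb R^{n-1}$ is the limit set of $\Gamma$ (limit points of $\Gamma o$ at infinity). For $k\ge0$ and an admissible sequence $\alpha=(\alpha_0,\dots,\alpha_k)$, the cylinder of length $k$ is $\mathtt C[\alpha]=\{x\in\Lambda:T^j(x)\in D_{\alpha_j}\text{ for }0\le j\le k\}$. Diameters, norms, inner products on $\mathbb R^{n-1}$ are Euclidean; $B^{\mathrm E}_r(x)$ is the open Euclidean ball. *)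

theory Defs
  imports "HOL-Analysis.Analysis"
begin

text \<open>
  The boundary \<open>\<real>\<^sup>n\<^sup>-\<^sup>1 \<union> {\<infinity>}\<close> of hyperbolic space is modelled by \<open>'a option\<close> with \<open>None\<close> as
  \<open>\<infinity>\<close>, and the upper half space by the set of pairs \<open>(\<xi>, t)\<close> with \<open>t > 0\<close>. Here \<open>'a\<close> is
  \<open>real ^ 'm\<close> with \<open>CARD('m) = n - 1\<close> (so \<open>n \<ge> 2\<close> is automatic), or \<open>complex\<close> when \<open>n = 3\<close>.
\<close>

definition upper_half_space :: "('a::euclidean_space \<times> real) set" where
  "upper_half_space = {x. snd x > 0}"

definition base_point :: "'a::euclidean_space \<times> real" where
  "base_point = (0, 1)"

text \<open>
  The points of \<open>\<real>\<^sup>n\<^sup>-\<^sup>1\<close> at which a subset of the upper half space accumulates. The possible limit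
  point \<open>\<infinity>\<close> is left out; it does not occur for the semigroups below.
\<close>

definition limit_points_at_infinity :: "('a::euclidean_space \<times> real) set \<Rightarrow> 'a set" where
  "limit_points_at_infinity X = {\<xi>. (\<xi>, 0) islimpt X}"

inductive_set generated_semigroup :: "('a::semiring_1 ^ 'n ^ 'n) set \<Rightarrow> ('a ^ 'n ^ 'n) set"
  for S :: "('a ^ 'n ^ 'n) set" where
    generator: "A \<in> S \<Longrightarrow> A \<in> generated_semigroup S"
  | product: "A \<in> generated_semigroup S \<Longrightarrow> B \<in> generated_semigroup S \<Longrightarrow>
      A ** B \<in> generated_semigroup S"

text \<open>
  Density in the Zariski topology of real algebraic groups. For complex matrices the polynomials
  are those in the real and imaginary parts of the entries.
\<close>

definition zariski_dense_in :: "'a::real_normed_vector set \<Rightarrow> 'a set \<Rightarrow> bool" where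
  "zariski_dense_in S G \<longleftrightarrow> S \<subseteq> G \<and>
     (\<forall>p. real_polynomial_function p \<longrightarrow> (\<forall>x\<in>S. p x = 0) \<longrightarrow> (\<forall>x\<in>G. p x = 0))"


section \<open>Coding\<close>

text \<open>
  \<open>F j\<close> stands for the action of \<open>g\<^sub>j\<^sup>-\<^sup>1\<close> on the boundary. The map is only meaningful on
  \<open>D\<^sub>1 \<union> \<dots> \<union> D\<^sub>N\<close>; the dummy value \<open>\<infinity>\<close> elsewhere lies in no \<open>D\<^sub>j\<close>.
\<close>

definition expanding_map ::
    "nat \<Rightarrow> (nat \<Rightarrow> 'a set) \<Rightarrow> (nat \<Rightarrow> 'a option \<Rightarrow> 'a option) \<Rightarrow> 'a option \<Rightarrow> 'a option" where
  "expanding_map N D F p = (case p of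
       None \<Rightarrow> None
     | Some u \<Rightarrow> if \<exists>j\<in>{1..N}. u \<in> D j then F (THE j. j \<in> {1..N} \<and> u \<in> D j) p else None)"

definition cylinder ::
    "'a set \<Rightarrow> (nat \<Rightarrow> 'a set) \<Rightarrow> ('a option \<Rightarrow> 'a option) \<Rightarrow> nat list \<Rightarrow> 'a set" where
  "cylinder \<Lambda> D T \<alpha> = {x \<in> \<Lambda>. \<forall>j<length \<alpha>. (T ^^ j) (Some x) \<in> Some ` D (\<alpha> ! j)}"


section \<open>The group \<open>SO\<^sub>Q(\<real>)\<^sup>\<circ>\<close> and its action\<close>

text \<open>
  Coordinates of \<open>\<real>\<^sup>n\<^sup>+\<^sup>1\<close>: \<open>Some (Some i)\<close> for the first \<open>n - 1\<close> ones, \<open>Some None\<close> for the \<open>n\<close>-th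
  and \<open>None\<close> for the last one.
\<close>

type_synonym 'm lorentz_vec = "real ^ 'm option option"
type_synonym 'm lorentz_mat = "real ^ 'm option option ^ 'm option option"

definition quadratic_form :: "('m::finite) lorentz_vec \<Rightarrow> real" where
  "quadratic_form x = (\<Sum>i\<in>UNIV. (x $ Some i)\<^sup>2) - (x $ None)\<^sup>2"

definition SO_Q :: "('m::finite) lorentz_mat set" where
  "SO_Q = {A. det A = 1 \<and> (\<forall>x. quadratic_form (A *v x) = quadratic_form x)}"

definition SO_Q_component :: "('m::finite) lorentz_mat set" where
  "SO_Q_component = connected_component_set SO_Q (mat 1)"

definition lorentz_vector :: "real ^ 'm \<Rightarrow> real \<Rightarrow> real \<Rightarrow> ('m::finite) lorentz_vec" where
  "lorentz_vector y a b = (\<chi> i. case i of None \<Rightarrow> b | Some None \<Rightarrow> a | Some (Some k) \<Rightarrow> y $ k)"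

text \<open>
  The isometry between the upper half space and the hyperboloid
  \<open>{v. quadratic_form v = -1, v $ None > 0}\<close>, and its inverse. The base point corresponds to the
  last standard basis vector.
\<close>

definition to_hyperboloid :: "(real ^ 'm) \<times> real \<Rightarrow> ('m::finite) lorentz_vec" where
  "to_hyperboloid = (\<lambda>(\<xi>, t). lorentz_vector (\<xi> /\<^sub>R t)
      (((norm \<xi>)\<^sup>2 + t\<^sup>2 - 1) / (2 * t)) (((norm \<xi>)\<^sup>2 + t\<^sup>2 + 1) / (2 * t)))"

definition of_hyperboloid :: "('m::finite) lorentz_vec \<Rightarrow> (real ^ 'm) \<times> real" where
  "of_hyperboloid v =
     ((\<chi> k. v $ Some (Some k) / (v $ None - v $ Some None)), 1 / (v $ None - v $ Some None))"

text \<open>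
  The induced identification of \<open>\<real>\<^sup>n\<^sup>-\<^sup>1 \<union> {\<infinity>}\<close> with the set of lines in the light cone: the limits of
  \<open>to_hyperboloid (\<xi>, t)\<close>, up to scaling, as \<open>t\<close> tends to \<open>0\<close>, respectively \<open>\<infinity>\<close>.
\<close>

fun to_light_cone :: "(real ^ 'm) option \<Rightarrow> ('m::finite) lorentz_vec" where
  "to_light_cone (Some \<xi>) = lorentz_vector (2 *\<^sub>R \<xi>) ((norm \<xi>)\<^sup>2 - 1) ((norm \<xi>)\<^sup>2 + 1)"
| "to_light_cone None = lorentz_vector 0 1 1"

definition of_light_cone :: "('m::finite) lorentz_vec \<Rightarrow> (real ^ 'm) option" where
  "of_light_cone v = (if v $ None = v $ Some None then None
     else Some (\<chi> k. v $ Some (Some k) / (v $ None - v $ Some None)))"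

definition lorentz_act :: "('m::finite) lorentz_mat \<Rightarrow> (real ^ 'm) \<times> real \<Rightarrow> (real ^ 'm) \<times> real" where
  "lorentz_act A x = of_hyperboloid (A *v to_hyperboloid x)"

definition lorentz_boundary_act ::
    "('m::finite) lorentz_mat \<Rightarrow> (real ^ 'm) option \<Rightarrow> (real ^ 'm) option" where
  "lorentz_boundary_act A p = of_light_cone (A *v to_light_cone p)"

text \<open>Hyperbolic isometries include those with a nontrivial rotational part (loxodromic ones).\<close>

definition hyperbolic :: "('m::finite) lorentz_mat \<Rightarrow> bool" where
  "hyperbolic A \<longleftrightarrow> (\<forall>x\<in>upper_half_space. lorentz_act A x \<noteq> x) \<and>
     card {p. lorentz_boundary_act A p = p} = 2"


section \<open>Schottky semigroups\<close>

text \<open>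
  No integrality of the generators is required. The exterior of a ball, a subset of
  \<open>\<real>\<^sup>n\<^sup>-\<^sup>1 \<union> {\<infinity>}\<close>, contains \<open>\<infinity>\<close>. The sets \<open>D j\<close> matter only for \<open>1 \<le> j \<le> 2 N\<^sub>0\<close>, the
  matrices \<open>g j\<close> only for \<open>1 \<le> j \<le> N\<^sub>0 + N\<^sub>1\<close>.
\<close>

locale schottky_semigroup =
  fixes N\<^sub>0 N\<^sub>1 :: nat
    and D :: "nat \<Rightarrow> (real ^ 'm::finite) set"
    and g :: "nat \<Rightarrow> 'm lorentz_mat"
  assumes N\<^sub>0_pos: "1 \<le> N\<^sub>0"
    and N\<^sub>1_le: "N\<^sub>1 \<le> N\<^sub>0"
    and closed_balls: "\<And>j. j \<in> {1..2 * N\<^sub>0} \<Longrightarrow> \<exists>c r. 0 < r \<and> D j = cball c r"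
    and disjoint_balls: "disjoint_family_on D {1..2 * N\<^sub>0}"
    and generators_in: "\<And>j. j \<in> {1..N\<^sub>0 + N\<^sub>1} \<Longrightarrow> g j \<in> SO_Q_component"
    and generators_hyperbolic: "\<And>j. j \<in> {1..N\<^sub>0 + N\<^sub>1} \<Longrightarrow> hyperbolic (g j)"
    and ext_to_int: "\<And>j. j \<in> {1..N\<^sub>0} \<Longrightarrow>
      lorentz_boundary_act (g j) ` (- Some ` D (j + N\<^sub>0)) = Some ` interior (D j)"
    and inverse_generators: "\<And>j. j \<in> {1..N\<^sub>1} \<Longrightarrow> g (N\<^sub>0 + j) = matrix_inv (g j)"
    and zariski_dense:
      "zariski_dense_in (generated_semigroup (g ` {1..N\<^sub>0 + N\<^sub>1})) SO_Q_component"

definition schottky_limit_set :: "nat \<Rightarrow> (nat \<Rightarrow> ('m::finite) lorentz_mat) \<Rightarrow> (real ^ 'm) set" where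
  "schottky_limit_set N g = limit_points_at_infinity
     ((\<lambda>\<gamma>. lorentz_act \<gamma> base_point) ` generated_semigroup (g ` {1..N}))"

definition schottky_admissible :: "nat \<Rightarrow> nat \<Rightarrow> nat list \<Rightarrow> bool" where
  "schottky_admissible N\<^sub>0 N\<^sub>1 \<alpha> \<longleftrightarrow> set \<alpha> \<subseteq> {1..N\<^sub>0 + N\<^sub>1} \<and>
     successively (\<lambda>a b. \<bar>int b - int a\<bar> \<noteq> int N\<^sub>0) \<alpha>"

text \<open>A cylinder of length \<open>k\<close> comes from a list of length \<open>k + 1\<close>.\<close>

definition schottky_cylinders ::
    "nat \<Rightarrow> nat \<Rightarrow> (nat \<Rightarrow> (real ^ 'm::finite) set) \<Rightarrow> (nat \<Rightarrow> 'm lorentz_mat) \<Rightarrow> (real ^ 'm) set set" where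
  "schottky_cylinders N\<^sub>0 N\<^sub>1 D g =
     cylinder (schottky_limit_set (N\<^sub>0 + N\<^sub>1) g) D
       (expanding_map (N\<^sub>0 + N\<^sub>1) D (\<lambda>j. lorentz_boundary_act (matrix_inv (g j))))
     ` {\<alpha>. \<alpha> \<noteq> [] \<and> schottky_admissible N\<^sub>0 N\<^sub>1 \<alpha>}"


section \<open>Continued fractions semigroups\<close>

definition SL2C :: "(complex ^ 2 ^ 2) set" where
  "SL2C = {M. det M = 1}"

fun moebius_act :: "complex ^ 2 ^ 2 \<Rightarrow> complex option \<Rightarrow> complex option" where
  "moebius_act M (Some z) = (if M $ 2 $ 1 * z + M $ 2 $ 2 = 0 then None
     else Some ((M $ 1 $ 1 * z + M $ 1 $ 2) / (M $ 2 $ 1 * z + M $ 2 $ 2)))"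
| "moebius_act M None = (if M $ 2 $ 1 = 0 then None else Some (M $ 1 $ 1 / M $ 2 $ 1))"

text \<open>The Poincare extension of the Moebius action of \<^term>\<open>SL2C\<close> to the upper half space.\<close>

definition poincare_act :: "complex ^ 2 ^ 2 \<Rightarrow> complex \<times> real \<Rightarrow> complex \<times> real" where
  "poincare_act M = (\<lambda>(z, t).
     let a = M $ 1 $ 1; b = M $ 1 $ 2; c = M $ 2 $ 1; d = M $ 2 $ 2;
         q = (cmod (c * z + d))\<^sup>2 + (cmod c)\<^sup>2 * t\<^sup>2
     in (((a * z + b) * cnj (c * z + d) + a * cnj c * of_real (t\<^sup>2)) / of_real q, t / q))"

definition cf_mat :: "complex \<Rightarrow> complex ^ 2 ^ 2" where
  "cf_mat a = vector [vector [0, 1], vector [1, a]]"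

definition cf_domain :: "real \<Rightarrow> complex set" where
  "cf_domain \<epsilon> = {\<xi>. Re \<xi> \<ge> \<epsilon> \<and> cmod (\<xi> - of_real (1 / (2 + \<epsilon>))) \<le> 1 / (2 + \<epsilon>)}"

text \<open>The bijection \<open>e\<close> is the relabelling of the pairs \<open>(a, a')\<close> by \<open>1, \<dots>, N\<close>.\<close>

definition cf_generator :: "(nat \<Rightarrow> complex \<times> complex) \<Rightarrow> nat \<Rightarrow> complex ^ 2 ^ 2" where
  "cf_generator e j = cf_mat (fst (e j)) ** cf_mat (snd (e j))"

definition cf_piece :: "real \<Rightarrow> (nat \<Rightarrow> complex \<times> complex) \<Rightarrow> nat \<Rightarrow> complex set" where
  "cf_piece \<epsilon> e j = {z. Some z \<in> moebius_act (cf_generator e j) ` Some ` cf_domain \<epsilon>}"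

locale continued_fractions_semigroup =
  fixes A :: "complex set" and \<epsilon> :: real and N :: nat and e :: "nat \<Rightarrow> complex \<times> complex"
  assumes finite_alphabet: "finite A"
    and alphabet: "A \<subseteq> {of_nat m + \<i> * of_int k | m k. 1 \<le> m}"
    and not_real: "\<not> A \<subseteq> {of_nat m | m. 1 \<le> m}"
    and \<epsilon>_range: "0 < \<epsilon>" "\<epsilon> < sqrt 3 - 1"
    and disjoint_images: "disjoint_family_on (\<lambda>a. moebius_act (cf_mat a) ` Some ` cf_domain \<epsilon>) A"
    and images_in_interior: "\<And>a. a \<in> A \<Longrightarrow>
      moebius_act (cf_mat a) ` Some ` cf_domain \<epsilon> \<subseteq> Some ` interior (cf_domain \<epsilon>)"
    and N_eq: "N = (card A)\<^sup>2"
    and relabelling: "bij_betw e {1..N} (A \<times> A)"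
    and zariski_dense: "zariski_dense_in (generated_semigroup (cf_generator e ` {1..N})) SL2C"

definition cf_limit_set :: "nat \<Rightarrow> (nat \<Rightarrow> complex \<times> complex) \<Rightarrow> complex set" where
  "cf_limit_set N e = limit_points_at_infinity
     ((\<lambda>\<gamma>. poincare_act \<gamma> base_point) ` generated_semigroup (cf_generator e ` {1..N}))"

definition cf_cylinders ::
    "real \<Rightarrow> nat \<Rightarrow> (nat \<Rightarrow> complex \<times> complex) \<Rightarrow> complex set set" where
  "cf_cylinders \<epsilon> N e =
     cylinder (cf_limit_set N e) (cf_piece \<epsilon> e)
       (expanding_map N (cf_piece \<epsilon> e) (\<lambda>j. moebius_act (matrix_inv (cf_generator e j))))
     ` {\<alpha>. \<alpha> \<noteq> [] \<and> set \<alpha> \<subseteq> {1..N}}"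

end

theory Submission
  imports Defs
begin

text \<open>
  A word \<open>\<alpha>\<close> acts on the limit points that may follow it by a Moebius map whose pole stays in a
  compact set away from these points, and the cylinder of \<open>\<alpha>\<close> is the image of these points. Up to
  scaling and isometries such a map is an inversion in its pole, so, after normalising, only a compact
  family of situations occurs. If the constants \<open>\<delta>\<close> degenerated, then in a limiting situation all
  points of the inverted limit set near the one farthest from \<open>x\<close> would lie in a hyperplane; undoing
  the inversion, an open piece of the limit set would lie in a sphere or a hyperplane, that is, in the
  zero set of a nonzero function \<open>\<alpha>\<bar>x\<bar>\<^sup>2 + \<langle>b, x\<rangle> + c\<close>.
  Such a function pulls back to a polynomial along orbits of the semigroup, so by Zariski density it
  would also vanish along the orbits of the whole group, which contains the translations.
\<close>

section \<open>Non-concentration for compact families of inversions\<close>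

text \<open>The constant 1/4 leaves room. For every \<open>x\<close> some point of a compact set
  lies at distance at least half the diameter, so all points near it stay beyond a quarter, and this
  strict inequality survives a passage to the limit. Since only a neighbourhood of that far point is
  available, flatness has to be excluded on every open piece of the limit set; each such piece
  contains the image of a whole word, which leads back to words.

  Two obstacles shape the rest. The limit set is defined by accumulation of an orbit and the
  cylinders by an expanding map; both are rewritten through images of words, because the orbit point
  of a word has height comparable to the diameter of its image and lies within a bounded multiple of
  that height from it. Secondly, Zariski density speaks of polynomials in the matrix, whereas the
  action has denominators and Schottky words may cancel. The denominators disappear in homogeneous
  coordinates (light cone vectors, or numerator and denominator); cancellation is met by a product
  of two linear factors, one of which vanishes wherever the orbit point lies.\<close>

definition quadric :: "real \<Rightarrow> 'a::euclidean_space \<Rightarrow> real \<Rightarrow> 'a \<Rightarrow> real" where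
  "quadric \<alpha> b c x = \<alpha> * (norm x)\<^sup>2 + b \<bullet> x + c"

lemma continuous_quadric: "continuous_on UNIV (quadric \<alpha> b c)"
  unfolding quadric_def by (intro continuous_intros)

text \<open>The values at \<open>x0\<close> and at the two points \<open>x0\<close> plus and minus
  \<open>(r/2) e\<close> separate the odd part, given by the gradient \<open>v\<close> at
  \<open>x0\<close>, from the even part, given by \<alpha>.\<close>

lemma quadric_zero_on_ball:
  assumes "0 < r" and zero: "\<And>x. x \<in> ball x0 r \<Longrightarrow> quadric \<alpha> b c x = 0"
  shows "\<alpha> = 0 \<and> b = 0 \<and> c = 0"
proof -
  define v where "v = (2 * \<alpha>) *\<^sub>R x0 + b"
  have expand: "quadric \<alpha> b c (x0 + s *\<^sub>R e) = quadric \<alpha> b c x0 + s * (v \<bullet> e) + \<alpha> * s\<^sup>2"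
    if "e \<in> Basis" for s and e :: 'a
    using that unfolding quadric_def v_def power2_norm_eq_inner
    by (simp add: inner_add inner_commute algebra_simps power2_eq_square)
  have both: "v \<bullet> e = 0 \<and> \<alpha> = 0" if e: "e \<in> Basis" for e
  proof -
    have "quadric \<alpha> b c (x0 + (r/2) *\<^sub>R e) = 0" "quadric \<alpha> b c (x0 + (- r/2) *\<^sub>R e) = 0"
      "quadric \<alpha> b c x0 = 0"
      using \<open>0 < r\<close> e by (auto intro!: zero simp: dist_norm)
    then have "r/2 * (v \<bullet> e) + \<alpha> * (r/2)\<^sup>2 = 0" "- (r/2 * (v \<bullet> e)) + \<alpha> * (r/2)\<^sup>2 = 0"
      using expand[OF e, of "r/2"] expand[OF e, of "-r/2"] by simp_all
    then have "r/2 * (v \<bullet> e) = 0" "\<alpha> * (r/2)\<^sup>2 = 0" by linarith+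
    with \<open>0 < r\<close> show ?thesis by simp
  qed
  have "\<alpha> = 0" using both[OF SOME_Basis] by simp
  moreover have "v = 0" by (rule euclidean_eqI) (use both in simp)
  ultimately have "\<alpha> = 0" "b = 0" by (simp_all add: v_def)
  moreover have "c = 0" using zero[of x0] \<open>0 < r\<close> \<open>\<alpha> = 0\<close> \<open>b = 0\<close> by (simp add: quadric_def)
  ultimately show ?thesis by simp
qed

text \<open>The first function is nonzero on some ball, and the second cannot vanish on all of that
  ball. This rules out the vanishing of a product of two quadrics.\<close>

lemma quadric_product_nonzero:
  assumes "(\<alpha>, b, c) \<noteq> (0, 0, 0)" "(\<alpha>', b', c') \<noteq> (0, 0, 0)"
  shows "\<exists>x. quadric \<alpha> b c x \<noteq> 0 \<and> quadric \<alpha>' b' c' x \<noteq> 0"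
proof -
  obtain x0 where x0: "quadric \<alpha> b c x0 \<noteq> 0"
    using quadric_zero_on_ball[of 1 0 \<alpha> b c] assms(1) by auto
  have "open {x. quadric \<alpha> b c x \<noteq> 0}"
    by (intro open_Collect_neq continuous_quadric continuous_on_const)
  with x0 obtain r where "0 < r" "ball x0 r \<subseteq> {x. quadric \<alpha> b c x \<noteq> 0}"
    unfolding open_contains_ball by blast
  with quadric_zero_on_ball[of r x0 \<alpha>' b' c'] assms(2) show ?thesis by blast
qed

section \<open>Inversions and their uniform non-concentration\<close>

text \<open>The inversion in the unit sphere about \<open>a\<close>, translated by
  \<open>- a\<close>; only differences of its values matter.\<close>

definition inversion :: "'a::euclidean_space \<Rightarrow> 'a \<Rightarrow> 'a" where
  "inversion a x = (x - a) /\<^sub>R (norm (x - a))\<^sup>2"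

lemma norm_inversion_diff:
  assumes "x \<noteq> a" "y \<noteq> a"
  shows "norm (inversion a x - inversion a y) = norm (x - y) / (norm (x - a) * norm (y - a))"
proof -
  define u v where "u = x - a" and "v = y - a"
  have nz: "u \<bullet> u \<noteq> 0" "v \<bullet> v \<noteq> 0" using assms by (auto simp: u_def v_def)
  have "(norm (inversion a x - inversion a y))\<^sup>2 = (norm (u - v))\<^sup>2 / ((norm u)\<^sup>2 * (norm v)\<^sup>2)"
    unfolding inversion_def u_def[symmetric] v_def[symmetric] power2_norm_eq_inner
    using nz by (simp add: inner_diff inner_commute field_simps)
  also have "\<dots> = (norm (x - y) / (norm (x - a) * norm (y - a)))\<^sup>2"
    by (simp add: u_def v_def power_divide power_mult_distrib)
  finally show ?thesis by (simp add: power2_eq_iff_nonneg)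
qed

text \<open>Two families with the same inner products differ by a linear isometry. It is built by
  choosing a basis among the \<open>k x\<close> and sending it to the corresponding
  \<open>h x\<close>; \<open>w'\<close> is the preimage of \<open>w\<close>.\<close>

lemma isometric_functional:
  fixes S :: "'b set" and h k :: "'b \<Rightarrow> 'a::euclidean_space"
  assumes spans: "span (k ` S) = UNIV"
    and inner: "\<And>x y. x \<in> S \<Longrightarrow> y \<in> S \<Longrightarrow> h x \<bullet> h y = k x \<bullet> k y"
  shows "\<exists>w'. norm w' = norm w \<and> (\<forall>x\<in>S. h x \<bullet> w = k x \<bullet> w')"
proof -
  obtain B where B: "B \<subseteq> k ` S" "independent B" "k ` S \<subseteq> span B"
    using maximal_independent_subset by blast
  have spanB: "span B = UNIV"
    using B(3) spans span_minimal[of "k ` S" "span B"] by auto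
  obtain s where s: "\<And>b. b \<in> B \<Longrightarrow> s b \<in> S \<and> k (s b) = b"
    using B(1) by (metis image_iff subset_iff)
  obtain T where T: "linear T" "\<And>b. b \<in> B \<Longrightarrow> T b = h (s b)"
    using linear_independent_extend[OF B(2), of "\<lambda>b. h (s b)"] by auto
  \<comment> \<open>This is weaker in form than \<open>h x = T (k x)\<close>, but it is linear in
    \<open>z\<close> and so needs checking only on the basis, and it is all that the conclusion
    uses.\<close>
  have hT: "h x \<bullet> T z = k x \<bullet> z" if "x \<in> S" for x z
  proof -
    have "z \<in> span B" using spanB by simp
    then show ?thesis
    proof (induction rule: span_induct_alt)
      case base then show ?case using linear_0[OF T(1)] by simp
    next
      case (step c b y)
      then show ?case
        using that s T inner[of x "s b"]
        by (simp add: linear_add linear_scale inner_add_right)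
    qed
  qed
  have TT: "T y \<bullet> T z = y \<bullet> z" for y z
  proof -
    have "y \<in> span B" using spanB by simp
    then show ?thesis
    proof (induction rule: span_induct_alt)
      case base then show ?case using linear_0[OF T(1)] by simp
    next
      case (step c b x)
      then show ?case
        using s[of b] T hT[of "s b" z]
        by (simp add: linear_add linear_scale inner_add_left)
    qed
  qed
  then have ortho: "orthogonal_transformation T"
    unfolding orthogonal_transformation_def using T by auto
  obtain w' where "T w' = w"
    using orthogonal_transformation_surj[OF ortho] by (metis surjD)
  moreover have "norm (T w') = norm w'"
    using orthogonal_transformation_norm[OF ortho] .
  ultimately show ?thesis using hT by auto
qed

text \<open>Compactness: counterexamples to ever smaller constants, together with pairs of points
  realising the diameters, converge along a subsequence to a situation that \<open>nondeg\<close>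
  forbids.\<close>

lemma uniform_nonconcentration_inversion:
  fixes K P :: "'a::euclidean_space set"
  assumes K: "compact K" and P: "compact P" and disj: "K \<inter> P = {}"
    and nondeg: "\<And>q e \<alpha> b c. q \<in> K \<Longrightarrow> 0 < e \<Longrightarrow> (\<alpha>, b, c) \<noteq> (0, 0, 0) \<Longrightarrow>
      \<exists>y\<in>K \<inter> ball q e. quadric \<alpha> b c y \<noteq> 0"
  shows "\<exists>\<delta>>0. \<delta> < 1 \<and> (\<forall>a\<in>P. \<forall>p\<in>K. \<forall>w. norm w = 1 \<longrightarrow>
      (\<exists>y\<in>K. diameter (inversion a ` K) / 4 \<le> norm (inversion a y - inversion a p) \<and>
        \<delta> * diameter (inversion a ` K) \<le> \<bar>(inversion a y - inversion a p) \<bullet> w\<bar>))"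
proof (rule ccontr)
  let ?D = "\<lambda>a. diameter (inversion a ` K)"
  assume neg: "\<not> ?thesis"
  \<comment> \<open>The constant 1/(n+2) instead of 1/(n+1) is below 1 also for n = 0, as the
    negated claim requires.\<close>
  have "\<exists>a p w. a \<in> P \<and> p \<in> K \<and> norm w = 1 \<and>
      (\<forall>y\<in>K. ?D a / 4 \<le> norm (inversion a y - inversion a p) \<longrightarrow>
         \<bar>(inversion a y - inversion a p) \<bullet> w\<bar> < inverse (real (Suc (Suc n))) * ?D a)" for n
  proof -
    have "inverse (real (Suc (Suc n))) > 0" "inverse (real (Suc (Suc n))) < 1"
      by (auto simp: field_simps)
    with neg show ?thesis by (meson not_le)
  qed
  then obtain a p w where apw: "\<And>n. a n \<in> P" "\<And>n. p n \<in> K" "\<And>n. norm (w n) = 1"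
    and small: "\<And>n y. y \<in> K \<Longrightarrow> ?D (a n) / 4 \<le> norm (inversion (a n) y - inversion (a n) (p n)) \<Longrightarrow>
         \<bar>(inversion (a n) y - inversion (a n) (p n)) \<bullet> w n\<bar> < inverse (real (Suc (Suc n))) * ?D (a n)"
    by metis
  have cont: "compact (inversion b ` K)" if "b \<in> P" for b
    unfolding inversion_def using that disj
    by (intro compact_continuous_image[OF _ K] continuous_intros) auto
  have "\<exists>q q'. q \<in> K \<and> q' \<in> K \<and> ?D (a n) = norm (inversion (a n) q - inversion (a n) q')" for n
  proof -
    have "inversion (a n) ` K \<noteq> {}" using apw(2) by auto
    from diameter_compact_attained[OF cont[OF apw(1)] this] show ?thesis
      by (metis dist_norm imageE)
  qed
  then obtain q q' where qq: "\<And>n. q n \<in> K" "\<And>n. q' n \<in> K"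
    "\<And>n. ?D (a n) = norm (inversion (a n) (q n) - inversion (a n) (q' n))"
    by metis
  have "compact (P \<times> K \<times> sphere (0::'a) 1 \<times> K \<times> K)"
    by (intro compact_Times K P compact_sphere)
  then have seq: "seq_compact (P \<times> K \<times> sphere (0::'a) 1 \<times> K \<times> K)"
    by (rule compact_imp_seq_compact)
  have in_product: "(a n, p n, w n, q n, q' n) \<in> P \<times> K \<times> sphere 0 1 \<times> K \<times> K" for n
    using apw qq by simp
  obtain l r where l: "l \<in> P \<times> K \<times> sphere 0 1 \<times> K \<times> K" and r: "strict_mono r"
    and lim: "((\<lambda>n. (a n, p n, w n, q n, q' n)) \<circ> r) \<longlonglongrightarrow> l"
    by (rule seq_compactE[OF seq allI[OF in_product]])
  obtain A p0 w0 q0 q1 where l_eq: "l = (A, p0, w0, q0, q1)" by (cases l)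
  have mem: "A \<in> P" "p0 \<in> K" "norm w0 = 1" "q0 \<in> K" "q1 \<in> K" using l l_eq by auto
  have lims: "(\<lambda>n. a (r n)) \<longlonglongrightarrow> A" "(\<lambda>n. p (r n)) \<longlonglongrightarrow> p0" "(\<lambda>n. w (r n)) \<longlonglongrightarrow> w0"
     "(\<lambda>n. q (r n)) \<longlonglongrightarrow> q0" "(\<lambda>n. q' (r n)) \<longlonglongrightarrow> q1"
  proof -
    note t = lim[unfolded l_eq o_def]
    note t2 = tendsto_snd[OF t, unfolded snd_conv]
    note t3 = tendsto_snd[OF t2, unfolded snd_conv]
    note t4 = tendsto_snd[OF t3, unfolded snd_conv]
    show "(\<lambda>n. a (r n)) \<longlonglongrightarrow> A" "(\<lambda>n. p (r n)) \<longlonglongrightarrow> p0" "(\<lambda>n. w (r n)) \<longlonglongrightarrow> w0"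
      "(\<lambda>n. q (r n)) \<longlonglongrightarrow> q0" "(\<lambda>n. q' (r n)) \<longlonglongrightarrow> q1"
      by (fact tendsto_fst[OF t, unfolded fst_conv] tendsto_fst[OF t2, unfolded fst_conv]
        tendsto_fst[OF t3, unfolded fst_conv] tendsto_fst[OF t4, unfolded fst_conv]
        tendsto_snd[OF t4, unfolded snd_conv])+
  qed
  have inv_lim: "(\<lambda>n. inversion (a (r n)) (z n)) \<longlonglongrightarrow> inversion A z0"
    if "z \<longlonglongrightarrow> z0" "z0 \<in> K" for z z0
    unfolding inversion_def using that mem disj lims(1)
    by (intro tendsto_intros) auto
  define d where "d = norm (inversion A q0 - inversion A q1)"
  have D_lim: "(\<lambda>n. ?D (a (r n))) \<longlonglongrightarrow> d"
    unfolding qq(3) d_def by (intro tendsto_intros inv_lim lims mem)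
  have d_max: "norm (inversion A x - inversion A y) \<le> d" if "x \<in> K" "y \<in> K" for x y
  proof (rule LIMSEQ_le)
    show "(\<lambda>n. norm (inversion (a (r n)) x - inversion (a (r n)) y)) \<longlonglongrightarrow> norm (inversion A x - inversion A y)"
      by (intro tendsto_intros inv_lim that)
    show "(\<lambda>n. ?D (a (r n))) \<longlonglongrightarrow> d" by (rule D_lim)
    show "\<exists>N. \<forall>n\<ge>N. norm (inversion (a (r n)) x - inversion (a (r n)) y) \<le> ?D (a (r n))"
      using that diameter_bounded_bound[OF compact_imp_bounded[OF cont[OF apw(1)]]]
      by (auto simp: dist_norm)
  qed
  \<comment> \<open>\<open>nondeg\<close> for an affine function vanishing at \<open>p0\<close>
    yields a second point of \<open>K\<close>, and the inversion separates the two.\<close>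
  have "d > 0"
  proof -
    obtain e :: 'a where e: "e \<in> Basis" using nonempty_Basis by blast
    obtain y where "y \<in> K" "quadric 0 e (- (e \<bullet> p0)) y \<noteq> 0"
      using nondeg[of p0 1 0 e "- (e \<bullet> p0)"] mem e by force
    then have y: "y \<in> K" "y \<noteq> p0" by (auto simp: quadric_def)
    have "y \<noteq> A" "p0 \<noteq> A" using mem y disj by auto
    then have "0 < norm (inversion A y - inversion A p0)"
      using norm_inversion_diff[of y A p0] y by simp
    with d_max[OF y(1) mem(2)] show ?thesis by linarith
  qed
  \<comment> \<open>By the triangle inequality one end of a diameter is at distance at least
    \<open>d / 2\<close> from the image of \<open>p0\<close>; the margin down to
    \<open>d / 4\<close> then covers a whole neighbourhood of it.\<close>
  obtain u where u: "u \<in> K" "d / 2 \<le> norm (inversion A u - inversion A p0)"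
  proof -
    have "d \<le> norm (inversion A q0 - inversion A p0) + norm (inversion A q1 - inversion A p0)"
      unfolding d_def by norm
    then have "d / 2 \<le> norm (inversion A q0 - inversion A p0) \<or> d / 2 \<le> norm (inversion A q1 - inversion A p0)"
      by linarith
    with mem that show thesis by blast
  qed
  have "continuous (at u) (\<lambda>y. norm (inversion A y - inversion A p0))"
    unfolding inversion_def using u mem disj by (intro continuous_intros) auto
  then have "\<forall>\<^sub>F y in at u. d / 4 < norm (inversion A y - inversion A p0)"
    using u \<open>d > 0\<close> unfolding isCont_def by (intro order_tendstoD) auto
  then obtain e where e: "e > 0" "\<And>y. y \<noteq> u \<Longrightarrow> dist y u < e \<Longrightarrow> d / 4 < norm (inversion A y - inversion A p0)"
    unfolding eventually_at by auto
  define k where "k = inversion A p0 \<bullet> w0"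
  \<comment> \<open>Multiplying the equation of a hyperplane in the inverted picture by the squared
    distance to the centre turns it into a quadric equation in \<open>y\<close>.\<close>
  have form: "quadric (- k) (w0 + (2 * k) *\<^sub>R A) (- (A \<bullet> w0) - k * (norm A)\<^sup>2) y
      = (norm (y - A))\<^sup>2 * ((inversion A y - inversion A p0) \<bullet> w0)" if "y \<in> K" for y
  proof -
    have "y \<noteq> A" using that mem disj by auto
    then have "(norm (y - A))\<^sup>2 * ((inversion A y - inversion A p0) \<bullet> w0)
      = (y - A) \<bullet> w0 - k * (norm (y - A))\<^sup>2"
      by (simp add: inversion_def[of A y] inner_diff_left algebra_simps flip: k_def)
    also have "\<dots> = quadric (- k) (w0 + (2 * k) *\<^sub>R A) (- (A \<bullet> w0) - k * (norm A)\<^sup>2) y"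
      unfolding quadric_def power2_norm_eq_inner by (simp add: inner_diff inner_add inner_commute algebra_simps)
    finally show ?thesis by simp
  qed
  \<comment> \<open>If the first coefficient vanishes, then \<open>k = 0\<close> and the second one
    is the unit vector \<open>w0\<close>.\<close>
  have "(- k, w0 + (2 * k) *\<^sub>R A, - (A \<bullet> w0) - k * (norm A)\<^sup>2) \<noteq> (0, 0, 0)"
    using mem(3) by auto
  from nondeg[OF u(1) e(1) this] obtain y where y: "y \<in> K" "dist u y < e"
    "(inversion A y - inversion A p0) \<bullet> w0 \<noteq> 0"
    using form by fastforce
  have far: "d / 4 < norm (inversion A y - inversion A p0)"
    using e(2)[of y] y(2) u(2) \<open>d > 0\<close> by (cases "y = u") (auto simp: dist_commute)
  have y_lim: "(\<lambda>n. inversion (a (r n)) y - inversion (a (r n)) (p (r n))) \<longlonglongrightarrow> inversion A y - inversion A p0"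
    by (intro tendsto_intros inv_lim y mem lims)
  have "(\<lambda>n. norm (inversion (a (r n)) y - inversion (a (r n)) (p (r n))) - ?D (a (r n)) / 4)
      \<longlonglongrightarrow> norm (inversion A y - inversion A p0) - d / 4"
    by (intro tendsto_intros y_lim D_lim) auto
  then have "\<forall>\<^sub>F n in sequentially. 0 < norm (inversion (a (r n)) y - inversion (a (r n)) (p (r n))) - ?D (a (r n)) / 4"
    using far by (intro order_tendstoD) auto
  then have ev: "\<forall>\<^sub>F n in sequentially. \<bar>(inversion (a (r n)) y - inversion (a (r n)) (p (r n))) \<bullet> w (r n)\<bar>
      \<le> inverse (real (Suc (Suc (r n)))) * ?D (a (r n))"
    by eventually_elim (rule less_imp_le, rule small[OF y(1)], simp)
  have inv0: "(\<lambda>n. inverse (real (Suc (Suc (r n))))) \<longlonglongrightarrow> 0"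
    using LIMSEQ_subseq_LIMSEQ[OF LIMSEQ_Suc[OF LIMSEQ_inverse_real_of_nat] r] by (simp add: o_def)
  have "\<bar>(inversion A y - inversion A p0) \<bullet> w0\<bar> \<le> 0 * d"
  proof (rule tendsto_le[OF _ _ _ ev])
    show "(\<lambda>n. inverse (real (Suc (Suc (r n)))) * ?D (a (r n))) \<longlonglongrightarrow> 0 * d"
      by (intro tendsto_intros inv0 D_lim)
    show "(\<lambda>n. \<bar>(inversion (a (r n)) y - inversion (a (r n)) (p (r n))) \<bullet> w (r n)\<bar>)
        \<longlonglongrightarrow> \<bar>(inversion A y - inversion A p0) \<bullet> w0\<bar>"
      by (intro tendsto_intros y_lim lims)
  qed auto
  with y(3) show False by simp
qed

text \<open>
  Up to scaling, a map with the distortion of an inversion is an inversion followed by an isometry,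
  and the latter is absorbed into the direction \<open>w\<close>.
\<close>

lemma uniform_nonconcentration:
  fixes K P :: "'a::euclidean_space set"
  assumes K: "compact K" and P: "compact P" and disj: "K \<inter> P = {}"
    and nondeg: "\<And>q e \<alpha> b c. q \<in> K \<Longrightarrow> 0 < e \<Longrightarrow> (\<alpha>, b, c) \<noteq> (0, 0, 0) \<Longrightarrow>
      \<exists>y\<in>K \<inter> ball q e. quadric \<alpha> b c y \<noteq> 0"
  shows "\<exists>\<delta>>0. \<delta> < 1 \<and> (\<forall>a\<in>P. \<forall>\<kappa>>0. \<forall>\<phi>::'a \<Rightarrow> 'a. \<forall>p\<in>K. \<forall>w.
      (\<forall>x\<in>K. \<forall>y\<in>K. norm (\<phi> x - \<phi> y) = norm (x - y) / (\<kappa> * (norm (x - a) * norm (y - a)))) \<longrightarrow> norm w = 1 \<longrightarrow>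
      (\<exists>y\<in>K. diameter (\<phi> ` K) / 4 \<le> norm (\<phi> y - \<phi> p) \<and>
        \<delta> * diameter (\<phi> ` K) \<le> \<bar>(\<phi> y - \<phi> p) \<bullet> w\<bar>))"
proof -
  obtain \<delta> where \<delta>: "\<delta> > 0" "\<delta> < 1" and main: "\<And>a p w. a \<in> P \<Longrightarrow> p \<in> K \<Longrightarrow> norm w = 1 \<Longrightarrow>
      (\<exists>y\<in>K. diameter (inversion a ` K) / 4 \<le> norm (inversion a y - inversion a p) \<and>
        \<delta> * diameter (inversion a ` K) \<le> \<bar>(inversion a y - inversion a p) \<bullet> w\<bar>)"
    using uniform_nonconcentration_inversion[OF assms] by blast
  have "\<exists>y\<in>K. diameter (\<phi> ` K) / 4 \<le> norm (\<phi> y - \<phi> p) \<and> \<delta> * diameter (\<phi> ` K) \<le> \<bar>(\<phi> y - \<phi> p) \<bullet> w\<bar>"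
    if a: "a \<in> P" and \<kappa>: "\<kappa> > 0" and p: "p \<in> K" and w: "norm w = 1"
      and dist: "\<And>x y. x \<in> K \<Longrightarrow> y \<in> K \<Longrightarrow>
        norm (\<phi> x - \<phi> y) = norm (x - y) / (\<kappa> * (norm (x - a) * norm (y - a)))"
    for a \<kappa> p w and \<phi> :: "'a \<Rightarrow> 'a"
  proof -
    \<comment> \<open>Both maps are based at \<open>p\<close>, and the factor \<kappa> makes them
      isometric to each other; polarization then gives equal inner products.\<close>
    define k h where "k x = inversion a x - inversion a p" and "h x = \<kappa> *\<^sub>R (\<phi> x - \<phi> p)" for x
    have iso: "norm (\<phi> x - \<phi> y) = norm (inversion a x - inversion a y) / \<kappa>" if "x \<in> K" "y \<in> K" for x y
    proof -
      have "x \<noteq> a" "y \<noteq> a" using that a disj by auto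
      then show ?thesis using dist[OF that] norm_inversion_diff[of x a y] by (simp add: mult.commute)
    qed
    have isoh: "norm (h x - h y) = norm (k x - k y)" if "x \<in> K" "y \<in> K" for x y
      using iso[OF that] \<kappa> by (simp add: h_def k_def flip: scaleR_diff_right)
    have hk: "norm (h x) = norm (k x)" if "x \<in> K" for x
      using isoh[OF that p] by (simp add: h_def k_def)
    have inner: "h x \<bullet> h y = k x \<bullet> k y" if "x \<in> K" "y \<in> K" for x y
      using isoh[OF that] hk[OF that(1)] hk[OF that(2)]
      by (simp add: dot_norm_neg)
    \<comment> \<open>Otherwise the inverted set would lie in a hyperplane and \<open>K\<close> in a
      quadric.\<close>
    have spans: "span (k ` K) = UNIV"
    proof (rule ccontr)
      assume "span (k ` K) \<noteq> UNIV"
      then obtain v where v: "v \<noteq> 0" "\<And>x. x \<in> span (k ` K) \<Longrightarrow> v \<bullet> x = 0"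
        using span_not_UNIV_orthogonal[of "k ` K"] by auto
      define c where "c = inversion a p \<bullet> v"
      have "quadric (- c) (v + (2 * c) *\<^sub>R a) (- (a \<bullet> v) - c * (norm a)\<^sup>2) y = 0" if "y \<in> K" for y
      proof -
        have "y \<noteq> a" using that a disj by auto
        have "v \<bullet> k y = 0" using v(2) that by (auto intro: span_base)
        then have "inversion a y \<bullet> v = c"
          by (simp add: k_def c_def inner_diff inner_commute)
        then have "(y - a) \<bullet> v / (norm (y - a))\<^sup>2 = c"
          by (simp add: inversion_def divide_inverse mult.commute)
        then have "(y - a) \<bullet> v = c * (norm (y - a))\<^sup>2"
          using \<open>y \<noteq> a\<close> by (auto simp: divide_eq_eq)
        then show ?thesis
          unfolding quadric_def power2_norm_eq_inner
          by (simp add: inner_diff inner_add inner_commute algebra_simps)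
      qed
      moreover have "(- c, v + (2 * c) *\<^sub>R a, - (a \<bullet> v) - c * (norm a)\<^sup>2) \<noteq> (0, 0, 0)"
        using v(1) by auto
      ultimately show False using nondeg[OF p zero_less_one] by blast
    qed
    obtain w' where w': "norm w' = 1" "\<And>x. x \<in> K \<Longrightarrow> h x \<bullet> w = k x \<bullet> w'"
      using isometric_functional[OF spans, of h w] inner w by auto
    obtain y where y: "y \<in> K" "diameter (inversion a ` K) / 4 \<le> norm (k y)"
       "\<delta> * diameter (inversion a ` K) \<le> \<bar>k y \<bullet> w'\<bar>"
      using main[OF a p w'(1)] by (auto simp: k_def)
    have "compact (inversion a ` K)"
      unfolding inversion_def using a disj
      by (intro compact_continuous_image[OF _ K] continuous_intros) auto
    then have bd: "norm (inversion a x - inversion a z) \<le> diameter (inversion a ` K)" if "x \<in> K" "z \<in> K" for x z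
      using diameter_bounded_bound[OF compact_imp_bounded, of "inversion a ` K"] that
      by (metis dist_norm imageI)
    have "diameter (\<phi> ` K) \<le> diameter (inversion a ` K) / \<kappa>"
      using p \<kappa> iso bd by (intro diameter_le) (auto simp: divide_right_mono)
    then have D: "\<kappa> * diameter (\<phi> ` K) \<le> diameter (inversion a ` K)"
      using \<kappa> by (simp add: field_simps)
    have "\<kappa> * diameter (\<phi> ` K) / 4 \<le> \<kappa> * norm (\<phi> y - \<phi> p)"
      using D y(2) hk[OF y(1)] \<kappa> by (simp add: h_def)
    moreover have "\<delta> * (\<kappa> * diameter (\<phi> ` K)) \<le> \<kappa> * \<bar>(\<phi> y - \<phi> p) \<bullet> w\<bar>"
    proof -
      have "\<delta> * (\<kappa> * diameter (\<phi> ` K)) \<le> \<bar>h y \<bullet> w\<bar>"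
        using mult_left_mono[OF D, of \<delta>] \<delta> y(3) w'(2)[OF y(1)] by linarith
      then show ?thesis using \<kappa> by (simp add: h_def abs_mult)
    qed
    ultimately show ?thesis using \<kappa> y(1)
      by (intro bexI[of _ y]) (simp_all add: mult.left_commute)
  qed
  then show ?thesis
    by (intro exI[of _ \<delta>] conjI \<delta> ballI allI impI) simp
qed

section \<open>Limit sets coded by words\<close>

definition admissible :: "nat \<Rightarrow> (nat \<Rightarrow> nat \<Rightarrow> bool) \<Rightarrow> nat list \<Rightarrow> bool" where
  "admissible N R w \<longleftrightarrow> set w \<subseteq> {1..N} \<and> successively R w"

lemma admissible_Cons:
  "admissible N R (j # w) \<longleftrightarrow> j \<in> {1..N} \<and> admissible N R w \<and> (w \<noteq> [] \<longrightarrow> R j (hd w))"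
  by (auto simp: admissible_def successively_Cons)

text \<open>\<open>R j k\<close> means that \<open>k\<close> may come after \<open>j\<close>. This
  union is the domain on which the branch of letter \<open>j\<close> is used; in the Schottky case
  it avoids the ball containing the pole of \<open>g j\<close>.\<close>

definition followers :: "nat \<Rightarrow> (nat \<Rightarrow> nat \<Rightarrow> bool) \<Rightarrow> (nat \<Rightarrow> 'a set) \<Rightarrow> nat \<Rightarrow> 'a set" where
  "followers N R D j = (\<Union>k\<in>{k \<in> {1..N}. R j k}. D k)"

lemma followersI: "k \<in> {1..N} \<Longrightarrow> R j k \<Longrightarrow> x \<in> D k \<Longrightarrow> x \<in> followers N R D j"
  by (auto simp: followers_def)

lemma followersE:
  assumes "x \<in> followers N R D j"
  obtains k where "k \<in> {1..N}" "R j k" "x \<in> D k"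
  using assms by (auto simp: followers_def)

text \<open>
  The common structure of the two settings. The point \<open>orb w\<close> is the image of the base point under
  the isometry \<open>\<gamma>\<close> attached to the word \<open>w\<close>; its height and its distance to \<open>\<gamma> y\<close> are those
  dictated by the Poincare extension when \<open>\<gamma>\<close> has the pole \<open>a\<close> and the scaling factor \<open>\<kappa>\<close>.
\<close>

locale inversive_coding =
  fixes N :: nat and R :: "nat \<Rightarrow> nat \<Rightarrow> bool" and D :: "nat \<Rightarrow> 'a::euclidean_space set"
    and f :: "nat \<Rightarrow> 'a \<Rightarrow> 'a" and F :: "nat \<Rightarrow> 'a option \<Rightarrow> 'a option" and P :: "nat \<Rightarrow> 'a set"
    and X :: "('a \<times> real) set" and orb :: "nat list \<Rightarrow> 'a \<times> real"
  assumes compact_D: "j \<in> {1..N} \<Longrightarrow> compact (D j)"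
    and disjoint_D: "disjoint_family_on D {1..N}"
    and two_points: "j \<in> {1..N} \<Longrightarrow> \<exists>x\<in>D j. \<exists>y\<in>D j. x \<noteq> y"
    and refl_R: "j \<in> {1..N} \<Longrightarrow> R j j"
    and maps: "j \<in> {1..N} \<Longrightarrow> x \<in> followers N R D j \<Longrightarrow> f j x \<in> D j"
    and inverse_branch: "j \<in> {1..N} \<Longrightarrow> x \<in> followers N R D j \<Longrightarrow> F j (Some (f j x)) = Some x"
    and compact_P: "j \<in> {1..N} \<Longrightarrow> compact (P j)"
    and disjoint_P: "j \<in> {1..N} \<Longrightarrow> P j \<inter> followers N R D j = {}"
    and inversive: "admissible N R w \<Longrightarrow> w \<noteq> [] \<Longrightarrow> \<exists>\<kappa>>0. \<exists>a\<in>P (last w).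
      (\<forall>x\<in>followers N R D (last w). \<forall>y\<in>followers N R D (last w).
        norm (foldr f w x - foldr f w y) = norm (x - y) / (\<kappa> * (norm (x - a) * norm (y - a)))) \<and>
      snd (orb w) = 1 / (\<kappa> * (1 + (norm a)\<^sup>2)) \<and>
      (\<forall>y\<in>followers N R D (last w). (norm (fst (orb w) - foldr f w y))\<^sup>2 \<le>
         (snd (orb w))\<^sup>2 * ((1 + (norm y)\<^sup>2) * (1 + (norm a)\<^sup>2) / (norm (y - a))\<^sup>2))"
    and orb_in: "admissible N R w \<Longrightarrow> w \<noteq> [] \<Longrightarrow> orb w \<in> X"
    and orbit_cases: "z \<in> X \<Longrightarrow> (\<exists>w. admissible N R w \<and> w \<noteq> [] \<and> z = orb w) \<or> 1 \<le> snd z"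
begin

abbreviation E :: "nat \<Rightarrow> 'a set" where "E \<equiv> followers N R D"
abbreviation adm :: "nat list \<Rightarrow> bool" where "adm w \<equiv> admissible N R w \<and> w \<noteq> []"
abbreviation \<Lambda> :: "'a set" where "\<Lambda> \<equiv> limit_points_at_infinity X"

lemma compact_E: "compact (E j)"
  unfolding followers_def by (intro compact_UN) (auto intro: compact_D)

lemma D_subset_E: "k \<in> {1..N} \<Longrightarrow> R j k \<Longrightarrow> D k \<subseteq> E j"
  by (auto intro: followersI)

lemma last_letter: "adm w \<Longrightarrow> last w \<in> {1..N}"
  using last_in_set[of w] unfolding admissible_def by blast

lemma hd_letter: "adm w \<Longrightarrow> hd w \<in> {1..N}"
  using hd_in_set[of w] unfolding admissible_def by blast

lemma E_two_points: "j \<in> {1..N} \<Longrightarrow> \<exists>x\<in>E j. \<exists>y\<in>E j. x \<noteq> y"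
  using two_points D_subset_E refl_R by blast

lemma word_image: "adm w \<Longrightarrow> x \<in> E (last w) \<Longrightarrow> foldr f w x \<in> D (hd w)"
proof (induction w)
  case (Cons j w)
  show ?case
  proof (cases "w = []")
    case True
    then show ?thesis using Cons.prems maps by (simp add: admissible_Cons)
  next
    case False
    with Cons.prems have "adm w" "R j (hd w)" "j \<in> {1..N}" by (simp_all add: admissible_Cons)
    moreover have "foldr f w x \<in> D (hd w)" using Cons.IH Cons.prems False \<open>adm w\<close> by simp
    ultimately show ?thesis using maps followersI[of "hd w" N R j _ D] hd_letter[of w] by (simp del: atLeastAtMost_iff)
  qed
qed simp

section \<open>Orbit points and the limit set in terms of words\<close>

text \<open>Only the last letter decides where the pole and the arguments of a word lie, so finitely
  many disjoint pairs of compact sets give constants valid for all words.\<close>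

lemma position_bounds:
  obtains B \<rho> where "0 < B" "0 < \<rho>"
    "\<And>j a. j \<in> {1..N} \<Longrightarrow> a \<in> P j \<Longrightarrow> norm a \<le> B"
    "\<And>j y. j \<in> {1..N} \<Longrightarrow> y \<in> E j \<Longrightarrow> norm y \<le> B"
    "\<And>j a y. j \<in> {1..N} \<Longrightarrow> a \<in> P j \<Longrightarrow> y \<in> E j \<Longrightarrow> \<rho> \<le> norm (y - a)"
proof -
  have "bounded (\<Union>j\<in>{1..N}. P j \<union> E j)"
    by (intro compact_imp_bounded compact_UN) (auto intro!: compact_Un compact_P compact_E)
  then obtain B where B: "B > 0" "\<And>x. x \<in> (\<Union>j\<in>{1..N}. P j \<union> E j) \<Longrightarrow> norm x \<le> B"
    unfolding bounded_pos by blast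
  let ?S = "\<Union>j\<in>{1..N}. E j \<times> P j"
  have S: "compact ?S"
    by (intro compact_UN) (auto intro!: compact_P compact_E compact_Times)
  have pos: "0 < norm (fst z - snd z)" if "z \<in> ?S" for z
    using that disjoint_P by fastforce
  have "\<exists>\<rho>>0. \<forall>z\<in>?S. \<rho> \<le> norm (fst z - snd z)"
  proof (cases "?S = {}")
    case True
    then show ?thesis by (intro exI[of _ 1]) auto
  next
    case False
    have "continuous_on ?S (\<lambda>z. norm (fst z - snd z))" by (intro continuous_intros)
    from continuous_attains_inf[OF S False this] pos show ?thesis by blast
  qed
  then obtain \<rho> where \<rho>: "\<rho> > 0" "\<And>z. z \<in> ?S \<Longrightarrow> \<rho> \<le> norm (fst z - snd z)" by blast
  have "\<rho> \<le> norm (y - a)" if "j \<in> {1..N}" "a \<in> P j" "y \<in> E j" for j a y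
    using \<rho>(2)[of "(y, a)"] that unfolding fst_conv snd_conv by blast
  moreover have "norm a \<le> B" if "j \<in> {1..N}" "a \<in> P j \<union> E j" for j a
    using B(2)[of a] that by blast
  ultimately show ?thesis using B(1) \<rho>(1) by (intro that[of B \<rho>]) blast+
qed

text \<open>Pole and arguments stay bounded and apart, so the scale \<open>1 / \<kappa>\<close> of a
  word governs both the height of its orbit point and the size of its image, up to a factor
  independent of the word.\<close>

lemma orbit_near_image:
  obtains C where "0 < C" "\<And>w. adm w \<Longrightarrow> 0 < snd (orb w)"
    "\<And>w y. adm w \<Longrightarrow> y \<in> E (last w) \<Longrightarrow> norm (fst (orb w) - foldr f w y) \<le> C * snd (orb w)"
    "\<And>w. adm w \<Longrightarrow> \<exists>y\<in>E (last w). \<exists>y'\<in>E (last w).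
        snd (orb w) \<le> C * norm (foldr f w y - foldr f w y')"
proof -
  obtain B \<rho> where B: "B > 0" and \<rho>: "\<rho> > 0"
    and bP: "\<And>j a. j \<in> {1..N} \<Longrightarrow> a \<in> P j \<Longrightarrow> norm a \<le> B"
    and bE: "\<And>j y. j \<in> {1..N} \<Longrightarrow> y \<in> E j \<Longrightarrow> norm y \<le> B"
    and sep: "\<And>j a y. j \<in> {1..N} \<Longrightarrow> a \<in> P j \<Longrightarrow> y \<in> E j \<Longrightarrow> \<rho> \<le> norm (y - a)"
    using position_bounds by metis
  obtain u v where uv: "\<And>j. j \<in> {1..N} \<Longrightarrow> u j \<in> E j \<and> v j \<in> E j \<and> u j \<noteq> v j"
    using E_two_points by metis
  \<comment> \<open>A lower bound for the separation of the chosen points \<open>u j\<close> and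
    \<open>v j\<close>; the entry 1 keeps the minimum defined when there are no letters.\<close>
  define \<sigma> where "\<sigma> = Min (insert 1 ((\<lambda>j. norm (u j - v j)) ` {1..N}))"
  have \<sigma>: "\<sigma> > 0" "\<And>j. j \<in> {1..N} \<Longrightarrow> \<sigma> \<le> norm (u j - v j)"
  proof -
    show "\<sigma> > 0" unfolding \<sigma>_def using uv by (subst Min_gr_iff) auto
    show "\<sigma> \<le> norm (u j - v j)" if "j \<in> {1..N}" for j
      unfolding \<sigma>_def using that by (intro Min_le) auto
  qed
  \<comment> \<open>The first entry bounds the distance from the orbit point to the image in units
    of the height; the second compares the height, at most \<open>1 / \<kappa>\<close>, with the
    distance of the images of \<open>u j\<close> and \<open>v j\<close>.\<close>
  define C where "C = max ((1 + B\<^sup>2) / \<rho>) ((2 * B)\<^sup>2 / \<sigma>)"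
  have "C > 0" unfolding C_def using \<rho> B by (simp add: add_pos_nonneg less_max_iff_disj)
  moreover have pos: "0 < snd (orb w)" if "adm w" for w
    using inversive[of w] that by (auto simp: add_pos_nonneg)
  moreover have "norm (fst (orb w) - foldr f w y) \<le> C * snd (orb w)"
    if w: "adm w" and y: "y \<in> E (last w)" for w y
  proof -
    obtain a where a: "a \<in> P (last w)" and le: "(norm (fst (orb w) - foldr f w y))\<^sup>2 \<le>
         (snd (orb w))\<^sup>2 * ((1 + (norm y)\<^sup>2) * (1 + (norm a)\<^sup>2) / (norm (y - a))\<^sup>2)"
      using inversive[of w] w y by blast
    have l: "last w \<in> {1..N}" using last_letter w by blast
    have "(1 + (norm y)\<^sup>2) * (1 + (norm a)\<^sup>2) / (norm (y - a))\<^sup>2 \<le> (1 + B\<^sup>2) * (1 + B\<^sup>2) / \<rho>\<^sup>2"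
      using bP[OF l a] bE[OF l y] sep[OF l a y] \<rho> B
      by (intro frac_le mult_mono add_mono power_mono) (auto simp: add_pos_nonneg)
    also have "\<dots> = ((1 + B\<^sup>2) / \<rho>)\<^sup>2" by (simp add: power2_eq_square)
    also have "\<dots> \<le> C\<^sup>2" unfolding C_def using \<rho> B by (intro power_mono) (auto simp: add_nonneg_nonneg)
    finally have "(norm (fst (orb w) - foldr f w y))\<^sup>2 \<le> (snd (orb w))\<^sup>2 * C\<^sup>2"
      using le by (meson mult_left_mono order_trans zero_le_power2)
    also have "\<dots> = (C * snd (orb w))\<^sup>2" by (simp add: power_mult_distrib mult.commute)
    finally have "(norm (fst (orb w) - foldr f w y))\<^sup>2 \<le> (C * snd (orb w))\<^sup>2" .
    moreover have "0 \<le> C * snd (orb w)" using pos[OF w] \<open>C > 0\<close> by simp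
    ultimately show ?thesis by (rule power2_le_imp_le)
  qed
  moreover have "\<exists>y\<in>E (last w). \<exists>y'\<in>E (last w). snd (orb w) \<le> C * norm (foldr f w y - foldr f w y')"
    if w: "adm w" for w
  proof -
    define j where "j = last w"
    have l: "j \<in> {1..N}" using last_letter w by (simp add: j_def)
    obtain \<kappa> a where \<kappa>: "\<kappa> > 0" and a: "a \<in> P j"
      and dist: "\<And>x y. x \<in> E j \<Longrightarrow> y \<in> E j \<Longrightarrow>
          norm (foldr f w x - foldr f w y) = norm (x - y) / (\<kappa> * (norm (x - a) * norm (y - a)))"
      and h: "snd (orb w) = 1 / (\<kappa> * (1 + (norm a)\<^sup>2))"
      using inversive[of w] w unfolding j_def by blast
    have E: "u j \<in> E j" "v j \<in> E j" using uv[OF l] by auto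
    have pos: "0 < norm (u j - a)" "0 < norm (v j - a)"
      using sep[OF l a E(1)] sep[OF l a E(2)] \<rho> by linarith+
    have le: "norm (u j - a) \<le> 2 * B" "norm (v j - a) \<le> 2 * B"
      using bE[OF l E(1)] bE[OF l E(2)] bP[OF l a] norm_triangle_ineq4[of "u j" a] norm_triangle_ineq4[of "v j" a]
      by linarith+
    have "\<sigma> / (\<kappa> * (2 * B)\<^sup>2) \<le> norm (u j - v j) / (\<kappa> * (norm (u j - a) * norm (v j - a)))"
      unfolding power2_eq_square using \<kappa> \<sigma> l pos le B by (intro frac_le mult_left_mono mult_mono) auto
    then have 1: "\<sigma> / (\<kappa> * (2 * B)\<^sup>2) \<le> norm (foldr f w (u j) - foldr f w (v j))"
      by (simp add: dist E)
    have "snd (orb w) \<le> 1 / \<kappa>"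
      unfolding h using \<kappa> by (intro frac_le) auto
    also have "1 / \<kappa> = (2 * B)\<^sup>2 / \<sigma> * (\<sigma> / (\<kappa> * (2 * B)\<^sup>2))"
      using \<sigma>(1) B by simp
    also have "\<dots> \<le> C * norm (foldr f w (u j) - foldr f w (v j))"
      using \<sigma>(1) \<kappa> \<open>C > 0\<close> by (intro mult_mono 1) (auto simp: C_def)
    finally show ?thesis using E unfolding j_def by blast
  qed
  ultimately show thesis by (rule that)
qed

text \<open>Orbit points near the boundary have small height, hence small images close by;
  conversely a small image forces its orbit point to be low and near. From here on the half space is
  no longer needed to describe the limit set.\<close>

lemma limit_set_iff:
  "x \<in> \<Lambda> \<longleftrightarrow> (\<forall>e>0. \<exists>w. adm w \<and> foldr f w ` E (last w) \<subseteq> ball x e)"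
proof -
  obtain C where C: "0 < C" and pos: "\<And>w. adm w \<Longrightarrow> 0 < snd (orb w)"
    and near: "\<And>w y. adm w \<Longrightarrow> y \<in> E (last w) \<Longrightarrow> norm (fst (orb w) - foldr f w y) \<le> C * snd (orb w)"
    and big: "\<And>w. adm w \<Longrightarrow> \<exists>y\<in>E (last w). \<exists>y'\<in>E (last w).
        snd (orb w) \<le> C * norm (foldr f w y - foldr f w y')"
    using orbit_near_image by metis
  show ?thesis
  proof
    assume x: "x \<in> \<Lambda>"
    show "\<forall>e>0. \<exists>w. adm w \<and> foldr f w ` E (last w) \<subseteq> ball x e"
    proof (intro allI impI)
      fix e :: real assume "e > 0"
      \<comment> \<open>The bound 1 excludes the orbit points of height at least 1, which need not
        come from a nonempty word.\<close>
      define d where "d = min 1 (e / (C + 1))"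
      have "d \<le> e / (C + 1)" by (simp add: d_def)
      then have "(C + 1) * d \<le> e" using C by (simp add: pos_le_divide_eq mult.commute)
      moreover have "d > 0" "d \<le> 1" using \<open>e > 0\<close> C by (simp_all add: d_def)
      ultimately have d: "d > 0" "d \<le> 1" "(C + 1) * d \<le> e" by simp_all
      obtain z where z: "z \<in> X" "dist z (x, 0) < d"
        using x d(1) unfolding limit_points_at_infinity_def islimpt_approachable by blast
      have parts: "dist (fst z) x < d" "\<bar>snd z\<bar> < d"
        using dist_fst_le[of z "(x, 0)"] dist_snd_le[of z "(x, 0)"] z(2) by (auto simp: dist_real_def)
      with orbit_cases[OF z(1)] d(2) obtain w where w: "adm w" "z = orb w" by fastforce
      have "foldr f w y \<in> ball x e" if "y \<in> E (last w)" for y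
      proof -
        have "dist x (foldr f w y) \<le> dist x (fst z) + norm (fst (orb w) - foldr f w y)"
          using dist_triangle[of x "foldr f w y" "fst z"] by (simp add: w(2) dist_norm)
        also have "\<dots> < d + C * d"
        proof -
          have "C * snd (orb w) \<le> C * d" using parts(2) C w(2) by simp
          with parts(1) near[OF w(1) that] show ?thesis unfolding w(2) dist_commute[of x] by linarith
        qed
        finally show ?thesis using d(3) by (simp add: algebra_simps)
      qed
      with w(1) show "\<exists>w. adm w \<and> foldr f w ` E (last w) \<subseteq> ball x e" by blast
    qed
  next
    assume R: "\<forall>e>0. \<exists>w. adm w \<and> foldr f w ` E (last w) \<subseteq> ball x e"
    have "\<exists>z\<in>X. z \<noteq> (x, 0) \<and> dist z (x, 0) < e" if "e > 0" for e
    proof -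
      \<comment> \<open>The height is below \<open>2 * C * d\<close> and the distance to the limit
        point is below \<open>C + 1\<close> times the height plus \<open>d\<close>; the denominator
        makes the total equal to \<open>e\<close>.\<close>
      define d where "d = e / (2 * C * (C + 1) + 1)"
      have den: "2 * C * (C + 1) + 1 > 0" using C by (simp add: add_pos_pos)
      then have d: "d > 0" "(2 * C * (C + 1) + 1) * d = e" using that by (simp_all add: d_def)
      obtain w where w: "adm w" and sub: "foldr f w ` E (last w) \<subseteq> ball x d"
        using R d(1) by blast
      obtain y y' where y: "y \<in> E (last w)" "y' \<in> E (last w)"
          and le: "snd (orb w) \<le> C * norm (foldr f w y - foldr f w y')"
        using big[OF w] by blast
      have yd: "dist x (foldr f w y) < d" "dist x (foldr f w y') < d" using sub y by auto
      have "norm (foldr f w y - foldr f w y') < 2 * d"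
        using dist_triangle[of "foldr f w y" "foldr f w y'" x] yd by (simp add: dist_norm norm_minus_commute)
      with C le have h: "snd (orb w) < C * (2 * d)" by (meson le_less_trans mult_strict_left_mono)
      have "dist (fst (orb w)) x \<le> norm (fst (orb w) - foldr f w y) + dist x (foldr f w y)"
        using dist_triangle[of "fst (orb w)" x "foldr f w y"] by (simp add: dist_norm norm_minus_commute)
      also have "\<dots> < C * snd (orb w) + d" using near[OF w y(1)] yd(1) by simp
      finally have 1: "dist (fst (orb w)) x < C * snd (orb w) + d" .
      have "dist (orb w) (x, 0) \<le> dist (fst (orb w)) x + \<bar>snd (orb w)\<bar>"
        using sqrt_sum_squares_le_sum_abs[of "dist (fst (orb w)) x" "snd (orb w)"]
        by (simp add: dist_prod_def dist_real_def)
      also have "\<dots> < (C + 1) * snd (orb w) + d" using 1 pos[OF w] by (simp add: algebra_simps)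
      also have "\<dots> < (C + 1) * (C * (2 * d)) + d" using h C by simp
      also have "\<dots> = e" using d(2) by (simp add: algebra_simps)
      finally have "dist (orb w) (x, 0) < e" .
      moreover have "orb w \<noteq> (x, 0)" using pos[OF w] by auto
      ultimately show ?thesis using orb_in w by blast
    qed
    then show "x \<in> \<Lambda>"
      unfolding limit_points_at_infinity_def islimpt_approachable by blast
  qed
qed

section \<open>Invariance of the limit set under the branches\<close>

text \<open>In the distortion formula for the one-letter word, the distances to the pole lie between
  \<rho> and \<open>2 * B\<close>.\<close>

lemma letter_bilipschitz:
  assumes j: "j \<in> {1..N}"
  obtains L where "0 < L"
    "\<And>x y. x \<in> E j \<Longrightarrow> y \<in> E j \<Longrightarrow> norm (f j x - f j y) \<le> L * norm (x - y)"
    "\<And>x y. x \<in> E j \<Longrightarrow> y \<in> E j \<Longrightarrow> norm (x - y) \<le> L * norm (f j x - f j y)"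
proof -
  obtain B \<rho> where B: "B > 0" and \<rho>: "\<rho> > 0"
    and bP: "\<And>a. a \<in> P j \<Longrightarrow> norm a \<le> B" and bE: "\<And>y. y \<in> E j \<Longrightarrow> norm y \<le> B"
    and sep: "\<And>a y. a \<in> P j \<Longrightarrow> y \<in> E j \<Longrightarrow> \<rho> \<le> norm (y - a)"
    using position_bounds j by metis
  have "adm [j]" using j by (simp add: admissible_Cons admissible_def)
  then obtain \<kappa> a where \<kappa>: "\<kappa> > 0" and a: "a \<in> P j"
    and dist: "\<And>x y. x \<in> E j \<Longrightarrow> y \<in> E j \<Longrightarrow>
          norm (f j x - f j y) = norm (x - y) / (\<kappa> * (norm (x - a) * norm (y - a)))"
    using inversive[of "[j]"] by auto
  define L where "L = max (1 / (\<kappa> * \<rho>\<^sup>2)) (\<kappa> * (2 * B)\<^sup>2)"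
  have "L > 0" using \<kappa> \<rho> by (simp add: L_def less_max_iff_disj)
  moreover have "norm (f j x - f j y) \<le> L * norm (x - y)" if "x \<in> E j" "y \<in> E j" for x y
  proof -
    have "norm (f j x - f j y) \<le> norm (x - y) / (\<kappa> * \<rho>\<^sup>2)"
      unfolding dist[OF that] power2_eq_square using \<kappa> \<rho> sep[OF a that(1)] sep[OF a that(2)]
      by (intro frac_le mult_left_mono mult_mono) auto
    also have "\<dots> = 1 / (\<kappa> * \<rho>\<^sup>2) * norm (x - y)" by simp
    also have "\<dots> \<le> L * norm (x - y)" by (intro mult_right_mono) (auto simp: L_def)
    finally show ?thesis .
  qed
  moreover have "norm (x - y) \<le> L * norm (f j x - f j y)" if "x \<in> E j" "y \<in> E j" for x y
  proof -
    have pos: "norm (x - a) > 0" "norm (y - a) > 0"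
      using sep[OF a that(1)] sep[OF a that(2)] \<rho> by linarith+
    have le: "norm (x - a) \<le> 2 * B" "norm (y - a) \<le> 2 * B"
      using bE[OF that(1)] bE[OF that(2)] bP[OF a] norm_triangle_ineq4[of x a] norm_triangle_ineq4[of y a]
      by linarith+
    have "norm (x - y) = \<kappa> * (norm (x - a) * norm (y - a)) * norm (f j x - f j y)"
      unfolding dist[OF that] using \<kappa> pos by simp
    also have "\<dots> \<le> \<kappa> * (2 * B)\<^sup>2 * norm (f j x - f j y)"
      unfolding power2_eq_square using \<kappa> le pos B by (intro mult_right_mono mult_left_mono mult_mono) auto
    also have "\<dots> \<le> L * norm (f j x - f j y)" by (intro mult_right_mono) (auto simp: L_def)
    finally show ?thesis .
  qed
  ultimately show thesis by (rule that)
qed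

text \<open>The finitely many pieces that miss \<open>x\<close> form a closed set, so a ball about
  \<open>x\<close> avoids them, while the image of a word meets the piece of its first
  letter.\<close>

lemma first_letter:
  obtains e where "0 < e" "\<And>w. adm w \<Longrightarrow> foldr f w ` E (last w) \<subseteq> ball x e \<Longrightarrow> x \<in> D (hd w)"
proof -
  have "closed (\<Union>i\<in>{i \<in> {1..N}. x \<notin> D i}. D i)"
    by (intro closed_UN ballI compact_imp_closed compact_D) simp_all
  then have "open (- (\<Union>i\<in>{i \<in> {1..N}. x \<notin> D i}. D i))" by (rule open_Compl)
  moreover have "x \<in> - (\<Union>i\<in>{i \<in> {1..N}. x \<notin> D i}. D i)" by auto
  ultimately obtain e where e: "e > 0" "ball x e \<subseteq> - (\<Union>i\<in>{i \<in> {1..N}. x \<notin> D i}. D i)"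
    unfolding open_contains_ball by blast
  have "x \<in> D (hd w)" if w: "adm w" "foldr f w ` E (last w) \<subseteq> ball x e" for w
  proof -
    obtain y where "y \<in> E (last w)" using E_two_points[OF last_letter[OF w(1)]] by blast
    then have "foldr f w y \<in> D (hd w)" "foldr f w y \<in> ball x e" using word_image w by auto
    with e(2) hd_letter[OF w(1)] show ?thesis by blast
  qed
  with e(1) show thesis by (rule that)
qed

lemma letter_unique: "x \<in> D i \<Longrightarrow> x \<in> D j \<Longrightarrow> i \<in> {1..N} \<Longrightarrow> j \<in> {1..N} \<Longrightarrow> i = j"
  using disjoint_D unfolding disjoint_family_on_def by blast

lemma limit_set_covered: "x \<in> \<Lambda> \<Longrightarrow> \<exists>j\<in>{1..N}. x \<in> D j"
  using first_letter[of x] limit_set_iff[of x] hd_letter by metis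

text \<open>Words whose images shrink to \<open>y\<close> eventually start with the letter of the
  piece containing \<open>y\<close>. This letter may follow \<open>j\<close>, so prefixing
  \<open>j\<close> gives admissible words whose images shrink to \<open>f j y\<close>.\<close>

lemma forward_invariant:
  assumes y: "y \<in> \<Lambda>" "y \<in> E j" and j: "j \<in> {1..N}"
  shows "f j y \<in> \<Lambda>"
proof -
  obtain k where k: "k \<in> {1..N}" "R j k" "y \<in> D k" using y(2) by (rule followersE)
  obtain L where L: "L > 0"
    and lip: "\<And>x y. x \<in> E j \<Longrightarrow> y \<in> E j \<Longrightarrow> norm (f j x - f j y) \<le> L * norm (x - y)"
    using letter_bilipschitz[OF j] by metis
  obtain e0 where e0: "e0 > 0" "\<And>w. adm w \<Longrightarrow> foldr f w ` E (last w) \<subseteq> ball y e0 \<Longrightarrow> y \<in> D (hd w)"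
    using first_letter by metis
  have "\<exists>w. adm w \<and> foldr f w ` E (last w) \<subseteq> ball (f j y) e" if "e > 0" for e
  proof -
    have "min e0 (e / L) > 0" using that e0 L by simp
    then obtain w where w: "adm w" "foldr f w ` E (last w) \<subseteq> ball y (min e0 (e / L))"
      using y(1) unfolding limit_set_iff by blast
    then have "y \<in> D (hd w)" by (intro e0(2)) auto
    then have hd: "hd w = k" using letter_unique k hd_letter[OF w(1)] by blast
    then have "adm (j # w)" using w j k by (simp add: admissible_Cons)
    moreover have "foldr f (j # w) z \<in> ball (f j y) e" if "z \<in> E (last (j # w))" for z
    proof -
      have "z \<in> E (last w)" using that w by simp
      then have z: "foldr f w z \<in> E j" "dist y (foldr f w z) < e / L"
        using word_image[OF w(1)] hd k w(2) by (auto intro: followersI)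
      have "dist (f j y) (f j (foldr f w z)) \<le> L * dist y (foldr f w z)"
        using lip[OF y(2) z(1)] by (simp add: dist_norm)
      also have "\<dots> < e" using z(2) L by (simp add: field_simps)
      finally show ?thesis by simp
    qed
    ultimately show ?thesis by blast
  qed
  then show ?thesis unfolding limit_set_iff by blast
qed

text \<open>Words whose images shrink to \<open>x\<close> eventually start with \<open>j\<close>.
  Removing this letter gives words whose images approach a point of the compact set
  \<open>E j\<close> mapped to \<open>x\<close>.\<close>

lemma backward_invariant:
  assumes x: "x \<in> \<Lambda>" "x \<in> D j" and j: "j \<in> {1..N}"
  obtains y where "y \<in> \<Lambda>" "y \<in> E j" "x = f j y"
proof -
  obtain L where L: "L > 0"
    and lip: "\<And>x y. x \<in> E j \<Longrightarrow> y \<in> E j \<Longrightarrow> norm (f j x - f j y) \<le> L * norm (x - y)"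
    and lip': "\<And>x y. x \<in> E j \<Longrightarrow> y \<in> E j \<Longrightarrow> norm (x - y) \<le> L * norm (f j x - f j y)"
    using letter_bilipschitz[OF j] by metis
  obtain u v where uv: "u \<in> E j" "v \<in> E j" "u \<noteq> v" using E_two_points[OF j] by blast
  obtain e0 where e0: "e0 > 0" "\<And>w. adm w \<Longrightarrow> foldr f w ` E (last w) \<subseteq> ball x e0 \<Longrightarrow> x \<in> D (hd w)"
    using first_letter by metis
  \<comment> \<open>A ball of radius \<open>m\<close> cannot contain both \<open>f j u\<close> and
    \<open>f j v\<close>; this excludes the word consisting of \<open>j\<close> alone, whose removal
    would leave nothing.\<close>
  define m where "m = norm (f j u - f j v) / 2"
  have m: "m > 0" using lip'[OF uv(1,2)] uv(3) by (auto simp: m_def)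
  have words: "\<exists>w. adm w \<and> R j (hd w) \<and> (\<forall>z\<in>E (last w). foldr f w z \<in> E j \<and> f j (foldr f w z) \<in> ball x e)"
    if "e > 0" for e
  proof -
    have "min e (min e0 m) > 0" using that e0 m by simp
    then obtain w' where w': "adm w'" "foldr f w' ` E (last w') \<subseteq> ball x (min e (min e0 m))"
      using x(1) unfolding limit_set_iff by blast
    then have "x \<in> D (hd w')" by (intro e0(2)) auto
    then have "hd w' = j" using letter_unique x j hd_letter[OF w'(1)] by blast
    then obtain w where w: "w' = j # w" using w'(1) by (metis list.collapse)
    have "w \<noteq> []"
    proof
      assume "w = []"
      then have "f j u \<in> ball x m" "f j v \<in> ball x m" using w' w uv by auto
      then show False
        using dist_triangle[of "f j u" "f j v" x] by (simp add: m_def dist_norm norm_minus_commute)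
    qed
    then have adm: "adm w" "R j (hd w)" using w' w by (auto simp: admissible_Cons)
    moreover have "foldr f w z \<in> E j \<and> f j (foldr f w z) \<in> ball x e" if "z \<in> E (last w)" for z
      using word_image[OF adm(1) that] hd_letter[OF adm(1)] adm(2) w'(2) w that \<open>w \<noteq> []\<close>
      by (auto intro: followersI)
    ultimately show ?thesis by blast
  qed
  have "continuous_on (E j) (f j)"
    unfolding continuous_on_iff
  proof (intro ballI allI impI)
    fix y e :: real and y' :: 'a assume "0 < e" and y': "y' \<in> E j"
    show "\<exists>d>0. \<forall>x'\<in>E j. dist x' y' < d \<longrightarrow> dist (f j x') (f j y') < e"
    proof (intro exI[of _ "e / L"] conjI ballI impI)
      show "e / L > 0" using \<open>e > 0\<close> L by simp
      fix x' assume "x' \<in> E j" "dist x' y' < e / L"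
      then have "dist (f j x') (f j y') \<le> L * dist x' y'" "L * dist x' y' < e"
        using lip y' L by (auto simp: dist_norm field_simps)
      then show "dist (f j x') (f j y') < e" by linarith
    qed
  qed
  then have "closed (f j ` E j)"
    using compact_continuous_image compact_E compact_imp_closed by blast
  moreover have "\<exists>y\<in>f j ` E j. dist y x < e" if "e > 0" for e
  proof -
    obtain w where w: "adm w" "\<forall>z\<in>E (last w). foldr f w z \<in> E j \<and> f j (foldr f w z) \<in> ball x e"
      using words[OF \<open>e > 0\<close>] by blast
    obtain z where "z \<in> E (last w)" using E_two_points[OF last_letter[OF w(1)]] by blast
    with w(2) show ?thesis by (auto simp: dist_commute)
  qed
  ultimately have "x \<in> f j ` E j" using closed_approachable by blast
  then obtain y where y: "y \<in> E j" "x = f j y" by blast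
  have "\<exists>w. adm w \<and> foldr f w ` E (last w) \<subseteq> ball y e" if "e > 0" for e
  proof -
    have "e / L > 0" using that L by simp
    then obtain w where w: "adm w" "\<forall>z\<in>E (last w). foldr f w z \<in> E j \<and> f j (foldr f w z) \<in> ball x (e / L)"
      using words by blast
    have "foldr f w z \<in> ball y e" if "z \<in> E (last w)" for z
    proof -
      have z: "foldr f w z \<in> E j" "dist x (f j (foldr f w z)) < e / L" using w(2) that by auto
      have "dist y (foldr f w z) \<le> L * dist x (f j (foldr f w z))"
        using lip'[OF y(1) z(1)] by (simp add: dist_norm y(2))
      also have "\<dots> < e" using z(2) L by (simp add: field_simps)
      finally show ?thesis by simp
    qed
    with w(1) show ?thesis by blast
  qed
  then have "y \<in> \<Lambda>" unfolding limit_set_iff by blast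
  with y show thesis using that by blast
qed

lemma word_limit: "adm w \<Longrightarrow> x \<in> \<Lambda> \<Longrightarrow> x \<in> E (last w) \<Longrightarrow> foldr f w x \<in> \<Lambda>"
proof (induction w)
  case (Cons j w)
  show ?case
  proof (cases "w = []")
    case True
    then show ?thesis using Cons.prems forward_invariant by (simp add: admissible_Cons)
  next
    case False
    with Cons.prems have w: "adm w" "R j (hd w)" "j \<in> {1..N}" by (simp_all add: admissible_Cons)
    moreover have "x \<in> E (last w)" using Cons.prems False by simp
    ultimately have "foldr f w x \<in> \<Lambda>" "foldr f w x \<in> E j"
      using Cons.IH Cons.prems word_image[OF w(1)] D_subset_E[OF hd_letter[OF w(1)] w(2)] by blast+
    then show ?thesis using forward_invariant w by simp
  qed
qed simp

section \<open>Cylinders as images of words\<close>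

lemma expanding_map_branch:
  assumes "j \<in> {1..N}" "y \<in> E j"
  shows "expanding_map N D F (Some (f j y)) = Some y"
proof -
  have "f j y \<in> D j" using maps assms by blast
  moreover from this have "(THE i. i \<in> {1..N} \<and> f j y \<in> D i) = j"
    using assms(1) letter_unique by (intro the_equality) blast+
  ultimately show ?thesis
    using inverse_branch[OF assms] assms(1) unfolding expanding_map_def by auto
qed

text \<open>On \<open>f j y\<close> the expanding map undoes \<open>f j\<close>, so the conditions
  for \<open>j # \<alpha>\<close> become those for \<alpha> at \<open>y\<close>. Admissibility
  places the cylinder of \<alpha> inside \<open>E j\<close>, and backward invariance supplies
  \<open>y\<close>.\<close>

lemma cylinder_eq_image:
  "adm \<alpha> \<Longrightarrow> cylinder \<Lambda> D (expanding_map N D F) \<alpha> = foldr f \<alpha> ` (\<Lambda> \<inter> E (last \<alpha>))"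
proof (induction \<alpha>)
  case (Cons j \<alpha>)
  let ?T = "expanding_map N D F"
  have j: "j \<in> {1..N}" using Cons.prems by (simp add: admissible_Cons)
  have step: "cylinder \<Lambda> D ?T (j # \<alpha>) = f j ` (\<Lambda> \<inter> E j \<inter> {y. \<forall>i<length \<alpha>. (?T ^^ i) (Some y) \<in> Some ` D (\<alpha> ! i)})"
    (is "?A = ?B")
  proof -
    have iff: "(\<forall>i<length (j # \<alpha>). (?T ^^ i) (Some (f j y)) \<in> Some ` D ((j # \<alpha>) ! i)) \<longleftrightarrow>
        (\<forall>i<length \<alpha>. (?T ^^ i) (Some y) \<in> Some ` D (\<alpha> ! i))" if "y \<in> E j" for y
      using maps[OF j that] expanding_map_branch[OF j that]
      by (simp add: All_less_Suc2 funpow_swap1)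
    show ?thesis
    proof (intro set_eqI iffI)
      fix x assume x: "x \<in> ?A"
      then have "(?T ^^ 0) (Some x) \<in> Some ` D ((j # \<alpha>) ! 0)" unfolding cylinder_def by blast
      then have "x \<in> D j" by auto
      moreover have "x \<in> \<Lambda>" using x by (simp add: cylinder_def)
      ultimately obtain y where y: "y \<in> \<Lambda>" "y \<in> E j" "x = f j y" using backward_invariant j by metis
      with x iff[OF y(2)] show "x \<in> ?B" unfolding cylinder_def by blast
    next
      fix x assume "x \<in> ?B"
      then obtain y where y: "y \<in> \<Lambda>" "y \<in> E j" "x = f j y"
          "\<forall>i<length \<alpha>. (?T ^^ i) (Some y) \<in> Some ` D (\<alpha> ! i)" by blast
      then show "x \<in> ?A" using iff[OF y(2)] forward_invariant[OF y(1,2) j] unfolding cylinder_def by simp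
    qed
  qed
  show ?case
  proof (cases "\<alpha> = []")
    case True
    then show ?thesis using step by simp
  next
    case False
    with Cons.prems have \<alpha>: "adm \<alpha>" "R j (hd \<alpha>)" by (simp_all add: admissible_Cons)
    have IH: "cylinder \<Lambda> D ?T \<alpha> = foldr f \<alpha> ` (\<Lambda> \<inter> E (last \<alpha>))" using Cons.IH \<alpha> by blast
    have "cylinder \<Lambda> D ?T \<alpha> \<subseteq> E j"
      unfolding IH using word_image[OF \<alpha>(1)] \<alpha>(2) hd_letter[OF \<alpha>(1)] by (auto intro: followersI)
    then have "\<Lambda> \<inter> E j \<inter> {y. \<forall>i<length \<alpha>. (?T ^^ i) (Some y) \<in> Some ` D (\<alpha> ! i)} = cylinder \<Lambda> D ?T \<alpha>"
      unfolding cylinder_def by blast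
    then show ?thesis using step IH False by (simp add: image_comp)
  qed
qed simp

section \<open>Closedness of the limit set and non-concentration of cylinders\<close>

lemma closed_limit_set: "closed \<Lambda>"
proof -
  have "x \<in> \<Lambda>" if x: "\<And>e. e > 0 \<Longrightarrow> \<exists>y\<in>\<Lambda>. dist y x < e" for x
    unfolding limit_set_iff
  proof (intro allI impI)
    fix e :: real assume "e > 0"
    then obtain y where y: "y \<in> \<Lambda>" "dist y x < e / 2" using x[of "e / 2"] by auto
    have "e / 2 > 0" using \<open>e > 0\<close> by simp
    then obtain w where w: "adm w" "foldr f w ` E (last w) \<subseteq> ball y (e / 2)"
      using y(1) unfolding limit_set_iff by blast
    moreover have "ball y (e / 2) \<subseteq> ball x e"
    proof
      fix z assume "z \<in> ball y (e / 2)"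
      then show "z \<in> ball x e" using y(2) dist_triangle[of x z y] by (simp add: dist_commute)
    qed
    ultimately show "\<exists>w. adm w \<and> foldr f w ` E (last w) \<subseteq> ball x e" by blast
  qed
  then show ?thesis
    unfolding closure_subset_eq[symmetric] closure_approachable by (simp add: subset_eq closure_approachable)
qed

text \<open>Any ball about a limit point \<open>q\<close> contains the image of a word starting with
  the letter of \<open>q\<close>, and that word maps suitable limit points to limit points of the
  same piece. Hence \<open>nonflat\<close>, a statement about whole words, excludes flatness on
  every open piece, and one constant per last letter suffices.\<close>

lemma nonconcentration:
  assumes nonflat: "\<And>w \<alpha> b c. adm w \<Longrightarrow> \<Lambda> \<noteq> {} \<Longrightarrow> (\<alpha>, b, c) \<noteq> (0, 0, 0) \<Longrightarrow>
    \<exists>y\<in>\<Lambda> \<inter> E (last w). quadric \<alpha> b c (foldr f w y) \<noteq> 0"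
  shows "\<exists>\<delta>>0. \<delta> < 1 \<and> (\<forall>\<alpha>. adm \<alpha> \<longrightarrow>
    (\<forall>x\<in>cylinder \<Lambda> D (expanding_map N D F) \<alpha>. \<forall>w. norm w = 1 \<longrightarrow>
      (\<exists>y\<in>cylinder \<Lambda> D (expanding_map N D F) \<alpha> -
          ball x (diameter (cylinder \<Lambda> D (expanding_map N D F) \<alpha>) / 4).
        \<delta> * diameter (cylinder \<Lambda> D (expanding_map N D F) \<alpha>) \<le> \<bar>(y - x) \<bullet> w\<bar>)))"
proof -
  have K: "compact (\<Lambda> \<inter> E j)" for j
    using closed_limit_set compact_E by (rule closed_Int_compact)
  have nondeg: "\<exists>y\<in>(\<Lambda> \<inter> E j) \<inter> ball q e. quadric \<alpha> b c y \<noteq> 0"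
    if q: "q \<in> \<Lambda> \<inter> E j" and e: "0 < e" and nz: "(\<alpha>, b, c) \<noteq> (0, 0, 0)" for j q e \<alpha> c and b :: 'a
  proof -
    obtain k where k: "k \<in> {1..N}" "R j k" "q \<in> D k" using q by (auto elim: followersE)
    obtain e0 where e0: "e0 > 0" "\<And>w. adm w \<Longrightarrow> foldr f w ` E (last w) \<subseteq> ball q e0 \<Longrightarrow> q \<in> D (hd w)"
      using first_letter by metis
    have "min e e0 > 0" using e e0 by simp
    then obtain w where w: "adm w" "foldr f w ` E (last w) \<subseteq> ball q (min e e0)"
      using q unfolding limit_set_iff Int_iff by blast
    then have "q \<in> D (hd w)" by (intro e0(2)) auto
    then have hd: "hd w = k" using letter_unique k hd_letter[OF w(1)] by blast
    obtain y where y: "y \<in> \<Lambda>" "y \<in> E (last w)" "quadric \<alpha> b c (foldr f w y) \<noteq> 0"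
      using nonflat[OF w(1) _ nz] q by blast
    have "foldr f w y \<in> \<Lambda>" "foldr f w y \<in> E j" "foldr f w y \<in> ball q e"
      using word_limit[OF w(1) y(1,2)] word_image[OF w(1) y(2)] hd k y(2) w(2)
      by (auto intro: followersI)
    with y(3) show ?thesis by blast
  qed
  have "\<exists>\<delta>>0. \<delta> < 1 \<and> (\<forall>a\<in>P j. \<forall>\<kappa>>0. \<forall>\<phi>::'a \<Rightarrow> 'a. \<forall>p\<in>\<Lambda> \<inter> E j. \<forall>w.
      (\<forall>x\<in>\<Lambda> \<inter> E j. \<forall>y\<in>\<Lambda> \<inter> E j. norm (\<phi> x - \<phi> y) = norm (x - y) / (\<kappa> * (norm (x - a) * norm (y - a)))) \<longrightarrow>
      norm w = 1 \<longrightarrow>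
      (\<exists>y\<in>\<Lambda> \<inter> E j. diameter (\<phi> ` (\<Lambda> \<inter> E j)) / 4 \<le> norm (\<phi> y - \<phi> p) \<and>
        \<delta> * diameter (\<phi> ` (\<Lambda> \<inter> E j)) \<le> \<bar>(\<phi> y - \<phi> p) \<bullet> w\<bar>))" if j: "j \<in> {1..N}" for j
    using disjoint_P[OF j] by (intro uniform_nonconcentration K compact_P j nondeg) auto
  then obtain \<delta>' where \<delta>': "\<And>j. j \<in> {1..N} \<Longrightarrow> 0 < \<delta>' j" "\<And>j. j \<in> {1..N} \<Longrightarrow> \<delta>' j < 1"
    and main: "\<And>j a \<kappa> \<phi> p w. j \<in> {1..N} \<Longrightarrow> a \<in> P j \<Longrightarrow> 0 < \<kappa> \<Longrightarrow> p \<in> \<Lambda> \<inter> E j \<Longrightarrow>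
      \<forall>x\<in>\<Lambda> \<inter> E j. \<forall>y\<in>\<Lambda> \<inter> E j. norm (\<phi> x - \<phi> y) = norm (x - y) / (\<kappa> * (norm (x - a) * norm (y - a))) \<Longrightarrow>
      norm w = 1 \<Longrightarrow>
      \<exists>y\<in>\<Lambda> \<inter> E j. diameter (\<phi> ` (\<Lambda> \<inter> E j)) / 4 \<le> norm (\<phi> y - \<phi> p) \<and>
        \<delta>' j * diameter (\<phi> ` (\<Lambda> \<inter> E j)) \<le> \<bar>(\<phi> y - (\<phi> p :: 'a)) \<bullet> w\<bar>"
    by metis
  \<comment> \<open>The entry 1/2 keeps the minimum defined without letters and below 1.\<close>
  define \<delta> where "\<delta> = Min (insert (1/2) (\<delta>' ` {1..N}))"
  have \<delta>: "\<delta> > 0" "\<delta> < 1" "\<And>j. j \<in> {1..N} \<Longrightarrow> \<delta> \<le> \<delta>' j"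
  proof -
    show "\<delta> > 0" unfolding \<delta>_def using \<delta>' by (subst Min_gr_iff) auto
    have "\<delta> \<le> 1/2" unfolding \<delta>_def by (intro Min_le) auto
    then show "\<delta> < 1" by simp
    show "\<delta> \<le> \<delta>' j" if "j \<in> {1..N}" for j
      unfolding \<delta>_def using that by (intro Min_le) auto
  qed
  have "\<exists>y\<in>cylinder \<Lambda> D (expanding_map N D F) \<alpha> -
          ball x (diameter (cylinder \<Lambda> D (expanding_map N D F) \<alpha>) / 4).
        \<delta> * diameter (cylinder \<Lambda> D (expanding_map N D F) \<alpha>) \<le> \<bar>(y - x) \<bullet> w\<bar>"
    if \<alpha>: "adm \<alpha>" and x: "x \<in> cylinder \<Lambda> D (expanding_map N D F) \<alpha>" and w: "norm w = 1" for \<alpha> x w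
  proof -
    define j K' where "j = last \<alpha>" and "K' = \<Lambda> \<inter> E j"
    have j: "j \<in> {1..N}" using last_letter[OF \<alpha>] by (simp add: j_def)
    have C: "cylinder \<Lambda> D (expanding_map N D F) \<alpha> = foldr f \<alpha> ` K'"
      unfolding K'_def j_def by (rule cylinder_eq_image[OF \<alpha>])
    obtain p where p: "p \<in> K'" "x = foldr f \<alpha> p" using x C by auto
    obtain \<kappa> a where \<kappa>: "\<kappa> > 0" and a: "a \<in> P j"
      and dist: "\<And>x y. x \<in> E j \<Longrightarrow> y \<in> E j \<Longrightarrow>
          norm (foldr f \<alpha> x - foldr f \<alpha> y) = norm (x - y) / (\<kappa> * (norm (x - a) * norm (y - a)))"
      using inversive[of \<alpha>] \<alpha> unfolding j_def by blast
    obtain y where y: "y \<in> K'" "diameter (foldr f \<alpha> ` K') / 4 \<le> norm (foldr f \<alpha> y - foldr f \<alpha> p)"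
        "\<delta>' j * diameter (foldr f \<alpha> ` K') \<le> \<bar>(foldr f \<alpha> y - foldr f \<alpha> p) \<bullet> w\<bar>"
      using main[OF j a \<kappa> _ _ w, of p "foldr f \<alpha>"] p(1) dist unfolding K'_def by blast
    \<comment> \<open>Continuity makes the image bounded and its diameter nonnegative, so that
      lowering \<open>\<delta>' j\<close> to \<delta> weakens the inequality.\<close>
    have "continuous_on K' (foldr f \<alpha>)"
    proof -
      have "K' \<inter> {a} = {}" using a disjoint_P[OF j] by (auto simp: K'_def)
      show ?thesis
        unfolding continuous_on_def
      proof
        fix x0 assume x0: "x0 \<in> K'"
        have "((\<lambda>x. norm (x - x0) / (\<kappa> * (norm (x - a) * norm (x0 - a)))) \<longlongrightarrow>
            norm (x0 - x0) / (\<kappa> * (norm (x0 - a) * norm (x0 - a)))) (at x0 within K')"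
          using \<kappa> x0 \<open>K' \<inter> {a} = {}\<close> by (intro tendsto_intros) auto
        then have "((\<lambda>x. norm (foldr f \<alpha> x - foldr f \<alpha> x0)) \<longlongrightarrow> 0) (at x0 within K')"
          using x0 by (auto simp: dist K'_def eventually_at_filter elim!: Lim_transform_eventually)
        then show "(foldr f \<alpha> \<longlongrightarrow> foldr f \<alpha> x0) (at x0 within K')"
          using Lim_null tendsto_norm_zero_iff by blast
      qed
    qed
    then have "bounded (foldr f \<alpha> ` K')"
      using K[of j] by (auto simp: K'_def intro: compact_imp_bounded compact_continuous_image)
    then have "diameter (foldr f \<alpha> ` K') \<ge> 0" by (rule diameter_ge_0)
    then have "\<delta> * diameter (foldr f \<alpha> ` K') \<le> \<delta>' j * diameter (foldr f \<alpha> ` K')"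
      using \<delta>(3)[OF j] by (rule mult_right_mono[rotated])
    with y(3) have "\<delta> * diameter (foldr f \<alpha> ` K') \<le> \<bar>(foldr f \<alpha> y - x) \<bullet> w\<bar>"
      by (simp add: p(2))
    moreover have "foldr f \<alpha> y \<in> foldr f \<alpha> ` K' - ball x (diameter (foldr f \<alpha> ` K') / 4)"
      using y p by (auto simp: dist_norm norm_minus_commute)
    ultimately show ?thesis unfolding C by blast
  qed
  with \<delta> show ?thesis by blast
qed

end

section \<open>The Lorentz group and its Poincare extension\<close>

lemma all_lorentz_index:
  "(\<forall>i :: 'm option option. P i) \<longleftrightarrow> P None \<and> P (Some None) \<and> (\<forall>k. P (Some (Some k)))"
  by (metis option.exhaust)

lemma sum_option: "(\<Sum>i\<in>(UNIV :: 'm::finite option set). h i) = h None + (\<Sum>k\<in>UNIV. h (Some k))"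
  by (simp add: UNIV_option_conv sum.reindex)

section \<open>The Lorentz form and its isometries\<close>

definition lorentz_form :: "('m::finite) lorentz_vec \<Rightarrow> 'm lorentz_vec \<Rightarrow> real" where
  "lorentz_form v w = (\<Sum>i\<in>UNIV. v $ Some i * w $ Some i) - v $ None * w $ None"

lemma lorentz_form_coordinates:
  "lorentz_form v w = v $ Some None * w $ Some None + (\<Sum>k\<in>UNIV. v $ Some (Some k) * w $ Some (Some k))
     - v $ None * w $ None"
  by (simp add: lorentz_form_def sum_option)

lemma lorentz_form_self: "lorentz_form v v = quadratic_form v"
  by (simp add: lorentz_form_def quadratic_form_def power2_eq_square)

lemma lorentz_form_add: "lorentz_form (u + v) w = lorentz_form u w + lorentz_form v w"
  "lorentz_form w (u + v) = lorentz_form w u + lorentz_form w v"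
  by (simp_all add: lorentz_form_def algebra_simps sum.distrib)

lemma lorentz_form_scaleR: "lorentz_form (c *\<^sub>R v) w = c * lorentz_form v w"
  "lorentz_form v (c *\<^sub>R w) = c * lorentz_form v w"
  by (simp_all add: lorentz_form_def algebra_simps sum_distrib_left)

lemma lorentz_form_commute: "lorentz_form v w = lorentz_form w v"
  by (simp add: lorentz_form_def mult.commute)

lemma lorentz_form_polarization:
  "2 * lorentz_form v w = quadratic_form (v + w) - quadratic_form v - quadratic_form w"
  by (simp add: lorentz_form_add lorentz_form_commute[of w v] flip: lorentz_form_self)

lemma SO_Q_form:
  assumes "A \<in> SO_Q"
  shows "lorentz_form (A *v v) (A *v w) = lorentz_form v w"
proof -
  have "2 * lorentz_form (A *v v) (A *v w) = 2 * lorentz_form v w"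
    unfolding lorentz_form_polarization using assms
    by (simp add: SO_Q_def flip: matrix_vector_right_distrib)
  then show ?thesis by simp
qed

lemma
  fixes A :: "'a::field ^ 'n ^ 'n"
  assumes "det A \<noteq> 0"
  shows matrix_inv_right_det: "A ** matrix_inv A = mat 1"
    and matrix_inv_left_det: "matrix_inv A ** A = mat 1"
proof -
  have "\<exists>A'. A ** A' = mat 1 \<and> A' ** A = mat 1"
    using assms unfolding invertible_det_nz[symmetric] invertible_def by blast
  from someI_ex[OF this] show "A ** matrix_inv A = mat 1" "matrix_inv A ** A = mat 1"
    unfolding matrix_inv_def by auto
qed

lemma SO_Q_det: "A \<in> SO_Q \<Longrightarrow> det A \<noteq> 0"
  by (simp add: SO_Q_def)

lemma SO_Q_nonzero:
  assumes "A \<in> SO_Q" "v \<noteq> 0"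
  shows "A *v v \<noteq> 0"
proof
  assume "A *v v = 0"
  then have "(matrix_inv A ** A) *v v = 0"
    by (simp flip: matrix_vector_mul_assoc)
  with assms matrix_inv_left_det[OF SO_Q_det[OF assms(1)]] show False by simp
qed

lemma SO_Q_mult: "A \<in> SO_Q \<Longrightarrow> B \<in> SO_Q \<Longrightarrow> A ** B \<in> SO_Q"
  by (simp add: SO_Q_def det_mul flip: matrix_vector_mul_assoc)

lemma SO_Q_one: "mat 1 \<in> SO_Q"
  by (simp add: SO_Q_def)

lemma SO_Q_inv:
  assumes "A \<in> SO_Q"
  shows "matrix_inv A \<in> SO_Q"
proof -
  note inv = matrix_inv_right_det[OF SO_Q_det[OF assms]]
  have "det A * det (matrix_inv A) = 1" by (simp add: inv flip: det_mul)
  then have "det (matrix_inv A) = 1" using assms by (simp add: SO_Q_def)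
  moreover have "quadratic_form (matrix_inv A *v x) = quadratic_form x" for x
  proof -
    have "quadratic_form (A *v (matrix_inv A *v x)) = quadratic_form (matrix_inv A *v x)"
      using assms unfolding SO_Q_def by blast
    then show ?thesis by (simp add: matrix_vector_mul_assoc inv)
  qed
  ultimately show ?thesis by (simp add: SO_Q_def)
qed

text \<open>
  \<open>horo_vector \<xi> s\<close> is \<open>2t\<close> times the hyperboloid point of \<open>(\<xi>, t)\<close>, where \<open>s = t\<^sup>2\<close>; it still makes sense
  for \<open>t = 0\<close>. The functional \<open>gap\<close> recovers the scaling of a multiple of it.
\<close>

definition horo_vector :: "real ^ 'm \<Rightarrow> real \<Rightarrow> ('m::finite) lorentz_vec" where
  "horo_vector \<xi> s = lorentz_vector (2 *\<^sub>R \<xi>) ((norm \<xi>)\<^sup>2 + s - 1) ((norm \<xi>)\<^sup>2 + s + 1)"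

definition gap :: "('m::finite) lorentz_vec \<Rightarrow> real" where
  "gap v = (v $ None - v $ Some None) / 2"

lemma lorentz_vector_nth [simp]:
  "lorentz_vector y a b $ None = b" "lorentz_vector y a b $ Some None = a"
  "lorentz_vector y a b $ Some (Some k) = y $ k"
  by (simp_all add: lorentz_vector_def)

lemma gap_scaleR: "gap (c *\<^sub>R v) = c * gap v"
  by (simp add: gap_def algebra_simps)

lemma gap_horo_vector: "gap (horo_vector \<xi> s) = 1"
  by (simp add: gap_def horo_vector_def)

text \<open>The scaling functional is a pairing with the light vector of infinity. Invariance of the
  form therefore controls how a matrix changes \<open>gap\<close>.\<close>

lemma gap_eq_form: "lorentz_form (lorentz_vector 0 1 1) v = - 2 * gap v"
  by (simp add: lorentz_form_coordinates gap_def)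

lemma to_light_cone_Some: "to_light_cone (Some \<xi>) = horo_vector \<xi> 0"
  by (simp add: horo_vector_def)

text \<open>All metric information comes from this identity: for \<open>s = r = 0\<close> it
  recovers Euclidean distances of boundary points, and for \<open>s = 1\<close> it relates the base
  point to them.\<close>

lemma form_horo_vector:
  "lorentz_form (horo_vector \<xi> s) (horo_vector \<eta> r) = - 2 * ((norm (\<xi> - \<eta>))\<^sup>2 + s + r)"
proof -
  have "(\<Sum>k\<in>UNIV. (2 * \<xi> $ k) * (2 * \<eta> $ k)) = 4 * (\<xi> \<bullet> \<eta>)"
    by (simp add: inner_vec_def sum_distrib_left)
  then show ?thesis
    unfolding lorentz_form_coordinates horo_vector_def power2_norm_eq_inner
    by (simp add: inner_diff inner_commute algebra_simps)
qed

lemma quadratic_form_horo_vector: "quadratic_form (horo_vector \<xi> s) = - 4 * s"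
  by (simp add: form_horo_vector flip: lorentz_form_self)

lemma quadratic_form_coordinates:
  "quadratic_form v = (\<Sum>k\<in>UNIV. (v $ Some (Some k))\<^sup>2) - 2 * gap v * (v $ None + v $ Some None)"
proof -
  have "2 * gap v * (v $ None + v $ Some None) = (v $ None)\<^sup>2 - (v $ Some None)\<^sup>2"
    unfolding gap_def power2_eq_square by (simp add: field_simps)
  then show ?thesis by (simp add: quadratic_form_def sum_option)
qed

text \<open>Dividing by \<open>gap v\<close> normalises the scaling; the spatial coordinates then
  give the boundary point and the value of the quadratic form gives the squared height.\<close>

lemma horo_vector_decomposition:
  assumes "gap v \<noteq> 0"
  shows "v = gap v *\<^sub>R horo_vector (\<chi> k. v $ Some (Some k) / (2 * gap v)) (- quadratic_form v / (4 * (gap v)\<^sup>2))"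
proof -
  define \<xi> where "\<xi> = (\<chi> k. v $ Some (Some k) / (2 * gap v))"
  have "(norm \<xi>)\<^sup>2 = (\<Sum>k\<in>UNIV. (v $ Some (Some k))\<^sup>2) / (4 * (gap v)\<^sup>2)"
    unfolding power2_norm_eq_inner \<xi>_def
    by (simp add: inner_vec_def power2_eq_square sum_divide_distrib)
  then have sum: "(norm \<xi>)\<^sup>2 - quadratic_form v / (4 * (gap v)\<^sup>2) = (v $ None + v $ Some None) / (2 * gap v)"
    using assms by (simp add: quadratic_form_coordinates field_simps power2_eq_square)
  have "gap v * ((v $ None + v $ Some None) / (2 * gap v) - 1) = v $ Some None"
    "gap v * ((v $ None + v $ Some None) / (2 * gap v) + 1) = v $ None"
    using assms by (simp_all add: gap_def field_simps)
  with sum show ?thesis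
    unfolding vec_eq_iff all_lorentz_index \<xi>_def[symmetric] horo_vector_def
    using assms by (simp add: \<xi>_def)
qed

lemma light_vector_infinity:
  assumes "gap v = 0" "quadratic_form v = 0"
  shows "v = (v $ None) *\<^sub>R lorentz_vector 0 1 1"
proof -
  have "(\<Sum>k\<in>UNIV. (v $ Some (Some k))\<^sup>2) = 0"
    using assms by (simp add: quadratic_form_coordinates)
  then have "v $ Some (Some k) = 0" for k by (simp add: sum_nonneg_eq_0_iff)
  moreover have "v $ Some None = v $ None" using assms(1) by (simp add: gap_def)
  ultimately show ?thesis by (simp add: vec_eq_iff all_lorentz_index)
qed

lemma of_light_cone_gap:
  "of_light_cone v = (if gap v = 0 then None else Some (\<chi> k. v $ Some (Some k) / (2 * gap v)))"
proof -
  have "v $ None - v $ Some None = 2 * gap v" by (simp add: gap_def)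
  then show ?thesis by (simp add: of_light_cone_def)
qed

lemma of_light_cone_scaleR: "c \<noteq> 0 \<Longrightarrow> of_light_cone (c *\<^sub>R v) = of_light_cone v"
  by (simp add: of_light_cone_gap gap_scaleR vec_eq_iff)

lemma quadratic_form_to_light_cone: "quadratic_form (to_light_cone p) = 0"
proof (cases p)
  case None
  then show ?thesis by (simp add: quadratic_form_coordinates gap_def)
next
  case (Some \<xi>)
  then show ?thesis unfolding Some to_light_cone_Some quadratic_form_horo_vector by simp
qed

lemma to_light_cone_nonzero: "to_light_cone p \<noteq> 0"
proof (cases p)
  case None
  then show ?thesis by (simp add: vec_eq_iff all_lorentz_index)
next
  case (Some \<xi>)
  have "gap (to_light_cone p) = 1" unfolding Some to_light_cone_Some by (rule gap_horo_vector)
  then show ?thesis by (auto simp: gap_def)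
qed

lemma of_to_light_cone: "of_light_cone (to_light_cone p) = p"
proof (cases p)
  case None
  then show ?thesis by (simp add: of_light_cone_def)
next
  case (Some \<xi>)
  then show ?thesis
    unfolding Some to_light_cone_Some of_light_cone_gap gap_horo_vector
    by (simp add: horo_vector_def vec_eq_iff)
qed

lemma to_of_light_cone:
  assumes "quadratic_form v = 0" "v \<noteq> 0"
  obtains c where "c \<noteq> 0" "v = c *\<^sub>R to_light_cone (of_light_cone v)"
proof (cases "gap v = 0")
  case True
  from light_vector_infinity[OF True assms(1)] assms(2) show thesis
    by (intro that[of "v $ None"]) (auto simp: of_light_cone_gap True)
next
  case False
  then show thesis
    using horo_vector_decomposition[OF False] assms(1)
    by (intro that[of "gap v"]) (simp_all add: of_light_cone_gap to_light_cone_Some del: to_light_cone.simps)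
qed

lemma act_of_vector:
  assumes "A \<in> SO_Q"
  obtains c where "c \<noteq> 0" "A *v to_light_cone p = c *\<^sub>R to_light_cone (lorentz_boundary_act A p)"
proof (rule to_of_light_cone)
  show "quadratic_form (A *v to_light_cone p) = 0"
    using assms quadratic_form_to_light_cone by (simp add: SO_Q_def)
  show "A *v to_light_cone p \<noteq> 0" by (rule SO_Q_nonzero[OF assms to_light_cone_nonzero])
qed (auto simp: lorentz_boundary_act_def intro: that)

lemma act_mult:
  assumes "B \<in> SO_Q"
  shows "lorentz_boundary_act (A ** B) p = lorentz_boundary_act A (lorentz_boundary_act B p)"
proof -
  obtain c where c: "c \<noteq> 0" "B *v to_light_cone p = c *\<^sub>R to_light_cone (lorentz_boundary_act B p)"
    using act_of_vector[OF assms] .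
  have "lorentz_boundary_act (A ** B) p = of_light_cone (c *\<^sub>R (A *v to_light_cone (lorentz_boundary_act B p)))"
    unfolding lorentz_boundary_act_def[of "A ** B"]
    by (simp add: c(2) matrix_vector_mult_scaleR flip: matrix_vector_mul_assoc)
  then show ?thesis by (simp add: of_light_cone_scaleR c(1) lorentz_boundary_act_def[of A])
qed

lemma act_one: "lorentz_boundary_act (mat 1) p = p"
  by (simp add: lorentz_boundary_act_def of_to_light_cone)

lemma act_inv:
  assumes "A \<in> SO_Q"
  shows "lorentz_boundary_act (matrix_inv A) (lorentz_boundary_act A p) = p"
    and "lorentz_boundary_act A (lorentz_boundary_act (matrix_inv A) p) = p"
  using act_mult[OF assms, of "matrix_inv A" p] act_mult[OF SO_Q_inv[OF assms], of A p]
    matrix_inv_left_det[OF SO_Q_det[OF assms]] matrix_inv_right_det[OF SO_Q_det[OF assms]]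
  by (simp_all add: act_one)

text \<open>The light vector of the pole is sent to a multiple \<tau> of that of infinity, and
  pairing with the latter is \<open>gap\<close>. Comparing this pairing before and after
  \<open>A\<close> gives the formula.\<close>

lemma gap_at_pole:
  assumes A: "A \<in> SO_Q" and pole: "lorentz_boundary_act A (Some a) = None"
  obtains \<tau> where "\<tau> \<noteq> 0" "\<And>\<xi> s. gap (A *v horo_vector \<xi> s) = ((norm (\<xi> - a))\<^sup>2 + s) / \<tau>"
proof -
  obtain \<tau> where \<tau>: "\<tau> \<noteq> 0" "A *v horo_vector a 0 = \<tau> *\<^sub>R lorentz_vector 0 1 1"
    using act_of_vector[OF A, of "Some a"] unfolding pole to_light_cone_Some by auto
  have "gap (A *v horo_vector \<xi> s) = ((norm (\<xi> - a))\<^sup>2 + s) / \<tau>" for \<xi> s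
  proof -
    have "lorentz_form (A *v horo_vector a 0) (A *v horo_vector \<xi> s) = - 2 * ((norm (\<xi> - a))\<^sup>2 + s)"
      by (simp add: SO_Q_form[OF A] form_horo_vector norm_minus_commute)
    then have "\<tau> * gap (A *v horo_vector \<xi> s) = (norm (\<xi> - a))\<^sup>2 + s"
      unfolding \<tau>(2) lorentz_form_scaleR gap_eq_form by simp
    with \<tau>(1) show ?thesis by (simp add: field_simps)
  qed
  with \<tau>(1) show thesis by (rule that)
qed

section \<open>The identity component and the Poincare extension\<close>

lemma SO_Q_component_subset: "SO_Q_component \<subseteq> SO_Q"
  unfolding SO_Q_component_def by (rule connected_component_subset)

lemma matrix_vector_base: "(A *v horo_vector 0 1) $ i = 2 * A $ i $ None"
  by (simp add: matrix_vector_mult_def horo_vector_def sum_option)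

text \<open>The entry depends continuously on \<open>A\<close> and equals 1 at the identity. It
  cannot vanish, because the image of the timelike base vector would then have a nonnegative
  quadratic form.\<close>

lemma SO_Q_component_time:
  fixes A :: "('m::finite) lorentz_mat"
  assumes "A \<in> SO_Q_component"
  shows "0 < A $ None $ None"
proof (rule ccontr)
  assume "\<not> 0 < A $ None $ None"
  let ?S = "(\<lambda>A :: 'm lorentz_mat. A $ None $ None) ` SO_Q_component"
  have "connected ?S"
    unfolding SO_Q_component_def
    by (intro connected_continuous_image connected_connected_component continuous_intros)
  moreover have "A $ None $ None \<in> ?S" using assms by blast
  moreover have "1 \<in> ?S"
  proof -
    have "mat 1 \<in> SO_Q_component"
      unfolding SO_Q_component_def using SO_Q_one by simp
    then show ?thesis by (intro image_eqI[of _ _ "mat 1"]) (auto simp: mat_def)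
  qed
  ultimately have "0 \<in> ?S"
    by (rule connectedD_interval) (use \<open>\<not> 0 < A $ None $ None\<close> in auto)
  then obtain B :: "'m lorentz_mat" where B: "B \<in> SO_Q_component" "B $ None $ None = 0"
    by auto
  let ?v = "B *v horo_vector 0 1"
  have "quadratic_form ?v = - 4"
    using B(1) SO_Q_component_subset by (auto simp: SO_Q_def quadratic_form_horo_vector)
  moreover have "?v $ None = 0" using B(2) by (simp add: matrix_vector_base)
  moreover have "0 \<le> (\<Sum>i\<in>UNIV. (?v $ Some i)\<^sup>2)" by (intro sum_nonneg) simp
  ultimately show False unfolding quadratic_form_def by simp
qed

lemma gap_base_positive:
  assumes "A \<in> SO_Q_component"
  shows "0 < gap (A *v horo_vector 0 1)"
proof -
  let ?v = "A *v horo_vector 0 1"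
  have "quadratic_form ?v = - 4"
    using assms SO_Q_component_subset by (auto simp: SO_Q_def quadratic_form_horo_vector)
  moreover have "0 \<le> (\<Sum>k\<in>UNIV. (?v $ Some (Some k))\<^sup>2)" by (intro sum_nonneg) simp
  ultimately have "(?v $ Some None)\<^sup>2 < (?v $ None)\<^sup>2"
    by (simp add: quadratic_form_def sum_option)
  moreover have "0 < ?v $ None"
    using SO_Q_component_time[OF assms] by (simp add: matrix_vector_base)
  ultimately have "?v $ Some None < ?v $ None"
    using power2_less_imp_less by fastforce
  then show ?thesis by (simp add: gap_def)
qed

text \<open>Light vectors are rescaled by the factor \<open>(norm (y - a))\<^sup>2 / \<tau>\<close>
  read off from \<open>gap\<close>. Comparing Lorentz pairings before and after \<open>A\<close>
  then gives the distance formula and the estimate; \<kappa> is \<open>1 / \<tau>\<close>.\<close>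

lemma poincare_extension:
  fixes A :: "('m::finite) lorentz_mat"
  assumes A: "A \<in> SO_Q_component" and pole: "lorentz_boundary_act A (Some a) = None"
  obtains \<kappa> where "0 < \<kappa>"
    "\<And>y z \<eta> \<zeta>. y \<noteq> a \<Longrightarrow> z \<noteq> a \<Longrightarrow> lorentz_boundary_act A (Some y) = Some \<eta> \<Longrightarrow>
       lorentz_boundary_act A (Some z) = Some \<zeta> \<Longrightarrow>
       norm (\<eta> - \<zeta>) = norm (y - z) / (\<kappa> * (norm (y - a) * norm (z - a)))"
    "snd (lorentz_act A base_point) = 1 / (\<kappa> * (1 + (norm a)\<^sup>2))"
    "\<And>y \<eta>. y \<noteq> a \<Longrightarrow> lorentz_boundary_act A (Some y) = Some \<eta> \<Longrightarrow>
       (norm (fst (lorentz_act A base_point) - \<eta>))\<^sup>2 \<le>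
         (snd (lorentz_act A base_point))\<^sup>2 * ((1 + (norm y)\<^sup>2) * (1 + (norm a)\<^sup>2) / (norm (y - a))\<^sup>2)"
proof -
  have SO: "A \<in> SO_Q" using A SO_Q_component_subset by blast
  obtain \<tau> where \<tau>: "\<tau> \<noteq> 0" and gap: "\<And>\<xi> s. gap (A *v horo_vector \<xi> s) = ((norm (\<xi> - a))\<^sup>2 + s) / \<tau>"
    using gap_at_pole[OF SO pole] by metis
  define G where "G = gap (A *v horo_vector 0 1)"
  have G: "G > 0" "G = (1 + (norm a)\<^sup>2) / \<tau>"
    using gap_base_positive[OF A] unfolding G_def by (simp_all add: gap add.commute)
  \<comment> \<open>The sign is the one place where the identity component enters: it keeps the gap
    of the base vector positive.\<close>
  have "\<tau> > 0"
    using G zero_less_divide_iff[of "1 + (norm a)\<^sup>2" \<tau>] by (smt (verit) zero_le_power2)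
  have image: "A *v horo_vector y 0 = ((norm (y - a))\<^sup>2 / \<tau>) *\<^sub>R horo_vector \<eta> 0"
    if y: "lorentz_boundary_act A (Some y) = Some \<eta>" for y \<eta>
  proof -
    obtain c where "A *v horo_vector y 0 = c *\<^sub>R horo_vector \<eta> 0"
      using act_of_vector[OF SO, of "Some y"] unfolding y to_light_cone_Some by metis
    moreover from this have "c = (norm (y - a))\<^sup>2 / \<tau>"
      using gap[of y 0] by (simp add: gap_scaleR gap_horo_vector)
    ultimately show ?thesis by simp
  qed
  define \<xi>0 where "\<xi>0 = (\<chi> k. (A *v horo_vector 0 1) $ Some (Some k) / (2 * G))"
  have base: "A *v horo_vector 0 1 = G *\<^sub>R horo_vector \<xi>0 (1 / G\<^sup>2)"
  proof -
    have "quadratic_form (A *v horo_vector 0 1) = - 4"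
      using SO by (simp add: SO_Q_def quadratic_form_horo_vector)
    then show ?thesis
      using horo_vector_decomposition[of "A *v horo_vector 0 1"] G(1) unfolding G_def[symmetric] \<xi>0_def
      by simp
  qed
  have half: "to_hyperboloid base_point = (1/2) *\<^sub>R (horo_vector 0 1 :: 'm lorentz_vec)"
    by (simp add: to_hyperboloid_def base_point_def horo_vector_def vec_eq_iff all_lorentz_index)
  have orbit: "lorentz_act A base_point = (\<xi>0, 1 / G)"
  proof -
    have nth: "(A *v to_hyperboloid base_point) $ i = (A *v horo_vector 0 1) $ i / 2" for i
      unfolding half matrix_vector_mult_scaleR by simp
    have diff: "(A *v horo_vector 0 1) $ None / 2 - (A *v horo_vector 0 1) $ Some None / 2 = G"
      by (simp add: G_def gap_def diff_divide_distrib)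
    show ?thesis
      unfolding lorentz_act_def of_hyperboloid_def nth diff \<xi>0_def by (simp add: vec_eq_iff)
  qed
  show thesis
  proof (rule that)
    show "0 < 1 / \<tau>" using \<open>\<tau> > 0\<close> by simp
    show "snd (lorentz_act A base_point) = 1 / (1 / \<tau> * (1 + (norm a)\<^sup>2))"
      by (simp add: orbit G(2))
    show "norm (\<eta> - \<zeta>) = norm (y - z) / (1 / \<tau> * (norm (y - a) * norm (z - a)))"
      if ne: "y \<noteq> a" "z \<noteq> a" and y: "lorentz_boundary_act A (Some y) = Some \<eta>"
        and z: "lorentz_boundary_act A (Some z) = Some \<zeta>" for y z \<eta> \<zeta>
    proof -
      have "lorentz_form (A *v horo_vector y 0) (A *v horo_vector z 0) = - 2 * (norm (y - z))\<^sup>2"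
        by (simp add: SO_Q_form[OF SO] form_horo_vector)
      then have "(norm (y - a))\<^sup>2 / \<tau> * ((norm (z - a))\<^sup>2 / \<tau> * (norm (\<eta> - \<zeta>))\<^sup>2) = (norm (y - z))\<^sup>2"
        unfolding image[OF y] image[OF z] lorentz_form_scaleR form_horo_vector by (simp add: algebra_simps)
      then have "(norm (\<eta> - \<zeta>) * (norm (y - a) * norm (z - a)))\<^sup>2 = (\<tau> * norm (y - z))\<^sup>2"
        using \<open>\<tau> > 0\<close> by (simp add: field_simps power2_eq_square)
      then have "norm (\<eta> - \<zeta>) * (norm (y - a) * norm (z - a)) = \<tau> * norm (y - z)"
        using \<open>\<tau> > 0\<close> by (subst (asm) power2_eq_iff_nonneg) auto
      then show ?thesis using ne \<open>\<tau> > 0\<close> by (simp add: eq_divide_eq mult.commute)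
    qed
    show "(norm (fst (lorentz_act A base_point) - \<eta>))\<^sup>2 \<le>
         (snd (lorentz_act A base_point))\<^sup>2 * ((1 + (norm y)\<^sup>2) * (1 + (norm a)\<^sup>2) / (norm (y - a))\<^sup>2)"
      if ne: "y \<noteq> a" and y: "lorentz_boundary_act A (Some y) = Some \<eta>" for y \<eta>
    proof -
      define d where "d = (norm (y - a))\<^sup>2"
      have d: "d > 0" using ne by (simp add: d_def)
      \<comment> \<open>This pairing determines the squared distance plus the squared height
        exactly; dropping the height leaves the bound.\<close>
      have "lorentz_form (A *v horo_vector 0 1) (A *v horo_vector y 0) = - 2 * (1 + (norm y)\<^sup>2)"
        by (simp add: SO_Q_form[OF SO] form_horo_vector)
      then have "G * (d / \<tau> * ((norm (\<xi>0 - \<eta>))\<^sup>2 + 1 / G\<^sup>2)) = 1 + (norm y)\<^sup>2"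
        unfolding image[OF y] base lorentz_form_scaleR form_horo_vector d_def
        by (simp only: mult.left_commute[of _ "- 2"] mult_cancel_left add_0_right) (simp add: mult.left_commute)
      then have "(norm (\<xi>0 - \<eta>))\<^sup>2 + 1 / G\<^sup>2 = (1 + (norm y)\<^sup>2) * \<tau> / (G * d)"
        using d G(1) \<open>\<tau> > 0\<close> by (simp add: field_simps)
      also have "\<dots> = (1 / G)\<^sup>2 * ((1 + (norm y)\<^sup>2) * (G * \<tau>) / d)"
        using d G(1) by (simp add: power2_eq_square)
      also have "G * \<tau> = 1 + (norm a)\<^sup>2" using G(2) \<open>\<tau> > 0\<close> by simp
      finally have "(norm (\<xi>0 - \<eta>))\<^sup>2 + 1 / G\<^sup>2 = (1 / G)\<^sup>2 * ((1 + (norm y)\<^sup>2) * (1 + (norm a)\<^sup>2) / d)" .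
      moreover have "0 \<le> 1 / G\<^sup>2" by simp
      ultimately show ?thesis unfolding orbit d_def fst_conv snd_conv by linarith
    qed
  qed
qed

section \<open>Translations as Lorentz maps\<close>

text \<open>The parabolic map fixing infinity. Its coefficients come from expanding the squared norm
  of \<open>\<xi> + t\<close> in \<open>horo_vector (\<xi> + t) s\<close>, with \<open>gap v\<close>
  homogenising the result so that it is linear in \<open>v\<close>.\<close>

definition translate :: "real ^ 'm \<Rightarrow> ('m::finite) lorentz_vec \<Rightarrow> 'm lorentz_vec" where
  "translate t v = v + (let c = (\<Sum>k\<in>UNIV. v $ Some (Some k) * t $ k) + gap v * (t \<bullet> t)
     in lorentz_vector ((2 * gap v) *\<^sub>R t) c c)"

lemma translate_nth:
  "translate t v $ None = v $ None + ((\<Sum>k\<in>UNIV. v $ Some (Some k) * t $ k) + gap v * (t \<bullet> t))"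
  "translate t v $ Some None = v $ Some None + ((\<Sum>k\<in>UNIV. v $ Some (Some k) * t $ k) + gap v * (t \<bullet> t))"
  "translate t v $ Some (Some k) = v $ Some (Some k) + 2 * gap v * t $ k"
  by (simp_all add: translate_def Let_def)

lemma gap_translate: "gap (translate t v) = gap v"
  by (simp add: gap_def[of "translate t v"] translate_nth) (simp add: gap_def)

lemma linear_translate: "linear (translate t)"
proof (rule linearI)
  show "translate t (u + v) = translate t u + translate t v" for u v
    unfolding vec_eq_iff all_lorentz_index vector_add_component translate_nth
    by (simp add: gap_def algebra_simps sum.distrib add_divide_distrib diff_divide_distrib)
  show "translate t (c *\<^sub>R v) = c *\<^sub>R translate t v" for c v
    unfolding vec_eq_iff all_lorentz_index vector_scaleR_component translate_nth gap_scaleR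
    by (simp add: algebra_simps sum_distrib_left)
qed

lemma quadratic_form_translate: "quadratic_form (translate t v) = quadratic_form v"
proof -
  have "(\<Sum>k\<in>UNIV. (v $ Some (Some k) + 2 * gap v * t $ k)\<^sup>2) =
      (\<Sum>k\<in>UNIV. (v $ Some (Some k))\<^sup>2) + 4 * gap v * (\<Sum>k\<in>UNIV. v $ Some (Some k) * t $ k)
        + 4 * gap v * (gap v * (t \<bullet> t))"
    by (simp add: inner_vec_def power2_eq_square algebra_simps sum.distrib sum_distrib_left)
  then show ?thesis
    unfolding quadratic_form_coordinates gap_translate translate_nth by (simp add: algebra_simps)
qed

lemma translate_translate: "translate t (translate s v) = translate (s + t) v"
  unfolding vec_eq_iff all_lorentz_index translate_nth gap_translate
  by (simp add: inner_vec_def algebra_simps sum.distrib sum_distrib_left)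

lemma translate_zero: "translate 0 v = v"
  unfolding vec_eq_iff all_lorentz_index translate_nth by simp

lemma translate_horo_vector: "translate t (horo_vector \<xi> s) = horo_vector (\<xi> + t) s"
proof -
  have "(\<Sum>k\<in>UNIV. 2 * \<xi> $ k * t $ k) = 2 * (\<xi> \<bullet> t)"
    by (simp add: inner_vec_def sum_distrib_left algebra_simps)
  then show ?thesis
    unfolding vec_eq_iff all_lorentz_index translate_nth gap_horo_vector
    by (simp add: horo_vector_def power2_norm_eq_inner inner_add inner_commute algebra_simps)
qed

text \<open>With \<open>J\<close> the Gram matrix of the form, invariance says that the transpose of
  \<open>A\<close> times \<open>J\<close> times \<open>A\<close> is \<open>J\<close>; take
  determinants.\<close>

lemma det_form_preserving:
  fixes A :: "('m::finite) lorentz_mat"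
  assumes "\<And>x. quadratic_form (A *v x) = quadratic_form x"
  shows "(det A)\<^sup>2 = 1"
proof -
  define J :: "'m lorentz_mat" where "J = (\<chi> i j. if i = j then (if i = None then - 1 else 1) else 0)"
  have J_nth: "(J *v w) $ i = (if i = None then - 1 else 1) * w $ i" for w i
    by (simp add: J_def matrix_vector_mult_def if_distrib[of "\<lambda>x. x * _"] cong: if_cong)
  have J: "lorentz_form v w = v \<bullet> (J *v w)" for v w
    unfolding lorentz_form_def inner_vec_def sum_option J_nth by simp
  have "lorentz_form (A *v v) (A *v w) = lorentz_form v w" for v w
  proof -
    have "2 * lorentz_form (A *v v) (A *v w) = 2 * lorentz_form v w"
      unfolding lorentz_form_polarization by (simp add: assms flip: matrix_vector_right_distrib)
    then show ?thesis by simp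
  qed
  then have "v \<bullet> (transpose A *v (J *v (A *v w))) = v \<bullet> (J *v w)" for v w
    unfolding J by (metis dot_lmul_matrix transpose_matrix_vector transpose_transpose)
  then have "transpose A *v (J *v (A *v w)) = J *v w" for w
    using vector_eq_ldot by blast
  then have "transpose A ** (J ** A) = J"
    by (simp add: matrix_eq flip: matrix_vector_mul_assoc)
  then have "det A * (det J * det A) = det J"
    by (metis det_mul det_transpose)
  moreover have "det J = prod (\<lambda>i. J $ i $ i) UNIV"
    by (rule det_diagonal) (simp add: J_def)
  then have "det J \<noteq> 0" by (simp add: J_def)
  ultimately show ?thesis by (simp add: power2_eq_square)
qed

lemma matrix_translate: "matrix (translate t) *v v = translate t v"
  using matrix_vector_mul(2)[OF linear_translate] by (metis)

text \<open>Preserving the form leaves the sign of the determinant open, but a translation is the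
  square of the translation by half the vector.\<close>

lemma translate_in_SO_Q: "matrix (translate t) \<in> SO_Q"
proof -
  let ?H = "matrix (translate ((1/2) *\<^sub>R t))"
  have "(1/2) *\<^sub>R t + (1/2) *\<^sub>R t = t" by (simp flip: scaleR_left_distrib)
  then have "matrix (translate t) = ?H ** ?H"
    by (simp add: matrix_eq matrix_translate translate_translate flip: matrix_vector_mul_assoc)
  then have "det (matrix (translate t)) = (det ?H)\<^sup>2" by (simp add: det_mul power2_eq_square)
  then have "det (matrix (translate t)) = 1"
    using det_form_preserving[of ?H] by (simp add: matrix_translate quadratic_form_translate)
  then show ?thesis by (simp add: SO_Q_def matrix_translate quadratic_form_translate)
qed

lemma translate_in_component: "matrix (translate t) \<in> SO_Q_component"
proof -
  let ?m = "\<lambda>s :: real. matrix (translate (s *\<^sub>R t))"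
  \<comment> \<open>Written as a polynomial in \<open>s\<close>, the path from the identity is
    visibly continuous.\<close>
  have expand: "translate (s *\<^sub>R t) v = v
      + s *\<^sub>R (let c = (\<Sum>k\<in>UNIV. v $ Some (Some k) * t $ k) in lorentz_vector ((2 * gap v) *\<^sub>R t) c c)
      + s\<^sup>2 *\<^sub>R lorentz_vector 0 (gap v * (t \<bullet> t)) (gap v * (t \<bullet> t))" for s v
    unfolding vec_eq_iff all_lorentz_index translate_nth
    by (simp add: Let_def algebra_simps sum_distrib_left power2_eq_square)
  have "continuous_on {0..1} ?m"
    unfolding matrix_def expand
    by (intro continuous_on_vec_lambda continuous_intros)
  then have "connected (?m ` {0..1})" by (intro connected_continuous_image) auto
  moreover have "?m 0 = mat 1" by (simp add: matrix_eq matrix_translate translate_zero)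
  then have "mat 1 \<in> ?m ` {0..1}" by (metis atLeastAtMost_iff image_eqI order_refl zero_le_one)
  moreover have "?m ` {0..1} \<subseteq> SO_Q" using translate_in_SO_Q by blast
  ultimately have "?m ` {0..1} \<subseteq> SO_Q_component"
    unfolding SO_Q_component_def by (intro connected_component_maximal)
  moreover have "matrix (translate t) \<in> ?m ` {0..1}" by (intro image_eqI[of _ _ 1]) auto
  ultimately show ?thesis by blast
qed

lemma act_translate: "lorentz_boundary_act (matrix (translate t)) (Some \<xi>) = Some (\<xi> + t)"
  unfolding lorentz_boundary_act_def to_light_cone_Some matrix_translate translate_horo_vector
  by (simp only: of_to_light_cone flip: to_light_cone_Some)

lemma act_translate_infinity: "lorentz_boundary_act (matrix (translate t)) None = None"
proof -
  have "gap (lorentz_vector 0 1 1 :: 'a lorentz_vec) = 0" by (simp add: gap_def)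
  then show ?thesis
    by (simp add: lorentz_boundary_act_def matrix_translate of_light_cone_gap gap_translate)
qed

section \<open>Quadrics as linear functionals on the light cone\<close>

text \<open>Spheres and hyperplanes are the hyperplane sections of the light cone. This turns
  flatness into a condition linear in the matrix.\<close>

lemma linear_functional_horo_vector:
  "m \<bullet> horo_vector \<xi> 0 = quadric (m $ Some None + m $ None) (\<chi> k. 2 * m $ Some (Some k)) (m $ None - m $ Some None) \<xi>"
proof -
  have "(\<Sum>k\<in>UNIV. m $ Some (Some k) * (2 * \<xi> $ k)) = (\<chi> k. 2 * m $ Some (Some k)) \<bullet> \<xi>"
    by (simp add: inner_vec_def algebra_simps)
  then show ?thesis
    unfolding quadric_def inner_vec_def[of m] sum_option
    by (simp add: horo_vector_def algebra_simps)
qed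

lemma nonzero_functional:
  fixes m :: "('m::finite) lorentz_vec"
  assumes "m \<noteq> 0"
  shows "(m $ Some None + m $ None, (\<chi> k. 2 * m $ Some (Some k)) :: real ^ 'm, m $ None - m $ Some None) \<noteq> (0, 0, 0)"
  using assms by (auto simp: vec_eq_iff all_lorentz_index)

text \<open>Pulling a nonzero functional back along an invertible matrix keeps it nonzero, and two
  nonzero quadrics have a common point where neither vanishes.\<close>

lemma functionals_product_nonzero:
  fixes m :: "('m::finite) lorentz_vec"
  assumes m: "m \<noteq> 0" and A: "A \<in> SO_Q" and B: "B \<in> SO_Q"
  shows "\<exists>\<xi>. m \<bullet> (A *v horo_vector \<xi> 0) \<noteq> 0 \<and> m \<bullet> (B *v horo_vector \<xi> 0) \<noteq> 0"
proof -
  have pull: "\<exists>m'. m' \<noteq> 0 \<and> (\<forall>v. m \<bullet> (C *v v) = m' \<bullet> v)" if C: "C \<in> SO_Q" for C :: "'m lorentz_mat"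
  proof (intro exI conjI allI)
    show "m \<bullet> (C *v v) = (m v* C) \<bullet> v" for v by (simp add: dot_lmul_matrix)
    show "m v* C \<noteq> 0"
    proof
      assume "m v* C = 0"
      then have "m \<bullet> (C *v (matrix_inv C *v m)) = 0" by (simp flip: dot_lmul_matrix)
      then have "m \<bullet> m = 0"
        by (simp add: matrix_vector_mul_assoc matrix_inv_right_det[OF SO_Q_det[OF C]])
      with m show False by simp
    qed
  qed
  obtain a b where "a \<noteq> 0" "b \<noteq> 0" "\<And>v. m \<bullet> (A *v v) = a \<bullet> v" "\<And>v. m \<bullet> (B *v v) = b \<bullet> v"
    using pull[OF A] pull[OF B] by metis
  with quadric_product_nonzero[OF nonzero_functional nonzero_functional, of a b]
  show ?thesis by (simp add: linear_functional_horo_vector)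
qed

section \<open>Schottky semigroups\<close>

definition word_matrix :: "(nat \<Rightarrow> 'a::semiring_1 ^ 'n ^ 'n) \<Rightarrow> nat list \<Rightarrow> 'a ^ 'n ^ 'n" where
  "word_matrix g w = foldr (\<lambda>j A. g j ** A) w (mat 1)"

lemma word_matrix_simps [simp]:
  "word_matrix g [] = mat 1" "word_matrix g (j # w) = g j ** word_matrix g w"
  by (simp_all add: word_matrix_def)

lemma word_matrix_in_semigroup:
  "w \<noteq> [] \<Longrightarrow> set w \<subseteq> I \<Longrightarrow> word_matrix g w \<in> generated_semigroup (g ` I)"
proof (induction w)
  case (Cons j w)
  then have "g j \<in> generated_semigroup (g ` I)" by (intro generator) auto
  with Cons show ?case by (cases "w = []") (auto intro: product)
qed simp

lemma linear_imp_real_polynomial_function: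
  fixes l :: "'a::euclidean_space \<Rightarrow> real"
  shows "linear l \<Longrightarrow> real_polynomial_function l"
  by (simp add: linear_conv_bounded_linear real_polynomial_function.intros(1))

text \<open>The index of the paired ball: with \<open>n\<close> equal to \<open>N\<^sub>0\<close>,
  the matrix \<open>g j\<close> sends everything outside \<open>D (opposite n j)\<close> into
  \<open>D j\<close>, also when \<open>g j\<close> is one of the inverse generators.\<close>

definition opposite :: "nat \<Rightarrow> nat \<Rightarrow> nat" where
  "opposite n j = (if j \<le> n then j + n else j - n)"

lemma opposite_range: "j \<in> {1..2 * n} \<Longrightarrow> opposite n j \<in> {1..2 * n}"
  by (auto simp: opposite_def)

lemma opposite_iff:
  "a \<in> {1..2 * n} \<Longrightarrow> b \<in> {1..2 * n} \<Longrightarrow> \<bar>int b - int a\<bar> \<noteq> int n \<longleftrightarrow> b \<noteq> opposite n a"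
  by (auto simp: opposite_def)

context schottky_semigroup
begin

abbreviation "act \<equiv> lorentz_boundary_act"
abbreviation "M \<equiv> N\<^sub>0 + N\<^sub>1"
abbreviation "opp \<equiv> opposite N\<^sub>0"
abbreviation "R \<equiv> \<lambda>a b. \<bar>int b - int a\<bar> \<noteq> int N\<^sub>0"
abbreviation "\<Gamma> \<equiv> generated_semigroup (g ` {1..M})"
abbreviation "branch \<equiv> \<lambda>j x. the (act (g j) (Some x))"

lemma letter_range: "j \<in> {1..M} \<Longrightarrow> j \<in> {1..2 * N\<^sub>0}"
  using N\<^sub>1_le by auto

lemma R_iff: "a \<in> {1..M} \<Longrightarrow> b \<in> {1..M} \<Longrightarrow> R a b \<longleftrightarrow> b \<noteq> opp a"
  using opposite_iff letter_range by blast

lemma semigroup_subset: "\<Gamma> \<subseteq> SO_Q_component"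
  using zariski_dense unfolding zariski_dense_in_def by blast

lemma generator_SO_Q: "j \<in> {1..M} \<Longrightarrow> g j \<in> SO_Q"
  using generators_in SO_Q_component_subset by blast

lemma polynomial_vanishes:
  assumes "real_polynomial_function p" "\<And>s. s \<in> \<Gamma> \<Longrightarrow> p s = 0" "A \<in> SO_Q_component"
  shows "p A = 0"
  using zariski_dense assms unfolding zariski_dense_in_def by blast

lemma semigroup_SO_Q: "s \<in> \<Gamma> \<Longrightarrow> s \<in> SO_Q"
  using semigroup_subset SO_Q_component_subset by blast

lemma disjoint_D: "i \<in> {1..2 * N\<^sub>0} \<Longrightarrow> j \<in> {1..2 * N\<^sub>0} \<Longrightarrow> i \<noteq> j \<Longrightarrow> D i \<inter> D j = {}"
  using disjoint_balls by (auto simp: disjoint_family_on_def)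

lemma generator_cancel:
  assumes j: "j \<in> {1..M}" and opp: "opp j \<in> {1..M}"
  shows "g j ** g (opp j) = mat 1"
proof (cases "j \<le> N\<^sub>0")
  case True
  then have i: "j \<in> {1..N\<^sub>1}" "opp j = N\<^sub>0 + j" using assms by (auto simp: opposite_def)
  then show ?thesis
    using inverse_generators[OF i(1)] matrix_inv_right_det[OF SO_Q_det[OF generator_SO_Q[OF j]]] by simp
next
  case False
  then have i: "opp j \<in> {1..N\<^sub>1}" "j = N\<^sub>0 + opp j" using assms by (auto simp: opposite_def)
  show ?thesis
    using inverse_generators[OF i(1)] i(2) matrix_inv_left_det[OF SO_Q_det[OF generator_SO_Q[OF opp]]] by simp
qed

section \<open>Ping-pong and the poles of words\<close>

text \<open>For an inverse generator argue backwards: if the image missed \<open>D j\<close>, then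
  applying the original generator would put \<open>p\<close> inside the ball that it avoids.\<close>

lemma act_outside:
  assumes j: "j \<in> {1..M}" and p: "p \<notin> Some ` D (opp j)"
  shows "act (g j) p \<in> Some ` D j"
proof (cases "j \<le> N\<^sub>0")
  case True
  then have "j \<in> {1..N\<^sub>0}" "opp j = j + N\<^sub>0" using j by (auto simp: opposite_def)
  then have "act (g j) p \<in> Some ` interior (D j)"
    using ext_to_int[of j] p by (metis ComplI imageI)
  then show ?thesis using interior_subset[of "D j"] by blast
next
  case False
  define i where "i = opp j"
  have i: "i \<in> {1..N\<^sub>1}" "j = N\<^sub>0 + i" using j False by (auto simp: opposite_def i_def)
  then have i': "i \<in> {1..N\<^sub>0}" "i \<in> {1..M}" using N\<^sub>1_le by auto
  have gj: "g j = matrix_inv (g i)" using inverse_generators[OF i(1)] i(2) by simp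
  show ?thesis
  proof (rule ccontr)
    assume "act (g j) p \<notin> Some ` D j"
    then have "act (g j) p \<in> - Some ` D (i + N\<^sub>0)" using i(2) by (simp add: add.commute)
    then have "act (g i) (act (g j) p) \<in> Some ` interior (D i)"
      using ext_to_int[OF i'(1)] by blast
    moreover have "act (g i) (act (g j) p) = p"
      unfolding gj by (rule act_inv(2)[OF generator_SO_Q[OF i'(2)]])
    ultimately show False using p interior_subset[of "D i"] by (auto simp: i_def)
  qed
qed

lemma follower_opposite:
  assumes j: "j \<in> {1..M}" and x: "x \<in> followers M R D j"
  shows "x \<notin> D (opp j)"
proof -
  obtain k where k: "k \<in> {1..M}" "R j k" "x \<in> D k" using x by (rule followersE)
  then have "k \<noteq> opp j" using R_iff[OF j k(1)] by blast
  then show ?thesis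
    using disjoint_D[OF letter_range[OF k(1)] opposite_range[OF letter_range[OF j]]] k(3) by blast
qed

lemma branch_in:
  assumes "j \<in> {1..M}" and "x \<in> followers M R D j"
  shows "act (g j) (Some x) = Some (branch j x)" and "branch j x \<in> D j"
proof -
  have "act (g j) (Some x) \<in> Some ` D j"
    using follower_opposite[OF assms] by (intro act_outside[OF assms(1)]) auto
  then obtain y where "act (g j) (Some x) = Some y" "y \<in> D j" by blast
  then show "act (g j) (Some x) = Some (branch j x)" "branch j x \<in> D j" by simp_all
qed

lemma word_matrix_SO_Q: "set w \<subseteq> {1..M} \<Longrightarrow> word_matrix g w \<in> SO_Q"
  by (induction w) (simp_all add: SO_Q_one SO_Q_mult generator_SO_Q)

lemma word_matrix_branch:
  "admissible M R w \<Longrightarrow> w \<noteq> [] \<Longrightarrow> x \<in> followers M R D (last w) \<Longrightarrow>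
    act (word_matrix g w) (Some x) = Some (foldr branch w x) \<and> foldr branch w x \<in> D (hd w)"
proof (induction w)
  case (Cons j w)
  have j: "j \<in> {1..M}" and w: "admissible M R w" using Cons.prems by (simp_all add: admissible_Cons)
  show ?case
  proof (cases "w = []")
    case True
    then show ?thesis using branch_in[OF j] Cons.prems by simp
  next
    case False
    have IH: "act (word_matrix g w) (Some x) = Some (foldr branch w x)" "foldr branch w x \<in> D (hd w)"
      using Cons.IH[OF w False] Cons.prems False by auto
    have "hd w \<in> {1..M}" using hd_in_set[OF False] w unfolding admissible_def by blast
    moreover have "R j (hd w)" using Cons.prems False by (simp add: admissible_Cons)
    ultimately have "foldr branch w x \<in> followers M R D j" using IH(2) by (intro followersI)
    then show ?thesis
      using branch_in[OF j] IH(1) w act_mult[OF word_matrix_SO_Q, of w "g j" "Some x"]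
      by (simp add: admissible_def)
  qed
qed simp

text \<open>Ping-pong run backwards: to end outside \<open>D j\<close>, the letter \<open>j\<close>
  must receive a point of the opposite ball. This ball is disjoint from that of the next letter, so
  the same situation recurs up to the last letter.\<close>

lemma word_matrix_preimage:
  "admissible M R w \<Longrightarrow> w \<noteq> [] \<Longrightarrow> act (word_matrix g w) q \<notin> Some ` D (hd w) \<Longrightarrow>
    q \<in> Some ` D (opp (last w))"
proof (induction w)
  case (Cons j w)
  have j: "j \<in> {1..M}" and w: "admissible M R w" using Cons.prems by (simp_all add: admissible_Cons)
  have act: "act (word_matrix g (j # w)) q = act (g j) (act (word_matrix g w) q)"
    using w by (simp add: act_mult word_matrix_SO_Q admissible_def)
  have *: "act (word_matrix g w) q \<in> Some ` D (opp j)"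
    using act_outside[OF j] Cons.prems(3) unfolding act by auto
  show ?case
  proof (cases "w = []")
    case True
    then show ?thesis using * by (simp add: act_one)
  next
    case False
    have hd: "hd w \<in> {1..M}" using hd_in_set[OF False] w unfolding admissible_def by blast
    have "R j (hd w)" using Cons.prems False by (simp add: admissible_Cons)
    then have "hd w \<noteq> opp j" using R_iff[OF j hd] by blast
    then have "D (hd w) \<inter> D (opp j) = {}"
      by (intro disjoint_D letter_range hd opposite_range j)
    then have "act (word_matrix g w) q \<notin> Some ` D (hd w)" using * by auto
    then show ?thesis using Cons.IH[OF w False] False by simp
  qed
qed simp

text \<open>Infinity lies in no ball, so the backward ping-pong applies to its preimage.\<close>

lemma word_pole:
  assumes "admissible M R w" "w \<noteq> []"
  obtains a where "a \<in> D (opp (last w))" "act (word_matrix g w) (Some a) = None"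
proof -
  let ?q = "act (matrix_inv (word_matrix g w)) None"
  have "act (word_matrix g w) ?q = None"
    using assms by (intro act_inv(2) word_matrix_SO_Q) (simp add: admissible_def)
  moreover from this have "?q \<in> Some ` D (opp (last w))"
    using word_matrix_preimage[OF assms, of ?q] by auto
  ultimately show thesis using that by auto
qed

text \<open>Multiplication by a generator on the left either lengthens a reduced word or cancels its
  first letter. The empty word must be allowed: the identity lies in the semigroup once some
  generator has its inverse among the generators.\<close>

lemma semigroup_cases:
  assumes "s \<in> \<Gamma>"
  shows "\<exists>w. admissible M R w \<and> s = word_matrix g w"
proof -
  have step: "\<exists>w'. admissible M R w' \<and> g j ** word_matrix g w = word_matrix g w'"
    if j: "j \<in> {1..M}" and w: "admissible M R w" for j w
  proof (cases "w = [] \<or> R j (hd w)")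
    case True
    then have "admissible M R (j # w)" using j w by (auto simp: admissible_Cons)
    then show ?thesis by (intro exI[of _ "j # w"]) simp
  next
    case False
    then obtain k v where kv: "w = k # v" "\<not> R j k" by (cases w) auto
    then have k: "k \<in> {1..M}" "admissible M R v" using w by (auto simp: admissible_Cons)
    with kv(2) R_iff[OF j] have "k = opp j" by blast
    with generator_cancel[OF j] k(1) have "g j ** g k = mat 1" by blast
    then have "g j ** word_matrix g w = word_matrix g v"
      by (simp add: kv(1) matrix_mul_assoc)
    with k(2) show ?thesis by blast
  qed
  \<comment> \<open>Stated for products with any reduced word, since in the product case the right
    factor hands its reduced word on to the left one.\<close>
  have "admissible M R w \<Longrightarrow> \<exists>w'. admissible M R w' \<and> s ** word_matrix g w = word_matrix g w'" for w
    using assms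
  proof (induction arbitrary: w)
    case (generator A)
    then obtain j where "j \<in> {1..M}" "A = g j" by blast
    with step[of j w] generator.prems show ?case by simp
  next
    case (product A B)
    obtain v where v: "admissible M R v" "B ** word_matrix g w = word_matrix g v"
      using product.IH(2)[OF product.prems] by blast
    obtain u where u: "admissible M R u" "A ** word_matrix g v = word_matrix g u"
      using product.IH(1)[OF v(1)] by blast
    have "(A ** B) ** word_matrix g w = word_matrix g u"
      unfolding matrix_mul_assoc[symmetric] v(2) u(2) ..
    with u(1) show ?case by blast
  qed
  from this[of "[]"] show ?thesis by (simp add: admissible_def)
qed

lemma inversive_coding:
  "inversive_coding M R D branch (\<lambda>j. act (matrix_inv (g j))) (\<lambda>j. D (opp j))
     ((\<lambda>s. lorentz_act s base_point) ` \<Gamma>) (\<lambda>w. lorentz_act (word_matrix g w) base_point)"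
proof
  have ball: "\<exists>c r. 0 < r \<and> D j = cball c r" if "j \<in> {1..M}" for j
    using closed_balls letter_range that by blast
  show "compact (D j)" if "j \<in> {1..M}" for j using ball[OF that] by auto
  show "disjoint_family_on D {1..M}"
    using disjoint_D letter_range unfolding disjoint_family_on_def by blast
  show "\<exists>x\<in>D j. \<exists>y\<in>D j. x \<noteq> y" if j: "j \<in> {1..M}" for j
  proof -
    obtain c r where "0 < r" "D j = cball c r" using ball[OF j] by blast
    moreover obtain u :: "real ^ 'm" where "norm u = r" using vector_choose_size[of r] \<open>0 < r\<close> by auto
    ultimately show ?thesis
      by (intro bexI[of _ c] bexI[of _ "c + u"]) (auto simp: dist_norm)
  qed
  show "R j j" if "j \<in> {1..M}" for j using N\<^sub>0_pos by simp
  show "branch j x \<in> D j" if "j \<in> {1..M}" "x \<in> followers M R D j" for j x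
    using branch_in(2)[OF that] .
  show "act (matrix_inv (g j)) (Some (branch j x)) = Some x" if "j \<in> {1..M}" "x \<in> followers M R D j" for j x
    using branch_in(1)[OF that] act_inv(1)[OF generator_SO_Q[OF that(1)]] by metis
  show "compact (D (opp j))" if "j \<in> {1..M}" for j
    using closed_balls[OF opposite_range[OF letter_range[OF that]]] by auto
  show "D (opp j) \<inter> followers M R D j = {}" if "j \<in> {1..M}" for j
    using follower_opposite[OF that] by blast
  show "lorentz_act (word_matrix g w) base_point \<in> (\<lambda>s. lorentz_act s base_point) ` \<Gamma>"
    if "admissible M R w" "w \<noteq> []" for w
    using word_matrix_in_semigroup[OF that(2), of "{1..M}" g] that(1) by (auto simp: admissible_def)
  show "(\<exists>w. admissible M R w \<and> w \<noteq> [] \<and> z = lorentz_act (word_matrix g w) base_point) \<or> 1 \<le> snd z"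
    if z: "z \<in> (\<lambda>s. lorentz_act s base_point) ` \<Gamma>" for z
  proof -
    obtain w where w: "admissible M R w" "z = lorentz_act (word_matrix g w) base_point"
      using z semigroup_cases by blast
    show ?thesis
    proof (cases "w = []")
      case True
      then have "snd z = 1"
        by (simp add: w(2) lorentz_act_def of_hyperboloid_def to_hyperboloid_def base_point_def)
      then show ?thesis by simp
    qed (use w in blast)
  qed
  show "\<exists>\<kappa>>0. \<exists>a\<in>D (opp (last w)).
      (\<forall>x\<in>followers M R D (last w). \<forall>y\<in>followers M R D (last w).
        norm (foldr branch w x - foldr branch w y) = norm (x - y) / (\<kappa> * (norm (x - a) * norm (y - a)))) \<and>
      snd (lorentz_act (word_matrix g w) base_point) = 1 / (\<kappa> * (1 + (norm a)\<^sup>2)) \<and>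
      (\<forall>y\<in>followers M R D (last w). (norm (fst (lorentz_act (word_matrix g w) base_point) - foldr branch w y))\<^sup>2 \<le>
         (snd (lorentz_act (word_matrix g w) base_point))\<^sup>2 * ((1 + (norm y)\<^sup>2) * (1 + (norm a)\<^sup>2) / (norm (y - a))\<^sup>2))"
    if w: "admissible M R w" "w \<noteq> []" for w
  proof -
    have "word_matrix g w \<in> \<Gamma>"
      using word_matrix_in_semigroup[OF w(2), of "{1..M}" g] w(1) by (auto simp: admissible_def)
    then have A: "word_matrix g w \<in> SO_Q_component" using semigroup_subset by blast
    obtain a where a: "a \<in> D (opp (last w))" "act (word_matrix g w) (Some a) = None"
      using word_pole[OF w] .
    have l: "last w \<in> {1..M}" using last_in_set[OF w(2)] w(1) unfolding admissible_def by blast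
    have ne: "x \<noteq> a" if "x \<in> followers M R D (last w)" for x
      using follower_opposite[OF l that] a(1) by blast
    have img: "act (word_matrix g w) (Some x) = Some (foldr branch w x)" if "x \<in> followers M R D (last w)" for x
      using word_matrix_branch[OF w that] by blast
    show ?thesis
    proof (rule poincare_extension[OF A a(2)], goal_cases)
      case (1 \<kappa>)
      show ?case
        by (intro exI[of _ \<kappa>] conjI 1(1) bexI[OF _ a(1)] ballI 1(2)[OF ne ne img img] 1(3) 1(4)[OF ne img])
    qed
  qed
qed

sublocale coding: inversive_coding M R D branch "\<lambda>j. act (matrix_inv (g j))" "\<lambda>j. D (opp j)"
    "(\<lambda>s. lorentz_act s base_point) ` \<Gamma>" "\<lambda>w. lorentz_act (word_matrix g w) base_point"
  by (rule inversive_coding)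

section \<open>Zariski density excludes flat limit sets\<close>

text \<open>A letter may meet a limit point in its opposite ball, where its branch is undefined.
  There backward invariance writes the point as an image under the inverse generator, and the two
  cancel.\<close>

lemma limit_set_invariant:
  assumes "s \<in> \<Gamma>" "p \<in> coding.\<Lambda>"
  obtains q where "q \<in> coding.\<Lambda>" "act s (Some p) = Some q"
proof -
  have step: "\<exists>q\<in>coding.\<Lambda>. act (g j) (Some p) = Some q" if j: "j \<in> {1..M}" and p: "p \<in> coding.\<Lambda>" for j p
  proof -
    obtain k where k: "k \<in> {1..M}" "p \<in> D k" using coding.limit_set_covered[OF p] by blast
    show ?thesis
    proof (cases "k = opp j")
      case False
      then have "p \<in> followers M R D j" using R_iff[OF j k(1)] k by (intro followersI) auto
      then show ?thesis using branch_in(1)[OF j] coding.forward_invariant[OF p _ j] by blast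
    next
      case True
      obtain y where y: "y \<in> coding.\<Lambda>" "y \<in> followers M R D k" "p = branch k y"
        using coding.backward_invariant[OF p k(2,1)] .
      have "act (g j) (Some p) = act (g j ** g k) (Some y)"
        using branch_in(1)[OF k(1) y(2)] y(3) by (simp add: act_mult[OF generator_SO_Q[OF k(1)]])
      also have "\<dots> = Some y" using generator_cancel[OF j] k(1) True by (simp add: act_one)
      finally show ?thesis using y(1) by blast
    qed
  qed
  have "p \<in> coding.\<Lambda> \<Longrightarrow> \<exists>q\<in>coding.\<Lambda>. act s (Some p) = Some q" for p
    using assms(1)
  proof (induction arbitrary: p)
    case (generator A)
    then obtain j where "j \<in> {1..M}" "A = g j" by blast
    with step[of j p] generator.prems show ?case by simp
  next
    case (product A B)
    then obtain q where q: "q \<in> coding.\<Lambda>" "act B (Some p) = Some q" by blast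
    then obtain q' where "q' \<in> coding.\<Lambda>" "act A (Some q) = Some q'" using product by blast
    with q show ?case using act_mult[OF semigroup_SO_Q[OF product(2)]] by auto
  qed
  with assms(2) that show thesis by blast
qed

text \<open>Commuting with \<open>g 1\<close> is a linear condition, so density would extend it to
  the whole component. Translations fix infinity and would then fix the finite point
  \<open>g 1\<close> sends it to.\<close>

lemma not_single_pair: "\<not> (N\<^sub>0 = 1 \<and> N\<^sub>1 = 1)"
proof
  assume N: "N\<^sub>0 = 1 \<and> N\<^sub>1 = 1"
  then have one: "1 \<in> {1..M}" "opp 1 = 2" "2 \<in> {1..M}" "opp 2 = 1" by (auto simp: opposite_def)
  have commute: "s ** g 1 = g 1 ** s" if "s \<in> \<Gamma>" for s
    using that
  proof induction
    case (generator A)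
    have "{1..M} = {1, 2 :: nat}" using N by auto
    with generator have "A = g 1 \<or> A = g 2" by auto
    then show ?case using generator_cancel[of 1] generator_cancel[of 2] one by auto
  next
    case (product A B)
    have "(A ** B) ** g 1 = A ** (g 1 ** B)" unfolding matrix_mul_assoc[symmetric] product.IH(2) ..
    also have "\<dots> = g 1 ** (A ** B)" unfolding matrix_mul_assoc product.IH(1) ..
    finally show ?case .
  qed
  have "A ** g 1 = g 1 ** A" if A: "A \<in> SO_Q_component" for A
  proof -
    have "(A ** g 1 - g 1 ** A) $ i $ k = 0" for i k
    proof -
      have "linear (\<lambda>s. (s ** g 1 - g 1 ** s) $ i $ k)"
        by (rule linearI) (simp_all add: matrix_matrix_mult_def algebra_simps sum.distrib sum_distrib_left)
      then have "real_polynomial_function (\<lambda>s. (s ** g 1 - g 1 ** s) $ i $ k)"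
        by (rule linear_imp_real_polynomial_function)
      from polynomial_vanishes[OF this _ A] commute show ?thesis by simp
    qed
    then show ?thesis by (simp add: vec_eq_iff)
  qed
  then have "act (matrix (translate t)) (act (g 1) None) = act (g 1) (act (matrix (translate t)) None)" for t
    using translate_in_component translate_in_SO_Q act_mult generator_SO_Q[OF one(1)] by metis
  then have fixed: "act (matrix (translate t)) (act (g 1) None) = act (g 1) None" for t
    by (simp add: act_translate_infinity)
  obtain x where x: "act (g 1) None = Some x" using act_outside[OF one(1), of None] by auto
  obtain t :: "real ^ 'm" where "norm t = 1" using vector_choose_size[of 1] by auto
  with fixed[of t] show False unfolding x act_translate by auto
qed

text \<open>
  The points of the limit set that cannot follow \<open>l\<close> lie in the ball opposite to \<open>l\<close>; they can
  follow another letter \<open>j\<close> that in turn can follow \<open>l\<close>. For \<open>N\<^sub>0 = N\<^sub>1 = 1\<close> there is no such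
  letter, but then the semigroup is abelian and hence not Zariski dense.
\<close>

lemma bridging_letter:
  assumes l: "l \<in> {1..M}"
  obtains j where "j \<in> {1..M}" "R l j"
    "\<And>q. q \<in> coding.\<Lambda> \<Longrightarrow> q \<notin> followers M R D l \<Longrightarrow> q \<in> followers M R D j"
proof -
  have opp: "q \<in> D (opp l) \<and> opp l \<in> {1..M}" if q: "q \<in> coding.\<Lambda>" "q \<notin> followers M R D l" for q
  proof -
    obtain k where k: "k \<in> {1..M}" "q \<in> D k" using coding.limit_set_covered[OF q(1)] by blast
    have "\<not> R l k"
    proof
      assume "R l k"
      from followersI[of k M R l q D, OF k(1) this k(2)] q(2) show False by simp
    qed
    then have "k = opp l" using R_iff[OF l k(1)] by blast
    with k show ?thesis by simp
  qed
  show thesis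
  proof (cases "opp l \<in> {1..M}")
    case False
    then show thesis using opp by (intro that[OF l coding.refl_R[OF l]]) blast
  next
    case True
    have "2 \<le> N\<^sub>0"
    proof (rule ccontr)
      assume "\<not> 2 \<le> N\<^sub>0"
      then have "N\<^sub>0 = 1" "N\<^sub>1 = 0" using N\<^sub>0_pos N\<^sub>1_le not_single_pair by linarith+
      then show False using l True by (simp add: opposite_def)
    qed
    \<comment> \<open>Since \<open>N\<^sub>0\<close> is at least 2, the letters 1 and 2 are not
      opposite, so one of them lies outside the pair formed by \<open>l\<close> and its
      opposite.\<close>
    define j where "j = (if l = 1 \<or> opp l = 1 then 2 else 1 :: nat)"
    have j: "j \<in> {1..M}" "j \<noteq> l" "j \<noteq> opp l" "opp l \<noteq> opp j"
      using \<open>2 \<le> N\<^sub>0\<close> l True N\<^sub>1_le by (auto simp: j_def opposite_def split: if_splits)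
    show thesis
    proof (rule that[OF j(1)])
      show "R l j" using R_iff[OF l j(1)] j(3) by blast
      show "q \<in> followers M R D j" if "q \<in> coding.\<Lambda>" "q \<notin> followers M R D l" for q
        using opp[OF that] R_iff[OF j(1) True] j(4) by (intro followersI[OF True]) auto
    qed
  qed
qed

text \<open>The orbit of one fixed limit point \<open>p\<close> stays in the limit set. Lifted to
  the light cone, the flatness condition at \<open>s p\<close> becomes linear in \<open>s\<close>,
  since the unknown rescaling does not affect vanishing; density then replaces \<open>s\<close> by
  translations.\<close>

lemma nonflat:
  assumes w: "admissible M R w" "w \<noteq> []" and ne: "coding.\<Lambda> \<noteq> {}" and nz: "(\<alpha>, b, c) \<noteq> (0, 0, 0)"
  shows "\<exists>y\<in>coding.\<Lambda> \<inter> followers M R D (last w). quadric \<alpha> b c (foldr branch w y) \<noteq> 0"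
proof (rule ccontr)
  assume "\<not> ?thesis"
  then have flat: "quadric \<alpha> b c (foldr branch w y) = 0"
    if "y \<in> coding.\<Lambda>" "y \<in> followers M R D (last w)" for y using that by blast
  obtain p where p: "p \<in> coding.\<Lambda>" using ne by blast
  define l where "l = last w"
  have l: "l \<in> {1..M}" using coding.last_letter[of w] w by (simp add: l_def)
  obtain j where j: "j \<in> {1..M}" "R l j"
    and bridge: "\<And>q. q \<in> coding.\<Lambda> \<Longrightarrow> q \<notin> followers M R D l \<Longrightarrow> q \<in> followers M R D j"
    using bridging_letter[OF l] by metis
  let ?W = "word_matrix g w" and ?u = "horo_vector p 0"
  have W: "?W \<in> SO_Q" using w by (intro word_matrix_SO_Q) (simp add: admissible_def)
  \<comment> \<open>The coefficients invert the correspondence between linear functionals and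
    quadrics.\<close>
  define m :: "'m lorentz_vec" where "m = lorentz_vector ((1/2) *\<^sub>R b) ((\<alpha> - c) / 2) ((\<alpha> + c) / 2)"
  have m_quadric: "m \<bullet> horo_vector \<xi> 0 = quadric \<alpha> b c \<xi>" for \<xi>
  proof -
    have "(\<chi> k. 2 * m $ Some (Some k)) = b" by (simp add: m_def vec_eq_iff)
    moreover have "m $ Some None + m $ None = \<alpha>" "m $ None - m $ Some None = c"
      by (simp_all add: m_def field_simps)
    ultimately show ?thesis by (simp add: linear_functional_horo_vector)
  qed
  have "m \<noteq> 0"
  proof
    assume "m = 0"
    then have "quadric \<alpha> b c \<xi> = 0" for \<xi> using m_quadric[of \<xi>] by simp
    with quadric_zero_on_ball[of 1 0 \<alpha> b c] nz show False by auto
  qed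
  have vanish: "m \<bullet> (A *v horo_vector y 0) = 0"
    if "A \<in> SO_Q" "act A (Some y) = Some \<eta>" "quadric \<alpha> b c \<eta> = 0" for A y \<eta>
    using act_of_vector[OF that(1), of "Some y"] that(2,3) m_quadric
    by (metis inner_scaleR_right mult_zero_right to_light_cone_Some)
  have on_limit_set: "m \<bullet> (?W *v (A *v horo_vector y 0)) = 0"
    if A: "A \<in> SO_Q" and y: "act A (Some y) = Some q" "q \<in> coding.\<Lambda>" "q \<in> followers M R D l" for A y q
  proof -
    have "act (?W ** A) (Some y) = Some (foldr branch w q)"
      using y word_matrix_branch[OF w] by (simp add: act_mult[OF A] l_def)
    then show ?thesis
      using vanish[OF SO_Q_mult[OF W A]] flat[of q] y by (simp add: l_def flip: matrix_vector_mul_assoc)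
  qed
  \<comment> \<open>Which of the two factors vanishes depends on \<open>s\<close>; only the product is a polynomial that vanishes on all of \<open>\<Gamma>\<close>.\<close>
  have zero: "m \<bullet> (?W *v (s *v ?u)) * (m \<bullet> (?W *v (g j *v (s *v ?u)))) = 0" if s: "s \<in> \<Gamma>" for s
  proof -
    obtain q where q: "q \<in> coding.\<Lambda>" "act s (Some p) = Some q" using limit_set_invariant[OF s p] .
    show ?thesis
    proof (cases "q \<in> followers M R D l")
      case True
      then show ?thesis using on_limit_set[OF semigroup_SO_Q[OF s] q(2,1)] by simp
    next
      case False
      with bridge q(1) have qj: "q \<in> followers M R D j" by blast
      have "act (g j ** s) (Some p) = Some (branch j q)"
        using branch_in(1)[OF j(1) qj] q(2) by (simp add: act_mult[OF semigroup_SO_Q[OF s]])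
      moreover have "branch j q \<in> coding.\<Lambda>" using coding.forward_invariant[OF q(1) qj j(1)] .
      moreover have "branch j q \<in> followers M R D l"
        using branch_in(2)[OF j(1) qj] j by (intro followersI)
      ultimately have "m \<bullet> (?W *v ((g j ** s) *v ?u)) = 0"
        by (intro on_limit_set[OF SO_Q_mult[OF generator_SO_Q[OF j(1)] semigroup_SO_Q[OF s]]])
      then show ?thesis by (simp flip: matrix_vector_mul_assoc)
    qed
  qed
  have lin: "linear (\<lambda>s. m \<bullet> (B *v (s *v ?u)))" for B :: "'m lorentz_mat"
    by (rule linearI)
      (simp_all add: matrix_vector_mult_add_rdistrib matrix_vector_right_distrib inner_add_right
        matrix_vector_mult_scaleR scaleR_matrix_vector_assoc[symmetric])
  have "real_polynomial_function (\<lambda>s. m \<bullet> (?W *v (s *v ?u)) * (m \<bullet> (?W *v (g j *v (s *v ?u)))))"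
    using lin[of ?W] lin[of "?W ** g j"]
    by (intro real_polynomial_function.intros(4) linear_imp_real_polynomial_function)
      (simp_all flip: matrix_vector_mul_assoc)
  then have everywhere: "m \<bullet> (?W *v (s *v ?u)) * (m \<bullet> (?W *v (g j *v (s *v ?u)))) = 0" if "s \<in> SO_Q_component" for s
    using polynomial_vanishes zero that by blast
  obtain \<xi> where \<xi>: "m \<bullet> (?W *v horo_vector \<xi> 0) \<noteq> 0" "m \<bullet> ((?W ** g j) *v horo_vector \<xi> 0) \<noteq> 0"
    using functionals_product_nonzero[OF \<open>m \<noteq> 0\<close> W SO_Q_mult[OF W generator_SO_Q[OF j(1)]]] by blast
  \<comment> \<open>At this element the product takes its value at \<xi>, where neither factor
    vanishes.\<close>
  have "matrix (translate (\<xi> - p)) *v ?u = horo_vector \<xi> 0"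
    by (simp add: matrix_translate translate_horo_vector)
  with everywhere[OF translate_in_component, of "\<xi> - p"] \<xi> show False
    by (simp flip: matrix_vector_mul_assoc)
qed

lemma cylinders_nonconcentrated:
  "\<exists>\<delta>::real. 0 < \<delta> \<and> \<delta> < 1 \<and>
    (\<forall>x \<in> schottky_limit_set (N\<^sub>0 + N\<^sub>1) g. \<forall>C \<in> schottky_cylinders N\<^sub>0 N\<^sub>1 D g. x \<in> C \<longrightarrow>
      (\<forall>w. norm w = 1 \<longrightarrow>
        (\<exists>y \<in> C - ball x (diameter C / 4). \<bar>(y - x) \<bullet> w\<bar> \<ge> \<delta> * diameter C)))"
proof -
  let ?cyl = "cylinder coding.\<Lambda> D (expanding_map M D (\<lambda>j. act (matrix_inv (g j))))"
  have limit: "schottky_limit_set M g = coding.\<Lambda>"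
    by (simp add: schottky_limit_set_def)
  have "\<exists>\<delta>>0. \<delta> < 1 \<and> (\<forall>\<alpha>. admissible M R \<alpha> \<and> \<alpha> \<noteq> [] \<longrightarrow>
      (\<forall>x\<in>?cyl \<alpha>. \<forall>w. norm w = 1 \<longrightarrow>
        (\<exists>y\<in>?cyl \<alpha> - ball x (diameter (?cyl \<alpha>) / 4). \<delta> * diameter (?cyl \<alpha>) \<le> \<bar>(y - x) \<bullet> w\<bar>)))"
    by (rule coding.nonconcentration) (use nonflat in blast)
  then obtain \<delta> where \<delta>: "0 < \<delta>" "\<delta> < 1" and main: "\<And>\<alpha> x w. admissible M R \<alpha> \<and> \<alpha> \<noteq> [] \<Longrightarrow>
      x \<in> ?cyl \<alpha> \<Longrightarrow> norm w = 1 \<Longrightarrow>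
        \<exists>y\<in>?cyl \<alpha> - ball x (diameter (?cyl \<alpha>) / 4). \<delta> * diameter (?cyl \<alpha>) \<le> \<bar>(y - x) \<bullet> w\<bar>"
    by blast
  show ?thesis
  proof (intro exI[of _ \<delta>] conjI \<delta> ballI impI allI)
    fix x C and w :: "real ^ 'm"
    assume C: "C \<in> schottky_cylinders N\<^sub>0 N\<^sub>1 D g" and x: "x \<in> C" and w: "norm w = 1"
    obtain \<alpha> where \<alpha>: "\<alpha> \<noteq> []" "schottky_admissible N\<^sub>0 N\<^sub>1 \<alpha>" "C = ?cyl \<alpha>"
      using C unfolding schottky_cylinders_def limit by auto
    then have "admissible M R \<alpha> \<and> \<alpha> \<noteq> []"
      by (simp add: schottky_admissible_def admissible_def)
    from main[OF this, of x w] x w show "\<exists>y\<in>C - ball x (diameter C / 4). \<delta> * diameter C \<le> \<bar>(y - x) \<bullet> w\<bar>"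
      unfolding \<alpha>(3) by blast
  qed
qed

end

section \<open>Continued fractions semigroups\<close>

definition numer :: "complex ^ 2 ^ 2 \<Rightarrow> complex \<Rightarrow> complex" where
  "numer A z = A $ 1 $ 1 * z + A $ 1 $ 2"

definition denom :: "complex ^ 2 ^ 2 \<Rightarrow> complex \<Rightarrow> complex" where
  "denom A z = A $ 2 $ 1 * z + A $ 2 $ 2"

lemma matrix_mult_2_nth: "((A :: 'a::semiring_1 ^ 2 ^ 2) ** B) $ i $ k = A $ i $ 1 * B $ 1 $ k + A $ i $ 2 * B $ 2 $ k"
  by (simp add: matrix_matrix_mult_def sum_2)

lemma numer_mult: "numer (A ** B) z = A $ 1 $ 1 * numer B z + A $ 1 $ 2 * denom B z"
  and denom_mult: "denom (A ** B) z = A $ 2 $ 1 * numer B z + A $ 2 $ 2 * denom B z"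
  by (simp_all add: numer_def denom_def matrix_mult_2_nth algebra_simps)

lemma mat_1_nth_2: "(mat 1 :: 'a::semiring_1 ^ 2 ^ 2) $ 1 $ 1 = 1" "(mat 1 :: 'a ^ 2 ^ 2) $ 1 $ 2 = 0"
  "(mat 1 :: 'a ^ 2 ^ 2) $ 2 $ 1 = 0" "(mat 1 :: 'a ^ 2 ^ 2) $ 2 $ 2 = 1"
  by (simp_all add: mat_def)

lemma moebius_act_finite: "denom A z \<noteq> 0 \<Longrightarrow> moebius_act A (Some z) = Some (numer A z / denom A z)"
  by (simp add: numer_def denom_def)

lemma moebius_act_matrix_inv:
  assumes A: "A \<in> SL2C" and d: "denom A z \<noteq> 0"
  shows "moebius_act (matrix_inv A) (Some (numer A z / denom A z)) = Some z"
proof -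
  define B where "B = matrix_inv A"
  have "B ** A = mat 1" unfolding B_def using A by (intro matrix_inv_left_det) (simp add: SL2C_def)
  then have eq: "numer (B ** A) z = z" "denom (B ** A) z = 1"
    by (simp_all add: numer_def denom_def mat_1_nth_2)
  have "numer B (numer A z / denom A z) = z / denom A z"
    using eq(1) d unfolding numer_mult by (simp add: numer_def[of B] field_simps)
  moreover have "denom B (numer A z / denom A z) = 1 / denom A z"
    using eq(2) d unfolding denom_mult by (simp add: denom_def[of B] field_simps)
  ultimately show ?thesis
    unfolding B_def[symmetric] using d by (subst moebius_act_finite) simp_all
qed

lemma poincare_act_base_point:
  "poincare_act A base_point =
    ((A $ 1 $ 2 * cnj (A $ 2 $ 2) + A $ 1 $ 1 * cnj (A $ 2 $ 1)) /
       of_real ((cmod (A $ 2 $ 2))\<^sup>2 + (cmod (A $ 2 $ 1))\<^sup>2),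
     1 / ((cmod (A $ 2 $ 2))\<^sup>2 + (cmod (A $ 2 $ 1))\<^sup>2))"
  by (simp add: poincare_act_def base_point_def Let_def)

text \<open>With \<open>A $ 2 $ 1\<close> the lower left entry, the denominator is this entry times
  \<open>z - a\<close>; in both differences of fractions the determinant 1 cancels all but a short
  numerator.\<close>

lemma moebius_poincare_extension:
  assumes A: "A \<in> SL2C" and c: "A $ 2 $ 1 \<noteq> 0" and a: "a = - (A $ 2 $ 2 / A $ 2 $ 1)"
  defines "\<kappa> \<equiv> (cmod (A $ 2 $ 1))\<^sup>2"
  shows "0 < \<kappa>"
    and "x \<noteq> a \<Longrightarrow> y \<noteq> a \<Longrightarrow> norm (numer A x / denom A x - numer A y / denom A y) =
      norm (x - y) / (\<kappa> * (norm (x - a) * norm (y - a)))"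
    and "snd (poincare_act A base_point) = 1 / (\<kappa> * (1 + (norm a)\<^sup>2))"
    and "y \<noteq> a \<Longrightarrow> (norm (fst (poincare_act A base_point) - numer A y / denom A y))\<^sup>2 \<le>
      (snd (poincare_act A base_point))\<^sup>2 * ((1 + (norm y)\<^sup>2) * (1 + (norm a)\<^sup>2) / (norm (y - a))\<^sup>2)"
proof -
  define p q r s where "p = A $ 1 $ 1" and "q = A $ 1 $ 2" and "r = A $ 2 $ 1" and "s = A $ 2 $ 2"
  have r: "r \<noteq> 0" and det: "p * s - q * r = 1" and s: "s = - (r * a)"
    using A c a by (simp_all add: SL2C_def det_2 p_def q_def r_def s_def)
  show "0 < \<kappa>" using c by (simp add: \<kappa>_def)
  have denom: "denom A z = r * (z - a)" for z
    by (simp add: denom_def s flip: r_def s_def) (simp add: algebra_simps)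
  have numer: "numer A z = p * z + q" for z by (simp add: numer_def p_def q_def)
  show "norm (numer A x / denom A x - numer A y / denom A y) =
      norm (x - y) / (\<kappa> * (norm (x - a) * norm (y - a)))" if "x \<noteq> a" "y \<noteq> a" for x y
  proof -
    have "(p * x + q) * (r * (y - a)) - (p * y + q) * (r * (x - a)) = (p * s - q * r) * (x - y)"
      unfolding s by (simp add: algebra_simps)
    then have "numer A x / denom A x - numer A y / denom A y = (x - y) / (r * (x - a) * (r * (y - a)))"
      unfolding denom numer using that r det by (simp add: diff_frac_eq)
    then show ?thesis
      by (simp add: norm_divide norm_mult \<kappa>_def power2_eq_square mult_ac flip: r_def)
  qed
  define Q where "Q = (cmod s)\<^sup>2 + (cmod r)\<^sup>2"
  have Q: "Q = \<kappa> * (1 + (norm a)\<^sup>2)"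
    by (simp add: Q_def s \<kappa>_def norm_mult power_mult_distrib algebra_simps flip: r_def)
  have "Q > 0" unfolding Q_def using r by (simp add: add_nonneg_pos)
  have orbit: "poincare_act A base_point = ((q * cnj s + p * cnj r) / of_real Q, 1 / Q)"
    unfolding poincare_act_base_point Q_def p_def q_def r_def s_def by simp
  show "snd (poincare_act A base_point) = 1 / (\<kappa> * (1 + (norm a)\<^sup>2))"
    by (simp add: orbit Q)
  show "(norm (fst (poincare_act A base_point) - numer A y / denom A y))\<^sup>2 \<le>
      (snd (poincare_act A base_point))\<^sup>2 * ((1 + (norm y)\<^sup>2) * (1 + (norm a)\<^sup>2) / (norm (y - a))\<^sup>2)"
    if y: "y \<noteq> a" for y
  proof -
    have QC: "complex_of_real Q = s * cnj s + r * cnj r"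
      unfolding Q_def of_real_add complex_norm_square ..
    have ry: "r * (y - a) = r * y + s" by (simp add: s algebra_simps)
    have "(q * cnj s + p * cnj r) * (r * y + s) - (p * y + q) * (s * cnj s + r * cnj r) =
        (p * s - q * r) * (cnj r - y * cnj s)"
      by (simp add: algebra_simps)
    then have "(q * cnj s + p * cnj r) / of_real Q - numer A y / denom A y =
        (cnj r - y * cnj s) / (of_real Q * (r * (y - a)))"
      unfolding numer denom using y r \<open>Q > 0\<close> det
      by (simp add: diff_frac_eq) (simp add: QC ry)
    then have "norm (fst (poincare_act A base_point) - numer A y / denom A y) =
        norm (cnj r - y * cnj s) / (Q * (norm r * norm (y - a)))"
      using \<open>Q > 0\<close> by (simp add: orbit norm_divide norm_mult)
    also have "\<dots> \<le> (norm r * (1 + norm y * norm a)) / (Q * (norm r * norm (y - a)))"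
    proof (rule divide_right_mono)
      have "norm (cnj r - y * cnj s) \<le> norm r + norm y * norm s"
        using norm_triangle_ineq4[of "cnj r" "y * cnj s"] by (simp add: norm_mult)
      then show "norm (cnj r - y * cnj s) \<le> norm r * (1 + norm y * norm a)"
        by (simp add: s norm_mult algebra_simps)
    qed (use \<open>Q > 0\<close> in simp)
    also have "\<dots> = (1 / Q) * ((1 + norm y * norm a) / norm (y - a))" using r by simp
    finally have "(norm (fst (poincare_act A base_point) - numer A y / denom A y))\<^sup>2 \<le>
        ((1 / Q) * ((1 + norm y * norm a) / norm (y - a)))\<^sup>2" by (rule power_mono) simp
    also have "\<dots> = (1 / Q)\<^sup>2 * ((1 + norm y * norm a)\<^sup>2 / (norm (y - a))\<^sup>2)"
      by (simp only: power_mult_distrib power_divide)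
    also have "\<dots> \<le> (1 / Q)\<^sup>2 * ((1 + (norm y)\<^sup>2) * (1 + (norm a)\<^sup>2) / (norm (y - a))\<^sup>2)"
    proof (intro mult_left_mono divide_right_mono)
      \<comment> \<open>Cauchy-Schwarz for the vectors \<open>(1, norm y)\<close> and
        \<open>(1, norm a)\<close>.\<close>
      have "0 \<le> (norm y - norm a)\<^sup>2" by simp
      then show "(1 + norm y * norm a)\<^sup>2 \<le> (1 + (norm y)\<^sup>2) * (1 + (norm a)\<^sup>2)"
        by (simp add: power2_eq_square algebra_simps)
    qed simp_all
    finally show ?thesis by (simp add: orbit)
  qed
qed

lemma word_matrix_append: "word_matrix g (v @ w) = word_matrix g v ** word_matrix g w"
  by (induction v) (simp_all add: matrix_mul_assoc)

lemma semigroup_word: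
  assumes "s \<in> generated_semigroup (g ` I)"
  shows "\<exists>w. w \<noteq> [] \<and> set w \<subseteq> I \<and> s = word_matrix g w"
  using assms
proof induction
  case (generator A)
  then obtain j where "j \<in> I" "A = g j" by blast
  then show ?case by (intro exI[of _ "[j]"]) simp
next
  case (product A B)
  then obtain v w where "v \<noteq> []" "set v \<subseteq> I" "A = word_matrix g v" "set w \<subseteq> I" "B = word_matrix g w"
    by blast
  then show ?case by (intro exI[of _ "v @ w"]) (simp add: word_matrix_append)
qed

text \<open>
  The condition on the second row \<open>(c, d)\<close> says that the pole \<open>- d / c\<close> lies in the image of the
  unit disc in the left half plane under \<open>z \<mapsto> 1 / z\<close>; it is inherited by products with
  \<^term>\<open>cf_mat a\<close> on the right.
\<close>

definition pole_condition :: "complex ^ 2 ^ 2 \<Rightarrow> bool" where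
  "pole_condition A \<longleftrightarrow> A $ 2 $ 2 \<noteq> 0 \<and> 0 \<le> Re (A $ 2 $ 1 / A $ 2 $ 2) \<and> cmod (A $ 2 $ 1 / A $ 2 $ 2) \<le> 1"

section \<open>Location of the poles and the coding domain\<close>

text \<open>The ratio \<open>c / d\<close> of the second row is replaced by the inverse of
  \<open>u = c / d + a\<close>, and \<open>Re u\<close> is at least 1. The new pole is
  \<open>- u\<close>.\<close>

lemma pole_condition_cf_mat:
  assumes A: "pole_condition A" and a: "1 \<le> Re a"
  shows "pole_condition (A ** cf_mat a)" and "(A ** cf_mat a) $ 2 $ 1 \<noteq> 0"
    and "Re (- ((A ** cf_mat a) $ 2 $ 2 / (A ** cf_mat a) $ 2 $ 1)) \<le> - 1"
    and "cmod (- ((A ** cf_mat a) $ 2 $ 2 / (A ** cf_mat a) $ 2 $ 1)) \<le> 1 + cmod a"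
proof -
  define c d where "c = A $ 2 $ 1" and "d = A $ 2 $ 2"
  have row: "(A ** cf_mat a) $ 2 $ 1 = d" "(A ** cf_mat a) $ 2 $ 2 = c + d * a"
    by (simp_all add: matrix_mult_2_nth cf_mat_def c_def d_def)
  have d: "d \<noteq> 0" "0 \<le> Re (c / d)" "cmod (c / d) \<le> 1"
    using A by (simp_all add: pole_condition_def c_def d_def)
  have ratio: "(c + d * a) / d = c / d + a" using d(1) by (simp add: field_simps)
  define u where "u = c / d + a"
  have u: "1 \<le> Re u" using d(2) a by (simp add: u_def)
  then have "u \<noteq> 0" by auto
  have "1 \<le> cmod u" using u complex_Re_le_cmod[of u] by linarith
  have cd: "c + d * a = d * u" using d(1) by (simp add: u_def algebra_simps)
  have "d / (d * u) = inverse u" using d(1) by (simp add: divide_simps)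
  moreover have "0 \<le> Re (inverse u)" using u by simp
  moreover have "cmod (inverse u) \<le> 1" using \<open>1 \<le> cmod u\<close> by (simp add: norm_inverse inverse_le_1_iff)
  ultimately show "pole_condition (A ** cf_mat a)"
    unfolding pole_condition_def row cd using d(1) \<open>u \<noteq> 0\<close> by simp
  show "(A ** cf_mat a) $ 2 $ 1 \<noteq> 0" using d(1) row by simp
  show "Re (- ((A ** cf_mat a) $ 2 $ 2 / (A ** cf_mat a) $ 2 $ 1)) \<le> - 1"
    unfolding row ratio using u by (simp add: u_def)
  show "cmod (- ((A ** cf_mat a) $ 2 $ 2 / (A ** cf_mat a) $ 2 $ 1)) \<le> 1 + cmod a"
    unfolding row ratio norm_minus_cancel using d(3) norm_triangle_ineq[of "c / d" a] by linarith
qed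

context continued_fractions_semigroup
begin

abbreviation "gen \<equiv> cf_generator e"
abbreviation "\<Gamma> \<equiv> generated_semigroup (gen ` {1..N})"
abbreviation "\<Delta> \<equiv> cf_domain \<epsilon>"
abbreviation "branch \<equiv> \<lambda>j z. numer (gen j) z / denom (gen j) z"
abbreviation "R \<equiv> \<lambda>(_::nat) (_::nat). True"

lemma letter_Re: "a \<in> A \<Longrightarrow> 1 \<le> Re a"
  using alphabet by fastforce

lemma letters_in: "j \<in> {1..N} \<Longrightarrow> fst (e j) \<in> A \<and> snd (e j) \<in> A"
  using bij_betwE[OF relabelling] by (metis SigmaE fst_conv snd_conv)

lemma dom_Re: "z \<in> \<Delta> \<Longrightarrow> 0 < Re z"
  using \<epsilon>_range by (auto simp: cf_domain_def)

lemma compact_dom: "compact \<Delta>"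
proof -
  have "\<Delta> = {z. \<epsilon> \<le> Re z} \<inter> cball (of_real (1 / (2 + \<epsilon>))) (1 / (2 + \<epsilon>))"
    by (auto simp: cf_domain_def dist_norm norm_minus_commute)
  moreover have "compact ({z. \<epsilon> \<le> Re z} \<inter> cball (of_real (1 / (2 + \<epsilon>))) (1 / (2 + \<epsilon>)))"
    by (intro closed_Int_compact closed_halfspace_Re_ge compact_cball)
  ultimately show ?thesis by simp
qed

lemma cf_mat_dom:
  assumes a: "a \<in> A" and z: "z \<in> \<Delta>"
  shows "z + a \<noteq> 0" and "Some (inverse (z + a)) \<in> moebius_act (cf_mat a) ` Some ` \<Delta>"
    and "inverse (z + a) \<in> \<Delta>"
proof -
  have "0 < Re (z + a)" using letter_Re[OF a] dom_Re[OF z] by simp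
  then show nz: "z + a \<noteq> 0" by (metis less_irrefl zero_complex.simps(1))
  have "moebius_act (cf_mat a) (Some z) = Some (inverse (z + a))"
    using nz by (simp add: cf_mat_def divide_inverse)
  then show im: "Some (inverse (z + a)) \<in> moebius_act (cf_mat a) ` Some ` \<Delta>"
    using z by (metis imageI)
  show "inverse (z + a) \<in> \<Delta>"
    using im images_in_interior[OF a] interior_subset[of \<Delta>] by auto
qed

lemma gen_nth: "gen j $ 1 $ 1 = 1" "gen j $ 1 $ 2 = snd (e j)" "gen j $ 2 $ 1 = fst (e j)"
  "gen j $ 2 $ 2 = 1 + fst (e j) * snd (e j)"
  by (simp_all add: cf_generator_def matrix_mult_2_nth cf_mat_def)

lemma gen_SL2C: "gen j \<in> SL2C"
  by (simp add: SL2C_def det_2 gen_nth)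

lemma branch_dom:
  assumes j: "j \<in> {1..N}" and z: "z \<in> \<Delta>"
  shows "denom (gen j) z \<noteq> 0" and "branch j z = inverse (inverse (z + snd (e j)) + fst (e j))"
    and "branch j z \<in> \<Delta>"
proof -
  have A: "fst (e j) \<in> A" "snd (e j) \<in> A" using letters_in[OF j] by auto
  note 1 = cf_mat_dom[OF A(2) z]
  note 2 = cf_mat_dom[OF A(1) 1(3)]
  have n: "numer (gen j) z = z + snd (e j)" by (simp add: numer_def gen_nth)
  have d: "denom (gen j) z = (z + snd (e j)) * (inverse (z + snd (e j)) + fst (e j))"
    unfolding distrib_left right_inverse[OF 1(1)] by (simp add: denom_def gen_nth algebra_simps)
  show "denom (gen j) z \<noteq> 0" unfolding d using 1(1) 2(1) by simp
  show eq: "branch j z = inverse (inverse (z + snd (e j)) + fst (e j))"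
    unfolding n d using 1(1) by (simp add: divide_inverse)
  show "branch j z \<in> \<Delta>" unfolding eq by (rule 2(3))
qed

lemma cf_piece_eq:
  assumes j: "j \<in> {1..N}"
  shows "cf_piece \<epsilon> e j = branch j ` \<Delta>"
proof -
  have "moebius_act (gen j) ` Some ` \<Delta> = Some ` branch j ` \<Delta>"
    unfolding image_image by (intro image_cong refl moebius_act_finite branch_dom(1)[OF j])
  then show ?thesis
    unfolding cf_piece_def by (simp only: inj_image_mem_iff[OF inj_Some] Collect_mem_eq)
qed

lemma cf_piece_subset:
  assumes j: "j \<in> {1..N}"
  shows "cf_piece \<epsilon> e j \<subseteq> \<Delta>"
  unfolding cf_piece_eq[OF j] by (rule image_subsetI) (rule branch_dom(3)[OF j])

lemma followers_subset: "followers N R (cf_piece \<epsilon> e) j \<subseteq> \<Delta>"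
  unfolding followers_def by (intro UN_least cf_piece_subset) simp

lemma branch_inverse:
  assumes "j \<in> {1..N}" "z \<in> \<Delta>"
  shows "moebius_act (matrix_inv (gen j)) (Some (branch j z)) = Some z"
  by (rule moebius_act_matrix_inv[OF gen_SL2C branch_dom(1)[OF assms]])

text \<open>A common point determines the outer letter, because the images under the single matrices
  are disjoint, and then the inner point by injectivity; the same argument once more gives the inner
  letter.\<close>

lemma pieces_disjoint: "disjoint_family_on (cf_piece \<epsilon> e) {1..N}"
  unfolding disjoint_family_on_def
proof (intro ballI impI equals0I)
  fix i j x assume i: "i \<in> {1..N}" and j: "j \<in> {1..N}" and ne: "i \<noteq> j"
    and x: "x \<in> cf_piece \<epsilon> e i \<inter> cf_piece \<epsilon> e j"
  obtain z z' where z: "z \<in> \<Delta>" "x = branch i z" and z': "z' \<in> \<Delta>" "x = branch j z'"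
    using x cf_piece_eq[OF i] cf_piece_eq[OF j] by blast
  have same: "a = b \<and> u = v" if "a \<in> A" "b \<in> A" "u \<in> \<Delta>" "v \<in> \<Delta>" "inverse (u + a) = inverse (v + b)" for a b u v
  proof -
    have "Some (inverse (u + a)) \<in> moebius_act (cf_mat a) ` Some ` \<Delta> \<inter> moebius_act (cf_mat b) ` Some ` \<Delta>"
      using cf_mat_dom(2)[OF that(1,3)] cf_mat_dom(2)[OF that(2,4)] that(5) by simp
    then have "a = b"
      using disjoint_images that(1,2) unfolding disjoint_family_on_def by blast
    with that(5) show ?thesis by simp
  qed
  have A: "fst (e i) \<in> A" "snd (e i) \<in> A" "fst (e j) \<in> A" "snd (e j) \<in> A"
    using letters_in[OF i] letters_in[OF j] by auto
  have "inverse (inverse (z + snd (e i)) + fst (e i)) = inverse (inverse (z' + snd (e j)) + fst (e j))"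
    using z z' branch_dom(2)[OF i z(1)] branch_dom(2)[OF j z'(1)] by simp
  from same[OF A(1,3) cf_mat_dom(3)[OF A(2) z(1)] cf_mat_dom(3)[OF A(4) z'(1)] this]
  have "fst (e i) = fst (e j)" "inverse (z + snd (e i)) = inverse (z' + snd (e j))" by auto
  moreover from same[OF A(2,4) z(1) z'(1) this(2)] have "snd (e i) = snd (e j)" by simp
  ultimately have "e i = e j" by (simp add: prod_eq_iff)
  with ne show False using relabelling i j unfolding bij_betw_def by (meson inj_onD)
qed

lemma dom_two_points: "\<exists>x\<in>\<Delta>. \<exists>y\<in>\<Delta>. x \<noteq> y"
proof -
  define c where "c = 1 / (2 + \<epsilon>)"
  \<comment> \<open>The bound \<open>sqrt 3 - 1\<close> says exactly that the rightmost point
    \<open>2 / (2 + \<epsilon>)\<close> of the disc lies beyond the line with real part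
    \<epsilon>.\<close>
  have "(\<epsilon> + 1)\<^sup>2 < (sqrt 3)\<^sup>2" using \<epsilon>_range by (intro power_strict_mono) auto
  then have "\<epsilon> * (2 + \<epsilon>) < 2" by (simp add: power2_eq_square algebra_simps)
  then have c: "\<epsilon> < 2 * c" "0 < c" using \<epsilon>_range by (simp_all add: c_def pos_less_divide_eq)
  have real_point: "complex_of_real t \<in> \<Delta>" if "\<epsilon> \<le> t" "t \<le> 2 * c" for t
  proof -
    have "cmod (of_real t - of_real c) = \<bar>t - c\<bar>" by (metis norm_of_real of_real_diff)
    then show ?thesis using that \<epsilon>_range unfolding cf_domain_def c_def[symmetric] by simp
  qed
  show ?thesis
    using real_point[of \<epsilon>] real_point[of "2 * c"] c by (metis less_irrefl less_imp_le of_real_eq_iff order_refl)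
qed

lemma word_SL2C: "word_matrix gen w \<in> SL2C"
  by (induction w) (use gen_SL2C in \<open>simp_all add: SL2C_def det_mul\<close>)

lemma word_branch:
  "set w \<subseteq> {1..N} \<Longrightarrow> z \<in> \<Delta> \<Longrightarrow> denom (word_matrix gen w) z \<noteq> 0 \<and>
    foldr branch w z = numer (word_matrix gen w) z / denom (word_matrix gen w) z \<and> foldr branch w z \<in> \<Delta>"
proof (induction w)
  case Nil
  then show ?case by (simp add: numer_def denom_def mat_1_nth_2)
next
  case (Cons j w)
  let ?W = "word_matrix gen w"
  have IH: "denom ?W z \<noteq> 0" "foldr branch w z = numer ?W z / denom ?W z" "foldr branch w z \<in> \<Delta>"
    and j: "j \<in> {1..N}" using Cons by auto
  have scale: "numer (gen j ** ?W) z = denom ?W z * numer (gen j) (foldr branch w z)"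
      "denom (gen j ** ?W) z = denom ?W z * denom (gen j) (foldr branch w z)"
    unfolding numer_mult denom_mult IH(2) using IH(1)
    by (simp_all add: numer_def[of "gen j"] denom_def[of "gen j"] field_simps)
  show ?case
    using branch_dom[OF j IH(3)] IH(1) by (simp add: scale)
qed

definition "letter_bound = Max (insert 0 (cmod ` A))"

lemma letter_bound: "a \<in> A \<Longrightarrow> cmod a \<le> letter_bound"
  unfolding letter_bound_def using finite_alphabet by (intro Max_ge) auto

text \<open>Poles have the form \<open>- (c / d + a)\<close> with \<open>c / d\<close> in the right
  half of the unit disc and \<open>a\<close> in the alphabet. One compact set thus serves all words,
  and it is separated from the domain by the imaginary axis.\<close>

definition "poles = {u. Re u \<le> - 1} \<inter> cball 0 (1 + letter_bound)"

text \<open>The condition concerns the second row, on which right multiplication acts; hence the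
  induction from the end of the word.\<close>

lemma pole_condition_word: "set w \<subseteq> {1..N} \<Longrightarrow> pole_condition (word_matrix gen w)"
proof (induction w rule: rev_induct)
  case Nil
  then show ?case by (simp add: pole_condition_def mat_1_nth_2)
next
  case (snoc j w)
  have "word_matrix gen (w @ [j]) = (word_matrix gen w ** cf_mat (fst (e j))) ** cf_mat (snd (e j))"
    by (simp add: word_matrix_append cf_generator_def matrix_mul_assoc)
  then show ?case using snoc letters_in[of j] letter_Re pole_condition_cf_mat(1) by simp
qed

lemma word_pole:
  assumes w: "set w \<subseteq> {1..N}" "w \<noteq> []"
  defines "W \<equiv> word_matrix gen w"
  shows "W $ 2 $ 1 \<noteq> 0" "- (W $ 2 $ 2 / W $ 2 $ 1) \<in> poles"
proof -
  obtain v j where v: "w = v @ [j]" using w(2) by (metis rev_exhaust)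
  \<comment> \<open>The pole is read off from the very last \<open>cf_mat\<close> factor, so the
    other half of the last generator is absorbed into \<open>B\<close>.\<close>
  define B where "B = word_matrix gen v ** cf_mat (fst (e j))"
  have j: "j \<in> {1..N}" using w(1) v by simp
  have W: "W = B ** cf_mat (snd (e j))"
    by (simp add: W_def B_def v word_matrix_append cf_generator_def matrix_mul_assoc)
  have A: "fst (e j) \<in> A" "snd (e j) \<in> A" using letters_in[OF j] by auto
  have "pole_condition B"
    unfolding B_def using w(1) v by (intro pole_condition_cf_mat(1) pole_condition_word letter_Re A) auto
  note 1 = pole_condition_cf_mat[OF this letter_Re[OF A(2)], folded W]
  show "W $ 2 $ 1 \<noteq> 0" by (rule 1(2))
  show "- (W $ 2 $ 2 / W $ 2 $ 1) \<in> poles"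
    using 1(3,4) letter_bound[OF A(2)] by (auto simp: poles_def)
qed

lemma poles_disjoint_dom: "a \<in> poles \<Longrightarrow> z \<in> \<Delta> \<Longrightarrow> z \<noteq> a"
  using dom_Re[of z] by (auto simp: poles_def)

lemma admissible_iff: "admissible N R w \<longleftrightarrow> set w \<subseteq> {1..N}"
  by (induction w) (simp_all add: admissible_Cons, simp add: admissible_def)

lemma semigroup_eq_words: "\<Gamma> = word_matrix gen ` {w. w \<noteq> [] \<and> set w \<subseteq> {1..N}}"
  using semigroup_word[of _ gen "{1..N}"] word_matrix_in_semigroup[of _ "{1..N}" gen] by blast

lemma inversive_coding:
  "inversive_coding N R (cf_piece \<epsilon> e) branch (\<lambda>j. moebius_act (matrix_inv (gen j))) (\<lambda>_. poles)
     ((\<lambda>s. poincare_act s base_point) ` \<Gamma>) (\<lambda>w. poincare_act (word_matrix gen w) base_point)"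
proof
  show "compact (cf_piece \<epsilon> e j)" if "j \<in> {1..N}" for j
    unfolding cf_piece_eq[OF that]
  proof (rule compact_continuous_image[OF _ compact_dom])
    show "continuous_on \<Delta> (branch j)"
      using branch_dom(1)[OF that] unfolding numer_def denom_def by (intro continuous_intros) auto
  qed
  show "disjoint_family_on (cf_piece \<epsilon> e) {1..N}" by (rule pieces_disjoint)
  show "\<exists>x\<in>cf_piece \<epsilon> e j. \<exists>y\<in>cf_piece \<epsilon> e j. x \<noteq> y" if j: "j \<in> {1..N}" for j
  proof -
    obtain x y where xy: "x \<in> \<Delta>" "y \<in> \<Delta>" "x \<noteq> y" using dom_two_points by blast
    then have "branch j x \<noteq> branch j y"
      using branch_inverse[OF j xy(1)] branch_inverse[OF j xy(2)] by (metis option.inject)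
    then show ?thesis using xy cf_piece_eq[OF j] by blast
  qed
  show "branch j x \<in> cf_piece \<epsilon> e j" if "j \<in> {1..N}" "x \<in> followers N R (cf_piece \<epsilon> e) j" for j x
    using that(2) followers_subset cf_piece_eq[OF that(1)] by blast
  show "moebius_act (matrix_inv (gen j)) (Some (branch j x)) = Some x"
    if "j \<in> {1..N}" "x \<in> followers N R (cf_piece \<epsilon> e) j" for j x
    by (rule branch_inverse[OF that(1)]) (use that(2) followers_subset in blast)
  show "compact poles" if "j \<in> {1..N}" for j :: nat
    unfolding poles_def by (intro closed_Int_compact closed_halfspace_Re_le compact_cball)
  show "poles \<inter> followers N R (cf_piece \<epsilon> e) j = {}" if "j \<in> {1..N}" for j
    using poles_disjoint_dom followers_subset by blast
  show "poincare_act (word_matrix gen w) base_point \<in> (\<lambda>s. poincare_act s base_point) ` \<Gamma>"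
    if "admissible N R w" "w \<noteq> []" for w
    unfolding semigroup_eq_words using that admissible_iff by blast
  show "(\<exists>w. admissible N R w \<and> w \<noteq> [] \<and> z = poincare_act (word_matrix gen w) base_point) \<or> 1 \<le> snd z"
    if "z \<in> (\<lambda>s. poincare_act s base_point) ` \<Gamma>" for z
    using that unfolding semigroup_eq_words admissible_iff by blast
  show "\<exists>\<kappa>>0. \<exists>a\<in>poles.
      (\<forall>x\<in>followers N R (cf_piece \<epsilon> e) (last w). \<forall>y\<in>followers N R (cf_piece \<epsilon> e) (last w).
        norm (foldr branch w x - foldr branch w y) = norm (x - y) / (\<kappa> * (norm (x - a) * norm (y - a)))) \<and>
      snd (poincare_act (word_matrix gen w) base_point) = 1 / (\<kappa> * (1 + (norm a)\<^sup>2)) \<and>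
      (\<forall>y\<in>followers N R (cf_piece \<epsilon> e) (last w).
        (norm (fst (poincare_act (word_matrix gen w) base_point) - foldr branch w y))\<^sup>2 \<le>
         (snd (poincare_act (word_matrix gen w) base_point))\<^sup>2 * ((1 + (norm y)\<^sup>2) * (1 + (norm a)\<^sup>2) / (norm (y - a))\<^sup>2))"
    if adm: "admissible N R w" "w \<noteq> []" for w
  proof -
    have w: "set w \<subseteq> {1..N}" using adm(1) admissible_iff by blast
    define W where "W = word_matrix gen w"
    define a where "a = - (W $ 2 $ 2 / W $ 2 $ 1)"
    have pole: "W $ 2 $ 1 \<noteq> 0" "a \<in> poles" using word_pole[OF w adm(2)] by (simp_all add: W_def a_def)
    note ext = moebius_poincare_extension[OF word_SL2C[of w, folded W_def] pole(1) a_def]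
    have z: "z \<noteq> a" "foldr branch w z = numer W z / denom W z"
      if "z \<in> followers N R (cf_piece \<epsilon> e) (last w)" for z
      using that followers_subset poles_disjoint_dom[OF pole(2)] word_branch[OF w] unfolding W_def by blast+
    have dist: "norm (foldr branch w x - foldr branch w y) =
          norm (x - y) / ((cmod (W $ 2 $ 1))\<^sup>2 * (norm (x - a) * norm (y - a)))"
      if x: "x \<in> followers N R (cf_piece \<epsilon> e) (last w)" and y: "y \<in> followers N R (cf_piece \<epsilon> e) (last w)" for x y
      unfolding z(2)[OF x] z(2)[OF y] by (rule ext(2)[OF z(1)[OF x] z(1)[OF y]])
    have near: "(norm (fst (poincare_act W base_point) - foldr branch w y))\<^sup>2 \<le>
         (snd (poincare_act W base_point))\<^sup>2 * ((1 + (norm y)\<^sup>2) * (1 + (norm a)\<^sup>2) / (norm (y - a))\<^sup>2)"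
      if y: "y \<in> followers N R (cf_piece \<epsilon> e) (last w)" for y
      unfolding z(2)[OF y] by (rule ext(4)[OF z(1)[OF y]])
    show ?thesis
      unfolding W_def[symmetric]
      by (intro exI[of _ "(cmod (W $ 2 $ 1))\<^sup>2"] conjI ext(1) ext(3) bexI[OF _ pole(2)] ballI dist near)
  qed
qed simp_all

sublocale coding: inversive_coding N R "cf_piece \<epsilon> e" branch "\<lambda>j. moebius_act (matrix_inv (gen j))" "\<lambda>_. poles"
    "(\<lambda>s. poincare_act s base_point) ` \<Gamma>" "\<lambda>w. poincare_act (word_matrix gen w) base_point"
  by (rule inversive_coding)

text \<open>Every letter may follow every other, so the whole limit set can be fed into
  \<open>w\<close> and a single homogenised quadric suffices. Vanishing on the orbit of one point
  extends to the group, which moves that point anywhere.\<close>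

lemma nonflat:
  assumes w: "admissible N R w" "w \<noteq> []" and ne: "coding.\<Lambda> \<noteq> {}" and nz: "(\<alpha>, b, c) \<noteq> (0, 0, 0)"
  shows "\<exists>y\<in>coding.\<Lambda> \<inter> followers N R (cf_piece \<epsilon> e) (last w). quadric \<alpha> b c (foldr branch w y) \<noteq> 0"
proof (rule ccontr)
  assume "\<not> ?thesis"
  then have flat: "quadric \<alpha> b c (foldr branch w y) = 0"
    if "y \<in> coding.\<Lambda>" "y \<in> followers N R (cf_piece \<epsilon> e) (last w)" for y using that by blast
  have all: "y \<in> followers N R (cf_piece \<epsilon> e) j" if "y \<in> coding.\<Lambda>" for y j
    using coding.limit_set_covered[OF that] by (auto intro: followersI)
  obtain p where p: "p \<in> coding.\<Lambda>" using ne by blast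
  have "p \<in> \<Delta>" using all[OF p] followers_subset by blast
  define W where "W = word_matrix gen w"
  have "W \<in> SL2C" unfolding W_def by (rule word_SL2C)
  \<comment> \<open>The homogenised quadric, multiplied out into real and imaginary parts so that it is visibly a polynomial.\<close>
  define H where "H x y = \<alpha> * (Re x * Re x + Im x * Im x) + Re b * (Re x * Re y + Im x * Im y)
      + Im b * (Im x * Re y + (- 1) * (Re x * Im y)) + c * (Re y * Re y + Im y * Im y)" for x y
  have H: "H x y = (cmod y)\<^sup>2 * quadric \<alpha> b c (x / y)" if "y \<noteq> 0" for x y
  proof -
    have "x / y = x * cnj y / (cmod y)\<^sup>2" by (rule complex_div_cnj)
    then have "(cmod y)\<^sup>2 * (b \<bullet> (x / y)) = b \<bullet> (x * cnj y)"
      using that by (simp add: inner_complex_def Re_divide_of_real Im_divide_of_real flip: of_real_power) (simp add: field_simps)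
    moreover have "(cmod y)\<^sup>2 * (cmod (x / y))\<^sup>2 = (cmod x)\<^sup>2" using that by (simp add: norm_divide power_divide)
    ultimately have "(cmod y)\<^sup>2 * quadric \<alpha> b c (x / y) = \<alpha> * (cmod x)\<^sup>2 + b \<bullet> (x * cnj y) + c * (cmod y)\<^sup>2"
      by (simp add: quadric_def algebra_simps)
    then show ?thesis
      unfolding H_def cmod_power2 inner_complex_def by (simp add: power2_eq_square algebra_simps)
  qed
  have zero: "H (numer (W ** s) p) (denom (W ** s) p) = 0" if s: "s \<in> \<Gamma>" for s
  proof -
    obtain v where v: "v \<noteq> []" "set v \<subseteq> {1..N}" "s = word_matrix gen v"
      using s unfolding semigroup_eq_words by blast
    have adm: "admissible N R v" using v(2) admissible_iff by blast
    have "foldr branch v p \<in> coding.\<Lambda>"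
      using coding.word_limit[OF _ p all[OF p]] adm v(1) by blast
    then have "quadric \<alpha> b c (foldr branch w (foldr branch v p)) = 0"
      using flat all by blast
    moreover have wv: "set (w @ v) \<subseteq> {1..N}" using w v admissible_iff by simp
    moreover have "W ** s = word_matrix gen (w @ v)" by (simp add: W_def v(3) word_matrix_append)
    ultimately show ?thesis
      using word_branch[OF wv \<open>p \<in> \<Delta>\<close>] H by simp
  qed
  have lin: "linear (\<lambda>s. Re (numer (W ** s) p))" "linear (\<lambda>s. Im (numer (W ** s) p))"
    "linear (\<lambda>s. Re (denom (W ** s) p))" "linear (\<lambda>s. Im (denom (W ** s) p))"
    by (rule linearI; simp add: numer_def denom_def matrix_mult_2_nth algebra_simps)+
  have "real_polynomial_function (\<lambda>s. H (numer (W ** s) p) (denom (W ** s) p))"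
    unfolding H_def
    by (intro real_polynomial_function.intros(2-4) linear_imp_real_polynomial_function lin)
  then have everywhere: "H (numer (W ** s) p) (denom (W ** s) p) = 0" if "s \<in> SL2C" for s
    using zariski_dense zero that unfolding zariski_dense_in_def by blast
  have "quadric \<alpha> b c z = 0" for z
  proof -
    \<comment> \<open>The translation taking \<open>p\<close> to \<open>z\<close>; the group element
      used is \<open>matrix_inv W ** T\<close>, which also undoes the word \<open>w\<close>.\<close>
    define T :: "complex ^ 2 ^ 2" where "T = vector [vector [1, z - p], vector [0, 1]]"
    have "W ** matrix_inv W = mat 1"
      using \<open>W \<in> SL2C\<close> by (intro matrix_inv_right_det) (simp add: SL2C_def)
    then have "det W * det (matrix_inv W) = 1" and WT: "W ** (matrix_inv W ** T) = T"
      by (simp_all add: matrix_mul_assoc flip: det_mul)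
    moreover have "det T = 1" by (simp add: T_def det_2)
    ultimately have "matrix_inv W ** T \<in> SL2C"
      using \<open>W \<in> SL2C\<close> unfolding SL2C_def mem_Collect_eq det_mul by simp
    from everywhere[OF this] have "H (numer T p) (denom T p) = 0" unfolding WT .
    moreover have "numer T p = z" "denom T p = 1" by (simp_all add: numer_def denom_def T_def)
    ultimately show ?thesis using H[of 1 z] by simp
  qed
  with quadric_zero_on_ball[of 1 0 \<alpha> b c] nz show False by auto
qed

lemma cylinders_nonconcentrated:
  "\<exists>\<delta>::real. 0 < \<delta> \<and> \<delta> < 1 \<and>
    (\<forall>x \<in> cf_limit_set N e. \<forall>C \<in> cf_cylinders \<epsilon> N e. x \<in> C \<longrightarrow>
      (\<forall>w. norm w = 1 \<longrightarrow>
        (\<exists>y \<in> C - ball x (diameter C / 4). \<bar>(y - x) \<bullet> w\<bar> \<ge> \<delta> * diameter C)))"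
proof -
  let ?cyl = "cylinder coding.\<Lambda> (cf_piece \<epsilon> e) (expanding_map N (cf_piece \<epsilon> e) (\<lambda>j. moebius_act (matrix_inv (gen j))))"
  have limit: "cf_limit_set N e = coding.\<Lambda>"
    by (simp add: cf_limit_set_def)
  have "\<exists>\<delta>>0. \<delta> < 1 \<and> (\<forall>\<alpha>. admissible N R \<alpha> \<and> \<alpha> \<noteq> [] \<longrightarrow>
      (\<forall>x\<in>?cyl \<alpha>. \<forall>w. norm w = 1 \<longrightarrow>
        (\<exists>y\<in>?cyl \<alpha> - ball x (diameter (?cyl \<alpha>) / 4). \<delta> * diameter (?cyl \<alpha>) \<le> \<bar>(y - x) \<bullet> w\<bar>)))"
    by (rule coding.nonconcentration) (use nonflat in blast)
  then obtain \<delta> where \<delta>: "0 < \<delta>" "\<delta> < 1" and main: "\<And>\<alpha> x w. admissible N R \<alpha> \<and> \<alpha> \<noteq> [] \<Longrightarrow>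
      x \<in> ?cyl \<alpha> \<Longrightarrow> norm w = 1 \<Longrightarrow>
        \<exists>y\<in>?cyl \<alpha> - ball x (diameter (?cyl \<alpha>) / 4). \<delta> * diameter (?cyl \<alpha>) \<le> \<bar>(y - x) \<bullet> w\<bar>"
    by blast
  show ?thesis
  proof (intro exI[of _ \<delta>] conjI \<delta> ballI impI allI)
    fix x C and w :: complex
    assume C: "C \<in> cf_cylinders \<epsilon> N e" and x: "x \<in> C" and w: "norm w = 1"
    obtain \<alpha> where \<alpha>: "\<alpha> \<noteq> []" "set \<alpha> \<subseteq> {1..N}" "C = ?cyl \<alpha>"
      using C unfolding cf_cylinders_def limit by auto
    then have "admissible N R \<alpha> \<and> \<alpha> \<noteq> []" by (simp add: admissible_iff)
    from main[OF this, of x w] x w show "\<exists>y\<in>C - ball x (diameter C / 4). \<delta> * diameter C \<le> \<bar>(y - x) \<bullet> w\<bar>"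
      unfolding \<alpha>(3) by blast
  qed
qed

end

theorem proposition11p8:
  shows "(\<forall>N\<^sub>0 N\<^sub>1 (D :: nat \<Rightarrow> (real ^ 'm::finite) set) g.
      schottky_semigroup N\<^sub>0 N\<^sub>1 D g \<longrightarrow>
      (\<exists>\<delta>::real. 0 < \<delta> \<and> \<delta> < 1 \<and>
        (\<forall>x \<in> schottky_limit_set (N\<^sub>0 + N\<^sub>1) g. \<forall>C \<in> schottky_cylinders N\<^sub>0 N\<^sub>1 D g. x \<in> C \<longrightarrow>
          (\<forall>w. norm w = 1 \<longrightarrow>
            (\<exists>y \<in> C - ball x (diameter C / 4). \<bar>(y - x) \<bullet> w\<bar> \<ge> \<delta> * diameter C)))))
    \<and>
    (\<forall>A \<epsilon> N e. continued_fractions_semigroup A \<epsilon> N e \<longrightarrow>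
      (\<exists>\<delta>::real. 0 < \<delta> \<and> \<delta> < 1 \<and>
        (\<forall>x \<in> cf_limit_set N e. \<forall>C \<in> cf_cylinders \<epsilon> N e. x \<in> C \<longrightarrow>
          (\<forall>w. norm w = 1 \<longrightarrow>
            (\<exists>y \<in> C - ball x (diameter C / 4). \<bar>(y - x) \<bullet> w\<bar> \<ge> \<delta> * diameter C)))))"
  by (intro conjI allI impI schottky_semigroup.cylinders_nonconcentrated
      continued_fractions_semigroup.cylinders_nonconcentrated)

end
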